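(* Let $E$ be a complex Banach space and let $C\in L(E)$ be injective. (i) Suppose that $\mathcal{G}$ is a $C$-distribution semigroup in $E$ with generator $A$, and that $\mathcal{G}$ is $\tilde{E}$-almost periodic for some linear subspace $\tilde{E}$ of $Z(A)$. Put $$P_rx:=\lim_{t\to\infty}\frac1t\int_0^te^{-irs}G(\delta_s)x\,ds,\qquad r\in\mathbb{R},\ x\in\tilde{E}.$$ Then $AP_rx=irP_rx$ for all $r\in\mathbb{R}$ and $x\in\tilde{E}$. Furthermore, if $\tilde{E}$ is dense in $E$, then the set $D$ of all eigenvectors of $A$ corresponding to purely imaginary eigenvalues (i.e. eigenvalues in $i\mathbb{R}$, zero included) is total in $E$, i.e. the linear span of $D$ is dense in $E$. (ii) Suppose that $\mathbf{G}$ is a $C$-distribution cosine function in $E$ with generator $A$, and that $\mathbf{G}$ is $\tilde{E}$-almost periodic for some linear subspace $\tilde{E}$ of $Z_2(A)$. For every $r\in\mathbb{R}$ and $x\in\tilde{E}$ put $$P_rx:=\lim_{t\to\infty}\frac1t\int_0^te^{-irs}G(\delta_s)x\,ds.$$ Then $AP_rx=-r^2P_rx$ for all $r\in\mathbb{R}$ and $x\in\tilde{E}$. Furthermore, if $\tilde{E}$ is dense in $E$, then the set $H$ of all eigenvectors of $A$ corresponding to real non-positive eigenvalues is total in $E$.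
   Context: **Test functions and distributions.** $E$ is a complex Banach space, $L(E)$ the bounded linear operators on $E$, $C\in L(E)$ is injective. $\mathcal{D}=C_0^\infty(\mathbb{R})$ with its usual inductive limit topology; $\mathcal{D}_0$ is the set of $\varphi\in\mathcal{D}$ with $\mathrm{supp}(\varphi)\subseteq[0,\infty)$. For a Banach space $X$, $\mathcal{D}'(X)$ is the space of continuous linear maps $\mathcal{D}\to X$, and $\mathcal{D}'_0(X)$ is the subspace of those with support in $[0,\infty)$. For $\varphi,\psi\in\mathcal{D}$, $(\varphi*_0\psi)(t):=\int_0^t\varphi(t-s)\psi(s)\,ds$, $t\in\mathbb{R}$. **$C$-distribution semigroups.** $\mathcal{G}\in\mathcal{D}_0'(L(E))$ with $C\mathcal{G}(\varphi)=\mathcal{G}(\varphi)C$ for all $\varphi\in\mathcal{D}$ is a $C$-distribution semigroup ($(C\text{-DS})$) iff (a) $\mathcal{G}(\varphi*_0\psi)C=\mathcal{G}(\varphi)\mathcal{G}(\psi)$ for all $\varphi,\psi\in\mathcal{D}$, and (b) $\bigcap_{\varphi\in\mathcal{D}_0}N(\mathcal{G}(\varphi))=\{0\}$. For a scalar distribution $T$ with compact support contained in $[0,\infty)$, $G(T)$ is the closed linear operator with graph $$G(T):=\{(x,y)\in E\times E:\ \mathcal{G}(T*\varphi)x=\mathcal{G}(\varphi)y\ \text{ for all }\varphi\in\mathcal{D}_0\}.$$ In particular $G(\delta_t)$, $t\ge0$, is defined using $\delta_t*\varphi=\varphi(\cdot-t)$. The generator of $\mathcal{G}$ is $A:=G(-\delta')$,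 i.e. $(x,y)\in A$ iff $\mathcal{G}(-\varphi')x=\mathcal{G}(\varphi)y$ for all $\varphi\in\mathcal{D}_0$. **Solution space $Z(A)$.** For a closed linear operator $A$, $Z(A)$ is the set of $x\in E$ for which there is $u(\cdot,x)\in C([0,\infty):E)$ with $\int_0^tu(s,x)\,ds\in D(A)$ and $A\int_0^tu(s,x)\,ds=u(t,x)-x$ for all $t\ge0$. If $A$ generates a $(C\text{-DS})$ $\mathcal{G}$, it is known that $Z(A)$ is the set of all $x\in\bigcap_{t\ge0}D(G(\delta_t))$ for which $t\mapsto G(\delta_t)x$, $t\ge 0$, is continuous, and $u(t,x)=G(\delta_t)x$ for $x\in Z(A)$. **$C$-distribution cosine functions.** Fix $\zeta\in\mathcal{D}$ with $\mathrm{supp}(\zeta)\subseteq[-2,-1]$ and $\int\zeta=1$. For $\varphi\in\mathcal{D}$ put $I(\varphi)(s):=\int_{-\infty}^{s}[\varphi(t)-\zeta(t)\int_{-\infty}^\infty\varphi(u)\,du]\,dt\in\mathcal{D}$; for $\mathbf{G}\in\mathcal{D}'(L(E))$ put $\mathbf{G}^{-1}(\varphi):=-\mathbf{G}(I(\varphi))$. An element $\mathbf{G}\in\mathcal{D}'_0(L(E))$ is a $C$-distribution cosine function ($(C\text{-DCF})$) iff $\mathbf{G}(\varphi)C=C\mathbf{G}(\varphi)$ for all $\varphi\in\mathcal{D}$, $\mathbf{G}^{-1}(\varphi*_0\psi)C=\mathbf{G}^{-1}(\varphi)\mathbf{G}(\psi)+\mathbf{G}(\varphi)\mathbf{G}^{-1}(\psi)$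 for all $\varphi,\psi\in\mathcal{D}$, and: $x=y=0$ iff $\mathbf{G}(\varphi)x+\mathbf{G}^{-1}(\varphi)y=0$ for all $\varphi\in\mathcal{D}_0$. Its generator is $A:=\{(x,y)\in E\times E:\ \mathbf{G}^{-1}(\varphi'')x=\mathbf{G}^{-1}(\varphi)y\ \text{for all }\varphi\in\mathcal{D}_0\}$. **$Z_2(A)$ and $G(\delta_t)$ in the cosine case.** $Z_2(A)$ is the set of $x\in E$ for which there is a continuous $u(\cdot;x,0):[0,\infty)\to E$ with $\int_0^t(t-s)u(s;x,0)\,ds\in D(A)$ and $A\int_0^t(t-s)u(s;x,0)\,ds=u(t;x,0)-x$ for all $t\ge0$. If $A$ generates a $(C\text{-DCF})$ $\mathbf{G}$, then it is known that $\mathcal{G}:=\begin{pmatrix}\mathbf{G}&\mathbf{G}^{-1}\\ \mathbf{G}'-\delta\otimes C&\mathbf{G}\end{pmatrix}$ is a $(\mathcal{C}\text{-DS})$ in $E\oplus E$ generated by $\mathcal{A}=\begin{pmatrix} 0 & I \\ A & 0 \end{pmatrix}$, where $\mathcal{C}=\begin{pmatrix} C & 0 \\ 0 & C \end{pmatrix}$; for $x\in Z_2(A)$ and $t\ge0$ one defines $G(\delta_t)x:=\pi_2\big(\mathcal{G}(\delta_t)\binom{0}{x}\big)$, where $\pi_2$ is the projection to the second coordinate and $\mathcal{G}(\delta_t)$ is the closed linear operator in $E\oplus E$ with graph $\{(w,z)\in (E\oplus E)\times(E\oplus E):\ \mathcal{G}(\delta_t*\varphi)w=\mathcal{G}(\varphi)z\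 \text{ for all }\varphi\in\mathcal{D}_0\}$, $\mathcal{G}$ being here this $(\mathcal{C}\text{-DS})$ in $E\oplus E$. One has $G(\delta_t)x=u(t;x,0)$. **Almost periodicity.** A continuous function $f:[0,\infty)\to E$ is almost periodic iff for each $\epsilon>0$ there is $l>0$ such that every subinterval of $[0,\infty)$ of length $l$ contains some $\tau$ with $\|f(t+\tau)-f(t)\|\le\epsilon$ for all $t\ge0$. For such $f$ it is well known that $\lim_{t\to\infty}\frac1t\int_0^te^{-irs}f(s)\,ds$ exists for every $r\in\mathbb{R}$. For a linear subspace $\tilde E$ of $Z(A)$ (semigroup case), resp. of $Z_2(A)$ (cosine case), $\mathcal{G}$, resp. $\mathbf{G}$, is $\tilde E$-almost periodic iff for each $x\in\tilde E$ the mapping $t\mapsto G(\delta_t)x$, $t\ge0$, is almost periodic. *)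

theory Defs
  imports "HOL-Analysis.Analysis"
begin

section \<open>Complex Banach spaces\<close>

class complex_normed_vector = real_normed_vector +
  fixes scaleC :: "complex \<Rightarrow> 'a \<Rightarrow> 'a"  (infixr "*\<^sub>C" 75)
  assumes scaleC_of_real: "complex_of_real r *\<^sub>C x = r *\<^sub>R x"
    and scaleC_add_right: "a *\<^sub>C (x + y) = a *\<^sub>C x + a *\<^sub>C y"
    and scaleC_add_left: "(a + b) *\<^sub>C x = a *\<^sub>C x + b *\<^sub>C x"
    and scaleC_scaleC: "a *\<^sub>C (b *\<^sub>C x) = (a * b) *\<^sub>C x"
    and norm_scaleC: "norm (a *\<^sub>C x) = cmod a * norm x"

class complex_banach = complex_normed_vector + banach

global_interpretation complex_vector: vector_space "scaleC :: complex \<Rightarrow> 'a \<Rightarrow> 'a::complex_normed_vector"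
proof
  fix x :: 'a
  show "1 *\<^sub>C x = x"
    using scaleC_of_real[of 1 x] by simp
qed (simp_all add: scaleC_add_right scaleC_add_left scaleC_scaleC)

lemma scaleC_scaleR_commute: "a *\<^sub>C (r *\<^sub>R x) = r *\<^sub>R (a *\<^sub>C (x :: 'a::complex_normed_vector))"
  by (metis mult.commute scaleC_of_real scaleC_scaleC)

lemma bounded_linear_scaleC: "bounded_linear (\<lambda>x :: 'a::complex_normed_vector. a *\<^sub>C x)"
  by (rule bounded_linear_intro[where K = "cmod a"])
    (simp_all add: scaleC_add_right scaleC_scaleR_commute norm_scaleC mult.commute)

instantiation prod :: (complex_normed_vector, complex_normed_vector) complex_normed_vector
begin

definition scaleC_prod :: "complex \<Rightarrow> 'a \<times> 'b \<Rightarrow> 'a \<times> 'b"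
  where "scaleC_prod a p = (a *\<^sub>C fst p, a *\<^sub>C snd p)"

instance
proof
  fix a b :: complex and r :: real and x y :: "'a \<times> 'b"
  show "complex_of_real r *\<^sub>C x = r *\<^sub>R x"
    by (simp add: scaleC_prod_def scaleC_of_real prod_eq_iff)
  show "a *\<^sub>C (x + y) = a *\<^sub>C x + a *\<^sub>C y"
    by (simp add: scaleC_prod_def scaleC_add_right)
  show "(a + b) *\<^sub>C x = a *\<^sub>C x + b *\<^sub>C x"
    by (simp add: scaleC_prod_def scaleC_add_left)
  show "a *\<^sub>C (b *\<^sub>C x) = (a * b) *\<^sub>C x"
    by (simp add: scaleC_prod_def scaleC_scaleC)
  have "(cmod a * norm (fst x))\<^sup>2 + (cmod a * norm (snd x))\<^sup>2
      = (cmod a)\<^sup>2 * ((norm (fst x))\<^sup>2 + (norm (snd x))\<^sup>2)"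
    by (simp add: power_mult_distrib algebra_simps)
  then show "norm (a *\<^sub>C x) = cmod a * norm x"
    by (simp add: scaleC_prod_def norm_prod_def norm_scaleC real_sqrt_mult)
qed

end

instance prod :: (complex_banach, complex_banach) complex_banach ..

instantiation blinfun :: (real_normed_vector, complex_normed_vector) complex_normed_vector
begin

lift_definition scaleC_blinfun :: "complex \<Rightarrow> ('a \<Rightarrow>\<^sub>L 'b) \<Rightarrow> ('a \<Rightarrow>\<^sub>L 'b)"
  is "\<lambda>a T x. a *\<^sub>C T x"
  by (rule bounded_linear_compose[OF bounded_linear_scaleC])

instance
proof
  fix a b :: complex and r :: real and T S :: "'a \<Rightarrow>\<^sub>L 'b"
  have le: "norm (c *\<^sub>C R) \<le> cmod c * norm R" for c and R :: "'a \<Rightarrow>\<^sub>L 'b"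
    by (rule norm_blinfun_bound)
      (simp_all add: scaleC_blinfun.rep_eq norm_scaleC mult.assoc mult_left_mono norm_blinfun)
  show "complex_of_real r *\<^sub>C T = r *\<^sub>R T"
    by transfer (simp add: scaleC_of_real)
  show "a *\<^sub>C (T + S) = a *\<^sub>C T + a *\<^sub>C S"
    by transfer (simp add: scaleC_add_right)
  show "(a + b) *\<^sub>C T = a *\<^sub>C T + b *\<^sub>C T"
    by transfer (simp add: scaleC_add_left)
  show assoc: "a *\<^sub>C (b *\<^sub>C T) = (a * b) *\<^sub>C T" for a b and T :: "'a \<Rightarrow>\<^sub>L 'b"
    by transfer (simp add: scaleC_scaleC)
  show "norm (a *\<^sub>C T) = cmod a * norm T"
  proof (cases "a = 0")
    case True
    then show ?thesis using le[of a T] by simp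
  next
    case False
    have one: "(1 :: complex) *\<^sub>C T = T"
      by (intro blinfun_eqI) (simp add: scaleC_blinfun.rep_eq)
    have "norm T = norm (inverse a *\<^sub>C (a *\<^sub>C T))"
      using False by (simp add: assoc one)
    also have "\<dots> \<le> cmod (inverse a) * norm (a *\<^sub>C T)"
      by (rule le)
    finally have "cmod a * norm T \<le> norm (a *\<^sub>C T)"
      using False by (simp add: norm_inverse norm_divide field_simps)
    with le[of a T] show ?thesis by simp
  qed
qed

end

text \<open>The type \<open>'a \<Rightarrow>\<^sub>L 'b\<close> consists of the real-linear bounded operators; \<open>L(E)\<close> is the
  following subset.\<close>

definition bounded_clinear_ops :: "('a::complex_normed_vector \<Rightarrow>\<^sub>L 'b::complex_normed_vector) set"
  where "bounded_clinear_ops = {T. \<forall>a x. blinfun_apply T (a *\<^sub>C x) = a *\<^sub>C blinfun_apply T x}"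

definition block_op ::
  "('a::real_normed_vector \<Rightarrow>\<^sub>L 'a) \<Rightarrow> ('a \<Rightarrow>\<^sub>L 'a) \<Rightarrow> ('a \<Rightarrow>\<^sub>L 'a) \<Rightarrow> ('a \<Rightarrow>\<^sub>L 'a) \<Rightarrow> (('a \<times> 'a) \<Rightarrow>\<^sub>L ('a \<times> 'a))"
  where "block_op T11 T12 T21 T22 = Blinfun (\<lambda>p.
           (blinfun_apply T11 (fst p) + blinfun_apply T12 (snd p),
            blinfun_apply T21 (fst p) + blinfun_apply T22 (snd p)))"

lemma block_op_apply:
  "blinfun_apply (block_op T11 T12 T21 T22) (x, y) =
     (blinfun_apply T11 x + blinfun_apply T12 y, blinfun_apply T21 x + blinfun_apply T22 y)"
proof -
  have "bounded_linear (\<lambda>p. (blinfun_apply T11 (fst p) + blinfun_apply T12 (snd p),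
      blinfun_apply T21 (fst p) + blinfun_apply T22 (snd p)))"
    by (intro bounded_linear_Pair bounded_linear_add
        bounded_linear_compose[OF blinfun.bounded_linear_right bounded_linear_fst]
        bounded_linear_compose[OF blinfun.bounded_linear_right bounded_linear_snd])
  then show ?thesis
    by (simp add: block_op_def bounded_linear_Blinfun_apply)
qed


section \<open>Test functions\<close>

text \<open>Test functions are total functions on \<open>\<real>\<close>; distributions are functions on all of \<open>\<real> \<Rightarrow> \<complex>\<close> whose values outside \<open>test_funs\<close> are irrelevant.\<close>

definition vderiv :: "(real \<Rightarrow> complex) \<Rightarrow> real \<Rightarrow> complex"
  where "vderiv \<phi> = (\<lambda>t. vector_derivative \<phi> (at t))"

definition smooth :: "(real \<Rightarrow> complex) \<Rightarrow> bool"
  where "smooth \<phi> \<longleftrightarrow> (\<forall>n t. (vderiv ^^ n) \<phi> differentiable (at t))"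

definition fun_supp :: "(real \<Rightarrow> complex) \<Rightarrow> real set"
  where "fun_supp \<phi> = closure {t. \<phi> t \<noteq> 0}"

definition test_funs :: "(real \<Rightarrow> complex) set"
  where "test_funs = {\<phi>. smooth \<phi> \<and> compact (fun_supp \<phi>)}"

definition test_funs_on :: "real set \<Rightarrow> (real \<Rightarrow> complex) set"
  where "test_funs_on K = {\<phi> \<in> test_funs. fun_supp \<phi> \<subseteq> K}"

abbreviation test_funs0 :: "(real \<Rightarrow> complex) set"
  where "test_funs0 \<equiv> test_funs_on {0..}"

text \<open>The usual topology of \<open>\<D>\<close>: it is the locally convex inductive limit of the Frechet spaces
  \<open>\<D>\<^sub>K\<close> (\<open>K\<close> compact), so that a base of neighbourhoods of 0 is formed by the absolutely convex sets
  \<open>V\<close> whose trace on each \<open>\<D>\<^sub>K\<close> is a neighbourhood of 0 in \<open>\<D>\<^sub>K\<close>.\<close>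

definition zero_nhd_on :: "real set \<Rightarrow> (real \<Rightarrow> complex) set \<Rightarrow> bool"
  where "zero_nhd_on K V \<longleftrightarrow> (\<exists>n. \<exists>e>0. \<forall>\<phi> \<in> test_funs_on K.
           (\<forall>j\<le>n. \<forall>t. cmod ((vderiv ^^ j) \<phi> t) < e) \<longrightarrow> \<phi> \<in> V)"

definition abs_convex :: "(real \<Rightarrow> complex) set \<Rightarrow> bool"
  where "abs_convex V \<longleftrightarrow> (\<forall>\<phi>\<in>V. \<forall>\<psi>\<in>V. \<forall>a b. cmod a + cmod b \<le> 1 \<longrightarrow> (\<lambda>t. a * \<phi> t + b * \<psi> t) \<in> V)"

definition basic_zero_nhd :: "(real \<Rightarrow> complex) set \<Rightarrow> bool"
  where "basic_zero_nhd V \<longleftrightarrow> V \<subseteq> test_funs \<and> abs_convex V \<and> (\<forall>K. compact K \<longrightarrow> zero_nhd_on K V)"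

definition test_open :: "(real \<Rightarrow> complex) set \<Rightarrow> bool"
  where "test_open U \<longleftrightarrow> U \<subseteq> test_funs \<and>
           (\<forall>\<phi>\<in>U. \<exists>V. basic_zero_nhd V \<and> (\<forall>\<psi>\<in>V. (\<lambda>t. \<phi> t + \<psi> t) \<in> U))"

definition test_topology :: "(real \<Rightarrow> complex) topology"
  where "test_topology = topology test_open"

lemma zero_nhd_on_Int:
  assumes "zero_nhd_on K V" "zero_nhd_on K W"
  shows "zero_nhd_on K (V \<inter> W)"
proof -
  obtain n e where 1: "e > 0" "\<And>\<phi>. \<phi> \<in> test_funs_on K \<Longrightarrow> \<forall>j\<le>n. \<forall>t. cmod ((vderiv ^^ j) \<phi> t) < e \<Longrightarrow> \<phi> \<in> V"
    using assms(1) unfolding zero_nhd_on_def by blast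
  obtain m d where 2: "d > 0" "\<And>\<phi>. \<phi> \<in> test_funs_on K \<Longrightarrow> \<forall>j\<le>m. \<forall>t. cmod ((vderiv ^^ j) \<phi> t) < d \<Longrightarrow> \<phi> \<in> W"
    using assms(2) unfolding zero_nhd_on_def by blast
  show ?thesis
    unfolding zero_nhd_on_def
  proof (intro exI[of _ "max n m"] exI[of _ "min e d"] conjI ballI impI)
    fix \<phi> assume "\<phi> \<in> test_funs_on K" "\<forall>j\<le>max n m. \<forall>t. cmod ((vderiv ^^ j) \<phi> t) < min e d"
    then show "\<phi> \<in> V \<inter> W"
      using 1(2)[of \<phi>] 2(2)[of \<phi>] by simp
  qed (use 1 2 in auto)
qed

lemma basic_zero_nhd_Int: "basic_zero_nhd V \<Longrightarrow> basic_zero_nhd W \<Longrightarrow> basic_zero_nhd (V \<inter> W)"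
  by (auto simp: basic_zero_nhd_def abs_convex_def zero_nhd_on_Int)

lemma istopology_test_open: "istopology test_open"
  unfolding istopology_def
proof (intro conjI allI impI)
  fix S T assume ST: "test_open S" "test_open T"
  show "test_open (S \<inter> T)"
    unfolding test_open_def
  proof (intro conjI ballI)
    show "S \<inter> T \<subseteq> test_funs"
      using ST by (auto simp: test_open_def)
    fix \<phi> assume "\<phi> \<in> S \<inter> T"
    then obtain V W where "basic_zero_nhd V" "\<forall>\<psi>\<in>V. (\<lambda>t. \<phi> t + \<psi> t) \<in> S"
      "basic_zero_nhd W" "\<forall>\<psi>\<in>W. (\<lambda>t. \<phi> t + \<psi> t) \<in> T"
      using ST by (auto simp: test_open_def) meson
    then show "\<exists>V. basic_zero_nhd V \<and> (\<forall>\<psi>\<in>V. (\<lambda>t. \<phi> t + \<psi> t) \<in> S \<inter> T)"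
      by (intro exI[of _ "V \<inter> W"]) (auto simp: basic_zero_nhd_Int)
  qed
next
  fix \<K> assume "\<forall>U\<in>\<K>. test_open U"
  then show "test_open (\<Union>\<K>)"
    unfolding test_open_def by (meson Sup_least Union_iff)
qed

lemma openin_test_topology: "openin test_topology = test_open"
  by (simp add: test_topology_def istopology_test_open)

lemma vderiv_apply: "vderiv \<phi> t = vector_derivative \<phi> (at t)"
  by (simp add: vderiv_def)

lemma vderiv_lincomb:
  assumes "smooth \<phi>" "smooth \<psi>"
  shows "(vderiv ^^ n) (\<lambda>t. a * \<phi> t + b * \<psi> t) = (\<lambda>t. a * (vderiv ^^ n) \<phi> t + b * (vderiv ^^ n) \<psi> t)"
proof (induction n)
  case (Suc n)
  show ?case
  proof
    fix t
    have "((vderiv ^^ n) \<phi> has_vector_derivative (vderiv ^^ Suc n) \<phi> t) (at t)"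
      using assms(1) by (simp add: smooth_def vderiv_apply vector_derivative_works[symmetric])
    moreover have "((vderiv ^^ n) \<psi> has_vector_derivative (vderiv ^^ Suc n) \<psi> t) (at t)"
      using assms(2) by (simp add: smooth_def vderiv_apply vector_derivative_works[symmetric])
    ultimately have "((\<lambda>t. a * (vderiv ^^ n) \<phi> t + b * (vderiv ^^ n) \<psi> t) has_vector_derivative
        a * (vderiv ^^ Suc n) \<phi> t + b * (vderiv ^^ Suc n) \<psi> t) (at t)"
      by (intro has_vector_derivative_add has_vector_derivative_mult_right)
    then have "vderiv (\<lambda>t. a * (vderiv ^^ n) \<phi> t + b * (vderiv ^^ n) \<psi> t) t
        = a * (vderiv ^^ Suc n) \<phi> t + b * (vderiv ^^ Suc n) \<psi> t"
      by (subst vderiv_apply) (rule vector_derivative_at)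
    then show "(vderiv ^^ Suc n) (\<lambda>t. a * \<phi> t + b * \<psi> t) t
        = a * (vderiv ^^ Suc n) \<phi> t + b * (vderiv ^^ Suc n) \<psi> t"
      using Suc by simp
  qed
qed simp

lemma test_funs_lincomb:
  assumes "\<phi> \<in> test_funs" "\<psi> \<in> test_funs"
  shows "(\<lambda>t. a * \<phi> t + b * \<psi> t) \<in> test_funs"
proof -
  have sm: "smooth \<phi>" "smooth \<psi>"
    using assms by (auto simp: test_funs_def)
  have "smooth (\<lambda>t. a * \<phi> t + b * \<psi> t)"
    using sm by (simp add: smooth_def vderiv_lincomb)
  moreover have "fun_supp (\<lambda>t. a * \<phi> t + b * \<psi> t) \<subseteq> fun_supp \<phi> \<union> fun_supp \<psi>"
    unfolding fun_supp_def closure_Un[symmetric] by (rule closure_mono) auto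
  then have "compact (fun_supp (\<lambda>t. a * \<phi> t + b * \<psi> t))"
    using assms compact_Un[of "fun_supp \<phi>" "fun_supp \<psi>"]
    by (metis (mono_tags, lifting) closed_closure compact_Int_closed fun_supp_def inf.absorb_iff2
        mem_Collect_eq test_funs_def)
  ultimately show ?thesis
    by (simp add: test_funs_def)
qed

lemma topspace_test_topology: "topspace test_topology = test_funs"
proof -
  have "basic_zero_nhd test_funs"
    by (auto simp: basic_zero_nhd_def abs_convex_def zero_nhd_on_def test_funs_lincomb test_funs_on_def
        intro: exI[of _ 0] exI[of _ 1])
  moreover have "(\<lambda>t. \<phi> t + \<psi> t) \<in> test_funs" if "\<phi> \<in> test_funs" "\<psi> \<in> test_funs" for \<phi> \<psi>
    using test_funs_lincomb[OF that, of 1 1] by simp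
  ultimately have "test_open test_funs"
    unfolding test_open_def by blast
  moreover have "U \<subseteq> test_funs" if "test_open U" for U
    using that by (simp add: test_open_def)
  ultimately show ?thesis
    unfolding topspace_def openin_test_topology by blast
qed

definition conv0 :: "(real \<Rightarrow> complex) \<Rightarrow> (real \<Rightarrow> complex) \<Rightarrow> real \<Rightarrow> complex"  (infixl "*\<^sub>0" 70)
  where "(\<phi> *\<^sub>0 \<psi>) t = (if 0 \<le> t then integral {0..t} (\<lambda>s. \<phi> (t - s) * \<psi> s)
                      else - integral {t..0} (\<lambda>s. \<phi> (t - s) * \<psi> s))"


section \<open>Distributions\<close>

definition distribution :: "((real \<Rightarrow> complex) \<Rightarrow> 'x::complex_normed_vector) \<Rightarrow> bool"
  where "distribution T \<longleftrightarrow> continuous_map test_topology euclidean T \<and>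
           (\<forall>\<phi>\<in>test_funs. \<forall>\<psi>\<in>test_funs. \<forall>a b.
              T (\<lambda>t. a * \<phi> t + b * \<psi> t) = a *\<^sub>C T \<phi> + b *\<^sub>C T \<psi>)"

definition dist_supp :: "((real \<Rightarrow> complex) \<Rightarrow> 'x::complex_normed_vector) \<Rightarrow> real set"
  where "dist_supp T = - \<Union>{U. open U \<and> (\<forall>\<phi>\<in>test_funs_on U. T \<phi> = 0)}"

text \<open>\<open>\<D>'\<^sub>0(L(E))\<close>\<close>

definition op_distribution0 :: "((real \<Rightarrow> complex) \<Rightarrow> ('a::complex_normed_vector \<Rightarrow>\<^sub>L 'a)) \<Rightarrow> bool"
  where "op_distribution0 G \<longleftrightarrow> distribution G \<and> G ` test_funs \<subseteq> bounded_clinear_ops \<and> dist_supp G \<subseteq> {0..}"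

definition dirac :: "real \<Rightarrow> (real \<Rightarrow> complex) \<Rightarrow> complex"
  where "dirac t \<phi> = \<phi> t"

definition dist_deriv :: "((real \<Rightarrow> complex) \<Rightarrow> 'x::ab_group_add) \<Rightarrow> (real \<Rightarrow> complex) \<Rightarrow> 'x"
  where "dist_deriv T \<phi> = - T (vderiv \<phi>)"

definition dist_conv :: "((real \<Rightarrow> complex) \<Rightarrow> complex) \<Rightarrow> (real \<Rightarrow> complex) \<Rightarrow> real \<Rightarrow> complex"
  where "dist_conv T \<phi> = (\<lambda>t. T (\<lambda>s. \<phi> (t - s)))"

lemma dist_conv_dirac: "dist_conv (dirac t) \<phi> = (\<lambda>s. \<phi> (s - t))"
  by (simp add: dist_conv_def dirac_def)

lemma dist_conv_uminus_deriv_dirac: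
  assumes "\<phi> \<in> test_funs"
  shows "dist_conv (\<lambda>\<psi>. - dist_deriv (dirac 0) \<psi>) \<phi> = (\<lambda>t. - vderiv \<phi> t)"
proof
  fix t
  have "(vderiv ^^ 0) \<phi> differentiable (at t)"
    using assms unfolding test_funs_def smooth_def by blast
  then have "(\<phi> has_vector_derivative vderiv \<phi> t) (at (t - 0))"
    by (simp add: vderiv_def vector_derivative_works[symmetric])
  then have "((\<phi> \<circ> (\<lambda>s. t - s)) has_vector_derivative (-1) *\<^sub>R vderiv \<phi> t) (at 0)"
    by (intro vector_diff_chain_at) (auto intro!: derivative_eq_intros)
  then have "vderiv (\<lambda>s. \<phi> (t - s)) 0 = - vderiv \<phi> t"
    by (simp add: vderiv_def o_def vector_derivative_at)
  then show "dist_conv (\<lambda>\<psi>. - dist_deriv (dirac 0) \<psi>) \<phi> t = - vderiv \<phi> t"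
    by (simp add: dist_conv_def dist_deriv_def dirac_def)
qed


section \<open>Closed operators as graphs\<close>

text \<open>\<open>graph_app A x\<close> is only meaningful for single-valued \<open>A\<close> and \<open>x\<close> in its domain \<open>Domain A\<close>.\<close>

definition graph_app :: "('a \<times> 'b) set \<Rightarrow> 'a \<Rightarrow> 'b"
  where "graph_app A x = (THE y. (x, y) \<in> A)"

definition eigenvectors :: "('a::complex_normed_vector \<times> 'a) set \<Rightarrow> complex \<Rightarrow> 'a set"
  where "eigenvectors A l = {x. x \<noteq> 0 \<and> (x, l *\<^sub>C x) \<in> A}"

definition total_set :: "'a::complex_normed_vector set \<Rightarrow> bool"
  where "total_set S \<longleftrightarrow> closure (complex_vector.span S) = UNIV"

definition Z_space :: "('a::complex_banach \<times> 'a) set \<Rightarrow> 'a set"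
  where "Z_space A = {x. \<exists>u :: real \<Rightarrow> 'a. continuous_on {0..} u \<and>
           (\<forall>t\<ge>0. (integral {0..t} u, u t - x) \<in> A)}"

definition Z2_space :: "('a::complex_banach \<times> 'a) set \<Rightarrow> 'a set"
  where "Z2_space A = {x. \<exists>u :: real \<Rightarrow> 'a. continuous_on {0..} u \<and>
           (\<forall>t\<ge>0. (integral {0..t} (\<lambda>s. (t - s) *\<^sub>R u s), u t - x) \<in> A)}"


section \<open>\<open>C\<close>-distribution semigroups\<close>

definition C_DS :: "('a::complex_banach \<Rightarrow>\<^sub>L 'a) \<Rightarrow> ((real \<Rightarrow> complex) \<Rightarrow> ('a \<Rightarrow>\<^sub>L 'a)) \<Rightarrow> bool"
  where "C_DS C G \<longleftrightarrow> op_distribution0 G \<and>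
           (\<forall>\<phi>\<in>test_funs. C o\<^sub>L G \<phi> = G \<phi> o\<^sub>L C) \<and>
           (\<forall>\<phi>\<in>test_funs. \<forall>\<psi>\<in>test_funs. G (\<phi> *\<^sub>0 \<psi>) o\<^sub>L C = G \<phi> o\<^sub>L G \<psi>) \<and>
           (\<Inter>\<phi>\<in>test_funs0. {x. blinfun_apply (G \<phi>) x = 0}) = {0}"

text \<open>The operator \<open>G(T)\<close> for a scalar distribution \<open>T\<close> with compact support in \<open>[0,\<infinity>)\<close>.\<close>

definition dist_op ::
  "((real \<Rightarrow> complex) \<Rightarrow> ('a::complex_banach \<Rightarrow>\<^sub>L 'a)) \<Rightarrow> ((real \<Rightarrow> complex) \<Rightarrow> complex) \<Rightarrow> ('a \<times> 'a) set"
  where "dist_op G T = {(x, y). \<forall>\<phi>\<in>test_funs0.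
           blinfun_apply (G (dist_conv T \<phi>)) x = blinfun_apply (G \<phi>) y}"

definition DS_generator :: "((real \<Rightarrow> complex) \<Rightarrow> ('a::complex_banach \<Rightarrow>\<^sub>L 'a)) \<Rightarrow> ('a \<times> 'a) set"
  where "DS_generator G = dist_op G (\<lambda>\<psi>. - dist_deriv (dirac 0) \<psi>)"

lemma DS_generator_iff:
  "(x, y) \<in> DS_generator G \<longleftrightarrow>
     (\<forall>\<phi>\<in>test_funs0. blinfun_apply (G (\<lambda>t. - vderiv \<phi> t)) x = blinfun_apply (G \<phi>) y)"
  by (auto simp: DS_generator_def dist_op_def dist_conv_uminus_deriv_dirac test_funs_on_def)

definition DS_orbit :: "((real \<Rightarrow> complex) \<Rightarrow> ('a::complex_banach \<Rightarrow>\<^sub>L 'a)) \<Rightarrow> 'a \<Rightarrow> real \<Rightarrow> 'a"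
  where "DS_orbit G x t = graph_app (dist_op G (dirac t)) x"


section \<open>\<open>C\<close>-distribution cosine functions\<close>

definition zeta_fun :: "(real \<Rightarrow> complex) \<Rightarrow> bool"
  where "zeta_fun \<zeta> \<longleftrightarrow> \<zeta> \<in> test_funs_on {-2..-1} \<and> integral UNIV \<zeta> = 1"

text \<open>\<open>antideriv \<zeta>\<close> is \<open>I\<close> and \<open>dist_prim \<zeta> G\<close> is \<open>G\<^sup>-\<^sup>1\<close>, both taken with respect to the fixed \<open>\<zeta>\<close>.\<close>

definition antideriv :: "(real \<Rightarrow> complex) \<Rightarrow> (real \<Rightarrow> complex) \<Rightarrow> real \<Rightarrow> complex"
  where "antideriv \<zeta> \<phi> = (\<lambda>s. integral {..s} (\<lambda>t. \<phi> t - \<zeta> t * integral UNIV \<phi>))"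

definition dist_prim ::
  "(real \<Rightarrow> complex) \<Rightarrow> ((real \<Rightarrow> complex) \<Rightarrow> 'x::ab_group_add) \<Rightarrow> (real \<Rightarrow> complex) \<Rightarrow> 'x"
  where "dist_prim \<zeta> G \<phi> = - G (antideriv \<zeta> \<phi>)"

definition C_DCF ::
  "(real \<Rightarrow> complex) \<Rightarrow> ('a::complex_banach \<Rightarrow>\<^sub>L 'a) \<Rightarrow> ((real \<Rightarrow> complex) \<Rightarrow> ('a \<Rightarrow>\<^sub>L 'a)) \<Rightarrow> bool"
  where "C_DCF \<zeta> C G \<longleftrightarrow> op_distribution0 G \<and>
           (\<forall>\<phi>\<in>test_funs. G \<phi> o\<^sub>L C = C o\<^sub>L G \<phi>) \<and>
           (\<forall>\<phi>\<in>test_funs. \<forall>\<psi>\<in>test_funs.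
              dist_prim \<zeta> G (\<phi> *\<^sub>0 \<psi>) o\<^sub>L C = (dist_prim \<zeta> G \<phi> o\<^sub>L G \<psi>) + (G \<phi> o\<^sub>L dist_prim \<zeta> G \<psi>)) \<and>
           (\<forall>x y. (x = 0 \<and> y = 0) \<longleftrightarrow>
              (\<forall>\<phi>\<in>test_funs0. blinfun_apply (G \<phi>) x + blinfun_apply (dist_prim \<zeta> G \<phi>) y = 0))"

definition DCF_generator ::
  "(real \<Rightarrow> complex) \<Rightarrow> ((real \<Rightarrow> complex) \<Rightarrow> ('a::complex_banach \<Rightarrow>\<^sub>L 'a)) \<Rightarrow> ('a \<times> 'a) set"
  where "DCF_generator \<zeta> G = {(x, y). \<forall>\<phi>\<in>test_funs0.
           blinfun_apply (dist_prim \<zeta> G (vderiv (vderiv \<phi>))) x = blinfun_apply (dist_prim \<zeta> G \<phi>) y}"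

text \<open>The matrix with rows \<open>(G, G\<^sup>-\<^sup>1)\<close> and \<open>(G' - \<delta> \<otimes> C, G)\<close>, where \<open>(\<delta> \<otimes> C)(\<phi>) = \<phi>(0) C\<close>.\<close>

definition DCF_matrix ::
  "(real \<Rightarrow> complex) \<Rightarrow> ('a::complex_banach \<Rightarrow>\<^sub>L 'a) \<Rightarrow> ((real \<Rightarrow> complex) \<Rightarrow> ('a \<Rightarrow>\<^sub>L 'a)) \<Rightarrow>
     (real \<Rightarrow> complex) \<Rightarrow> (('a \<times> 'a) \<Rightarrow>\<^sub>L ('a \<times> 'a))"
  where "DCF_matrix \<zeta> C G \<phi> =
           block_op (G \<phi>) (dist_prim \<zeta> G \<phi>) (dist_deriv G \<phi> - dirac 0 \<phi> *\<^sub>C C) (G \<phi>)"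

definition DCF_orbit ::
  "(real \<Rightarrow> complex) \<Rightarrow> ('a::complex_banach \<Rightarrow>\<^sub>L 'a) \<Rightarrow> ((real \<Rightarrow> complex) \<Rightarrow> ('a \<Rightarrow>\<^sub>L 'a)) \<Rightarrow> 'a \<Rightarrow> real \<Rightarrow> 'a"
  where "DCF_orbit \<zeta> C G x t = snd (graph_app (dist_op (DCF_matrix \<zeta> C G) (dirac t)) (0, x))"


section \<open>Almost periodicity\<close>

definition almost_periodic :: "(real \<Rightarrow> 'a::complex_banach) \<Rightarrow> bool"
  where "almost_periodic f \<longleftrightarrow> continuous_on {0..} f \<and>
           (\<forall>\<epsilon>>0. \<exists>l>0. \<forall>a\<ge>0. \<exists>\<tau>\<in>{a..a + l}. \<forall>t\<ge>0. norm (f (t + \<tau>) - f t) \<le> \<epsilon>)"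

definition DS_almost_periodic :: "((real \<Rightarrow> complex) \<Rightarrow> ('a::complex_banach \<Rightarrow>\<^sub>L 'a)) \<Rightarrow> 'a set \<Rightarrow> bool"
  where "DS_almost_periodic G E' \<longleftrightarrow> (\<forall>x\<in>E'. almost_periodic (DS_orbit G x))"

definition DCF_almost_periodic ::
  "(real \<Rightarrow> complex) \<Rightarrow> ('a::complex_banach \<Rightarrow>\<^sub>L 'a) \<Rightarrow> ((real \<Rightarrow> complex) \<Rightarrow> ('a \<Rightarrow>\<^sub>L 'a)) \<Rightarrow> 'a set \<Rightarrow> bool"
  where "DCF_almost_periodic \<zeta> C G E' \<longleftrightarrow> (\<forall>x\<in>E'. almost_periodic (DCF_orbit \<zeta> C G x))"

definition bohr_mean :: "real \<Rightarrow> (real \<Rightarrow> 'a::complex_banach) \<Rightarrow> 'a"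
  where "bohr_mean r f =
           Lim at_top (\<lambda>t. (1 / t) *\<^sub>R integral {0..t} (\<lambda>s. exp (- (\<i> * of_real r * of_real s)) *\<^sub>C f s))"

end

theory Submission
  imports Defs
begin

text \<open>
  The orbit \<open>u(t) = G(\<delta>\<^sub>t)x\<close> satisfies \<open>\<G>(\<phi>)u(t) = \<G>(\<phi>(\<cdot> - t))x\<close>, because
  \<open>s \<mapsto> \<G>(\<phi>(\<cdot> - (t - s)))u(s)\<close> has derivative zero. For fixed \<open>\<phi>\<close> the function \<open>y = \<G>(\<phi>)u\<close> is
  bounded with \<open>y' = \<G>(-\<phi>')u\<close>, so integrating \<open>e\<^sup>-\<^sup>i\<^sup>r\<^sup>sy'(s)\<close> by parts and dividing by \<open>t\<close> gives
  \<open>AP\<^sub>rx = irP\<^sub>rx\<close>. In the cosine case \<open>y = \<G>\<^sup>-\<^sup>1(\<phi>)u\<close> is bounded with bounded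
  second derivative, hence with bounded first derivative, and one integrates by parts twice.

  Totality amounts to \<open>f(0)\<close> lying in the closure of any subspace \<open>Y\<close> that contains all Bohr means
  of the almost periodic function \<open>f\<close>. Let \<open>S\<close> be the set of \<open>n < N\<close> such that \<open>nh\<close> is an
  \<open>\<epsilon>\<close>-almost period, \<open>Nh\<close> being one as well. Averaging \<open>f(((n - k) mod N)h)\<close> over \<open>n, k \<in> S\<close>
  changes \<open>f(0)\<close> by \<open>O(\<epsilon>)\<close>, and the discrete Fourier transform on \<open>\<int>/N\<close> turns the average into
  a nonnegative combination of the Fourier coefficients of the sampled \<open>f\<close>, of total mass
  \<open>N/|S| = O(1)\<close>. These coefficients are close to \<open>Y\<close> uniformly in the
  frequency once \<open>N\<close> is large, by compactness of the frequency range.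
\<close>

text \<open>The order of choices shapes the totality argument. The total mass N/|S| has to be
  bounded before the accuracy of the Fourier coefficients is fixed, while that accuracy dictates the
  step h, on which S depends. The way out is a lower density of S that does not depend on h: an
  almost period can be moved by any amount up to some \<delta> determined by f and \<epsilon> alone,
  so a finer grid meets S proportionally more often. The N frequencies of the transform have modulus
  at most \<pi>/h, which makes the frequency range compact, and Nh has to be an almost period
  because differences of indices wrap around modulo N.

  Uniformity in the frequency is claimed only for the distance to Y. The means themselves do not
  converge locally uniformly in r, since r \<mapsto> P_r x is in general discontinuous. A shift by
  an almost period, or a small change of frequency on a block, multiplies an integral nearly by a
  phase; this spoils convergence but is invisible to a complex subspace.\<close>

lemma bounded_bilinear_scaleC:
  "bounded_bilinear (scaleC :: complex \<Rightarrow> 'a \<Rightarrow> 'a::complex_normed_vector)"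
proof
  fix a b :: complex and x y :: 'a and r :: real
  show "(r *\<^sub>R a) *\<^sub>C x = r *\<^sub>R (a *\<^sub>C x)"
    by (metis scaleC_of_real scaleC_scaleC scaleR_conv_of_real)
  show "\<exists>K. \<forall>a (x::'a). norm (a *\<^sub>C x) \<le> norm a * norm x * K"
    by (rule exI[of _ 1]) (simp add: norm_scaleC)
qed (simp_all add: scaleC_add_left scaleC_add_right scaleC_scaleR_commute)

lemmas continuous_on_scaleC [continuous_intros] =
  bounded_bilinear.continuous_on[OF bounded_bilinear_scaleC]

lemma scaleC_diff_right: "a *\<^sub>C (x - y) = a *\<^sub>C x - a *\<^sub>C (y :: 'a::complex_normed_vector)"
  by (rule bounded_bilinear.diff_right[OF bounded_bilinear_scaleC])

lemma scaleC_diff_left: "(a - b) *\<^sub>C x = a *\<^sub>C x - b *\<^sub>C (x :: 'a::complex_normed_vector)"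
  by (rule bounded_bilinear.diff_left[OF bounded_bilinear_scaleC])

lemma scaleC_sum_right:
  "a *\<^sub>C (\<Sum>i\<in>I. f i) = (\<Sum>i\<in>I. a *\<^sub>C (f i :: 'a::complex_normed_vector))"
  by (rule bounded_bilinear.sum_right[OF bounded_bilinear_scaleC])

lemma scaleC_sum_left:
  "(\<Sum>i\<in>I. f i) *\<^sub>C x = (\<Sum>i\<in>I. f i *\<^sub>C (x :: 'a::complex_normed_vector))"
  by (rule bounded_bilinear.sum_left[OF bounded_bilinear_scaleC])

lemma integral_scaleC:
  fixes f :: "real \<Rightarrow> 'a::complex_banach"
  assumes "f integrable_on S"
  shows "integral S (\<lambda>s. c *\<^sub>C f s) = c *\<^sub>C integral S f"
  using integral_linear[OF assms bounded_linear_scaleC[of c]] by (simp add: o_def)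

section \<open>Almost periodic functions on the half-line, up to the approximation by Bohr
  means\<close>

section \<open>Distance to a subspace\<close>

text \<open>A witness is required instead of a bound on the infimum distance, so that errors of sums
  and multiples follow by combining witnesses. \<open>Y\<close> is not closed in general; closures
  enter only at the end.\<close>

definition near :: "'a::complex_normed_vector set \<Rightarrow> real \<Rightarrow> 'a \<Rightarrow> bool"
  where "near Y e x \<longleftrightarrow> (\<exists>y\<in>Y. norm (x - y) \<le> e)"

lemma near_perturb: "near Y e x \<Longrightarrow> norm (x' - x) \<le> d \<Longrightarrow> near Y (e + d) x'"
  unfolding near_def by (metis add.commute norm_diff_triangle_le)

lemma near_mono: "near Y e x \<Longrightarrow> e \<le> d \<Longrightarrow> near Y d x"
  unfolding near_def by force

lemma near_scale:
  assumes "complex_vector.subspace Y" "near Y e x"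
  shows "near Y (cmod c * e) (c *\<^sub>C x)"
proof -
  obtain y where y: "y \<in> Y" "norm (x - y) \<le> e"
    using assms(2) by (auto simp: near_def)
  have "norm (c *\<^sub>C x - c *\<^sub>C y) \<le> cmod c * e"
    using y by (simp add: scaleC_diff_right[symmetric] norm_scaleC mult_left_mono)
  then show ?thesis
    using complex_vector.subspace_scale[OF assms(1) y(1)] by (auto simp: near_def)
qed

lemma near_sum:
  assumes "complex_vector.subspace Y" "\<And>i. i \<in> I \<Longrightarrow> near Y (e i) (x i)"
  shows "near Y (\<Sum>i\<in>I. e i) (\<Sum>i\<in>I. x i)"
proof -
  obtain y where y: "\<And>i. i \<in> I \<Longrightarrow> y i \<in> Y \<and> norm (x i - y i) \<le> e i"
    using assms(2) unfolding near_def by metis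
  have "norm ((\<Sum>i\<in>I. x i) - (\<Sum>i\<in>I. y i)) \<le> (\<Sum>i\<in>I. e i)"
    unfolding sum_subtractf[symmetric] using y by (intro sum_norm_le) auto
  moreover have "(\<Sum>i\<in>I. y i) \<in> Y"
    using y by (intro complex_vector.subspace_sum[OF assms(1)]) auto
  ultimately show ?thesis by (auto simp: near_def)
qed

section \<open>Almost periods\<close>

definition almost_period :: "(real \<Rightarrow> 'a::real_normed_vector) \<Rightarrow> real \<Rightarrow> real \<Rightarrow> bool"
  where "almost_period f e \<tau> \<longleftrightarrow> 0 \<le> \<tau> \<and> (\<forall>t\<ge>0. norm (f (t + \<tau>) - f t) \<le> e)"

lemma almost_periodicD:
  assumes "almost_periodic f" "e > 0"
  obtains l where "l > 0" "\<And>a. a \<ge> 0 \<Longrightarrow> \<exists>\<tau>\<in>{a..a + l}. almost_period f e \<tau>"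
proof -
  from assms obtain l where "l > 0" "\<forall>a\<ge>0. \<exists>\<tau>\<in>{a..a + l}. \<forall>t\<ge>0. norm (f (t + \<tau>) - f t) \<le> e"
    unfolding almost_periodic_def by blast
  then show ?thesis
    by (intro that[of l]) (fastforce simp: almost_period_def)+
qed

lemma almost_periodicI:
  assumes "continuous_on {0..} f"
    "\<And>e. e > 0 \<Longrightarrow> \<exists>l>0. \<forall>a\<ge>0. \<exists>\<tau>\<in>{a..a + l}. almost_period f e \<tau>"
  shows "almost_periodic f"
  using assms unfolding almost_periodic_def almost_period_def by meson

lemma almost_period_mono: "almost_period f e \<tau> \<Longrightarrow> e \<le> d \<Longrightarrow> almost_period f d \<tau>"
  unfolding almost_period_def by force

lemma almost_period_add:
  assumes "almost_period f e \<tau>" "almost_period f d \<sigma>"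
  shows "almost_period f (e + d) (\<tau> + \<sigma>)"
  unfolding almost_period_def
proof (intro conjI allI impI)
  fix t :: real assume "t \<ge> 0"
  then have "norm (f (t + \<tau> + \<sigma>) - f (t + \<tau>)) \<le> d" "norm (f (t + \<tau>) - f t) \<le> e"
    using assms by (auto simp: almost_period_def)
  then show "norm (f (t + (\<tau> + \<sigma>)) - f t) \<le> e + d"
    using norm_diff_triangle_le by (fastforce simp: add.assoc)
qed (use assms in \<open>auto simp: almost_period_def\<close>)

lemma almost_period_diff:
  assumes "almost_period f e \<tau>" "almost_period f d \<sigma>" "\<sigma> \<le> \<tau>"
  shows "almost_period f (e + d) (\<tau> - \<sigma>)"
  unfolding almost_period_def
proof (intro conjI allI impI)
  fix t :: real assume "t \<ge> 0"
  moreover from this have "0 \<le> t + (\<tau> - \<sigma>)"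
    using assms(3) by simp
  ultimately have "norm (f (t + (\<tau> - \<sigma>) + \<sigma>) - f (t + (\<tau> - \<sigma>))) \<le> d" "norm (f (t + \<tau>) - f t) \<le> e"
    using assms unfolding almost_period_def by blast+
  then show "norm (f (t + (\<tau> - \<sigma>)) - f t) \<le> e + d"
    using norm_diff_triangle_le[of "f (t + (\<tau> - \<sigma>))" "f (t + \<tau>)" d "f t" e]
    by (simp add: norm_minus_commute)
qed (use assms in simp)

lemma almost_period_0: "e \<ge> 0 \<Longrightarrow> almost_period f e 0"
  by (simp add: almost_period_def)

text \<open>For t > l an almost period is picked in [t - l, t]; for t \<le> l the almost period 0
  serves. This replaces the half-line by a compact interval, from which boundedness and uniform
  continuity carry over.\<close>

lemma almost_periodic_reduce:
  assumes "almost_periodic f" "e > 0"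
  obtains l where "l > 0" "\<And>t. t \<ge> 0 \<Longrightarrow> \<exists>s\<in>{0..l}. \<exists>\<tau>. t = s + \<tau> \<and> almost_period f e \<tau>"
proof -
  obtain l where l: "l > 0" "\<And>a. a \<ge> 0 \<Longrightarrow> \<exists>\<tau>\<in>{a..a + l}. almost_period f e \<tau>"
    using almost_periodicD[OF assms] by blast
  have "\<exists>s\<in>{0..l}. \<exists>\<tau>. t = s + \<tau> \<and> almost_period f e \<tau>" if "t \<ge> 0" for t
  proof (cases "t \<le> l")
    case True
    then show ?thesis
      using that assms by (intro bexI[of _ t] exI[of _ 0]) (auto intro: almost_period_0)
  next
    case False
    then obtain \<tau> where "\<tau> \<in> {t - l..t}" "almost_period f e \<tau>"
      using l(2)[of "t - l"] by auto
    then show ?thesis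
      by (intro bexI[of _ "t - \<tau>"] exI[of _ \<tau>]) auto
  qed
  with l(1) show ?thesis using that by blast
qed

lemma almost_periodic_bounded:
  assumes "almost_periodic f"
  obtains M where "M > 0" "\<And>t. t \<ge> 0 \<Longrightarrow> norm (f t) \<le> M"
proof -
  obtain l where l: "l > 0" "\<And>t. t \<ge> 0 \<Longrightarrow> \<exists>s\<in>{0..l}. \<exists>\<tau>. t = s + \<tau> \<and> almost_period f 1 \<tau>"
    using almost_periodic_reduce[OF assms, of 1] by auto
  have "continuous_on {0..l} f"
    using assms by (auto simp: almost_periodic_def intro: continuous_on_subset)
  then have "bounded (f ` {0..l})"
    by (intro compact_imp_bounded compact_continuous_image) auto
  then obtain B where B: "B > 0" "\<And>s. s \<in> {0..l} \<Longrightarrow> norm (f s) \<le> B"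
    by (auto simp: bounded_pos)
  show ?thesis
  proof (rule that[of "B + 1"])
    fix t :: real assume "t \<ge> 0"
    then obtain s \<tau> where s: "s \<in> {0..l}" "t = s + \<tau>" "almost_period f 1 \<tau>"
      using l by blast
    then have "norm (f t - f s) \<le> 1"
      by (auto simp: almost_period_def)
    then show "norm (f t) \<le> B + 1"
      using B(2)[OF s(1)] norm_triangle_ineq2[of "f t" "f s"] by linarith
  qed (use B in auto)
qed

lemma almost_periodic_small_shifts:
  assumes "almost_periodic f" "e > 0"
  obtains \<delta> where "\<delta> > 0" "\<And>h. 0 \<le> h \<Longrightarrow> h \<le> \<delta> \<Longrightarrow> almost_period f e h"
proof -
  obtain l where l: "l > 0" "\<And>t. t \<ge> 0 \<Longrightarrow> \<exists>s\<in>{0..l}. \<exists>\<tau>. t = s + \<tau> \<and> almost_period f (e/3) \<tau>"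
    using almost_periodic_reduce[OF assms(1), of "e/3"] assms(2) by auto
  \<comment> \<open>One longer than [0, l], so that s + h stays inside for every h \<le> 1.\<close>
  have "continuous_on {0..l+1} f"
    using assms by (auto simp: almost_periodic_def intro: continuous_on_subset)
  then have "uniformly_continuous_on {0..l+1} f"
    by (rule compact_uniformly_continuous) simp
  then obtain d where d: "d > 0"
    "\<And>s s'. s \<in> {0..l+1} \<Longrightarrow> s' \<in> {0..l+1} \<Longrightarrow> dist s' s < d \<Longrightarrow> dist (f s') (f s) < e/3"
    using assms(2) unfolding uniformly_continuous_on_def by (elim allE[of _ "e/3"]) auto
  show ?thesis
  proof (rule that[of "min (d/2) 1"])
    fix h :: real assume h: "0 \<le> h" "h \<le> min (d/2) 1"
    show "almost_period f e h"
      unfolding almost_period_def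
    proof (intro conjI allI impI h(1))
      fix t :: real assume "t \<ge> 0"
      then obtain s \<tau> where s: "s \<in> {0..l}" "t = s + \<tau>" "almost_period f (e/3) \<tau>"
        using l by blast
      have 1: "norm (f t - f s) \<le> e/3"
        using s by (auto simp: almost_period_def)
      have "norm (f (s + h + \<tau>) - f (s + h)) \<le> e/3"
        using s h by (auto simp: almost_period_def)
      then have 2: "norm (f (t + h) - f (s + h)) \<le> e/3"
        using s by (simp add: algebra_simps)
      have 3: "norm (f (s + h) - f s) \<le> e/3"
        using d(2)[of s "s + h"] s h d(1) by (auto simp: dist_norm)
      show "norm (f (t + h) - f t) \<le> e"
        using norm_diff_triangle_le[OF norm_diff_triangle_le[OF 2 3], of "f t" "e/3"] 1
        by (simp add: norm_minus_commute)
    qed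
  qed (use d in auto)
qed

section \<open>Integrals over blocks\<close>

lemma continuous_on_halfline: "continuous_on {0..} g \<Longrightarrow> 0 \<le> a \<Longrightarrow> continuous_on {a..b::real} g"
  by (erule continuous_on_subset) auto

lemma integrable_on_halfline:
  fixes g :: "real \<Rightarrow> 'a::banach"
  shows "continuous_on {0..} g \<Longrightarrow> 0 \<le> a \<Longrightarrow> g integrable_on {a..b}"
  by (intro integrable_continuous_real continuous_on_halfline)

lemma integral_blocks:
  fixes g :: "real \<Rightarrow> 'a::banach"
  assumes "continuous_on {0..} g" "0 \<le> L"
  shows "integral {0..real n * L} g = (\<Sum>i<n. integral {real i * L..real i * L + L} g)"
proof (induction n)
  case (Suc n)
  have "integral {0..real n * L} g + integral {real n * L..real (Suc n) * L} g
      = integral {0..real (Suc n) * L} g"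
    using assms by (intro Henstock_Kurzweil_Integration.integral_combine integrable_on_halfline)
      (auto intro: mult_right_mono)
  then show ?case using Suc by (simp add: algebra_simps)
qed simp

lemma norm_integral_halfline:
  fixes g :: "real \<Rightarrow> 'a::banach"
  assumes "continuous_on {0..} g" "\<And>t. t \<ge> 0 \<Longrightarrow> norm (g t) \<le> M" "0 \<le> a" "a \<le> b"
  shows "norm (integral {a..b} g) \<le> M * (b - a)"
  using assms by (intro integral_bound continuous_on_halfline) auto

lemma integral_remainder:
  fixes g :: "real \<Rightarrow> 'a::banach"
  assumes "continuous_on {0..} g" "\<And>t. t \<ge> 0 \<Longrightarrow> norm (g t) \<le> M" "L > 0" "T \<ge> 0"
  obtains n where "real n * L \<le> T" "T \<le> real n * L + L"
    "norm (integral {0..T} g - integral {0..real n * L} g) \<le> M * L"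
proof -
  define n where "n = nat \<lfloor>T / L\<rfloor>"
  have "real n = of_int \<lfloor>T / L\<rfloor>"
    using assms by (simp add: n_def)
  then have "real n \<le> T / L" "T / L \<le> real n + 1"
    by linarith+
  then have n: "real n * L \<le> T" "T \<le> real n * L + L"
    using assms(3) by (simp_all add: field_simps)
  have M: "M \<ge> 0"
    using order_trans[OF norm_ge_zero assms(2)[of 0]] by simp
  have "integral {0..real n * L} g + integral {real n * L..T} g = integral {0..T} g"
    using assms n by (intro Henstock_Kurzweil_Integration.integral_combine integrable_on_halfline) auto
  then have "integral {0..T} g - integral {0..real n * L} g = integral {real n * L..T} g"
    by (simp add: algebra_simps)
  also have "norm \<dots> \<le> M * (T - real n * L)"
    using assms n by (intro norm_integral_halfline) auto
  also have "\<dots> \<le> M * L"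
    using n M by (intro mult_left_mono) auto
  finally show ?thesis by (rule that[OF n])
qed

text \<open>The two windows differ by two pieces of length at most l. The cost does not depend on L,
  hence is negligible relative to a long window.\<close>

lemma integral_window_shift:
  fixes g :: "real \<Rightarrow> 'a::banach"
  assumes "continuous_on {0..} g" "\<And>t. t \<ge> 0 \<Longrightarrow> norm (g t) \<le> M"
    and "0 \<le> a" "0 \<le> L" "\<tau> \<in> {a..a + l}"
  shows "norm (integral {a..a + L} g - integral {\<tau>..\<tau> + L} g) \<le> 2 * M * l"
proof -
  have M: "M \<ge> 0"
    using order_trans[OF norm_ge_zero assms(2)[of 0]] by simp
  have int: "g integrable_on {a..\<tau> + L}"
    using assms by (intro integrable_on_halfline)
  have "integral {a..a + L} g + integral {a + L..\<tau> + L} g = integral {a..\<tau> + L} g"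
    by (rule Henstock_Kurzweil_Integration.integral_combine[OF _ _ int]) (use assms in auto)
  moreover have "integral {a..\<tau>} g + integral {\<tau>..\<tau> + L} g = integral {a..\<tau> + L} g"
    by (rule Henstock_Kurzweil_Integration.integral_combine[OF _ _ int]) (use assms in auto)
  ultimately have "integral {a..a + L} g - integral {\<tau>..\<tau> + L} g
      = integral {a..\<tau>} g - integral {a + L..\<tau> + L} g"
    by (simp add: algebra_simps)
  also have "norm \<dots> \<le> M * (\<tau> - a) + M * (\<tau> + L - (a + L))"
    by (rule order_trans[OF norm_triangle_ineq4], rule add_mono;
        rule norm_integral_halfline[OF assms(1,2)]) (use assms in auto)
  also have "\<dots> = 2 * M * (\<tau> - a)"
    by (simp add: algebra_simps)
  also have "\<dots> \<le> 2 * M * l"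
    using M assms by (intro mult_left_mono) auto
  finally show ?thesis .
qed

text \<open>The incomplete last block is estimated trivially and costs the constant M * L, which is
  small against e * T for large T.\<close>

lemma near_integral_of_blocks:
  fixes g :: "real \<Rightarrow> 'a::complex_banach"
  assumes Y: "complex_vector.subspace Y" and g: "continuous_on {0..} g" "\<And>t. t \<ge> 0 \<Longrightarrow> norm (g t) \<le> M"
    and L: "L > 0" and e: "e \<ge> 0" and blocks: "\<And>a. a \<ge> 0 \<Longrightarrow> near Y (e * L) (integral {a..a + L} g)"
    and T: "T \<ge> 0"
  shows "near Y (e * T + M * L) (integral {0..T} g)"
proof -
  obtain n where n: "real n * L \<le> T"
    "norm (integral {0..T} g - integral {0..real n * L} g) \<le> M * L"
    using integral_remainder[OF g L T] by blast
  have "near Y (\<Sum>i<n. e * L) (integral {0..real n * L} g)"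
    unfolding integral_blocks[OF g(1) less_imp_le[OF L]] using L
    by (intro near_sum[OF Y] blocks) auto
  then have "near Y ((\<Sum>i<n. e * L) + M * L) (integral {0..T} g)"
    using n(2) by (rule near_perturb)
  moreover have "(\<Sum>i<n. e * L) \<le> e * T"
    using mult_left_mono[OF n(1) e] by (simp add: algebra_simps)
  ultimately show ?thesis by (elim near_mono) auto
qed

section \<open>Means of almost periodic functions\<close>

text \<open>Every window can be slid to an almost period, so all windows of a suitable length L have
  nearly the integral v of the first one. The averages therefore eventually stay close to v / L,
  which gives a Cauchy condition.\<close>

lemma almost_periodic_mean:
  fixes g :: "real \<Rightarrow> 'a::complex_banach"
  assumes "almost_periodic g"
  shows "\<exists>P. ((\<lambda>T. (1 / T) *\<^sub>R integral {0..T} g) \<longlongrightarrow> P) at_top"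
proof -
  define A where "A = (\<lambda>T. (1 / T) *\<^sub>R integral {0..T} g)"
  have g: "continuous_on {0..} g"
    using assms by (simp add: almost_periodic_def)
  obtain M where M: "M > 0" "\<And>t. t \<ge> 0 \<Longrightarrow> norm (g t) \<le> M"
    using almost_periodic_bounded[OF assms] by blast
  have key: "\<exists>c. \<forall>\<^sub>F X in at_top. norm (A X - c) \<le> 4 * e" if "e > 0" for e
  proof -
    obtain l where l: "l > 0" "\<And>a. a \<ge> 0 \<Longrightarrow> \<exists>\<tau>\<in>{a..a + l}. almost_period g e \<tau>"
      using almost_periodicD[OF assms \<open>e > 0\<close>] by blast
    \<comment> \<open>Sliding a window by at most l costs 2 * M * l; this L makes the cost equal to
      e * L.\<close>
    define L where "L = 2 * M * l / e"
    have L: "L > 0" using M l that by (simp add: L_def)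
    have Le: "2 * M * l = e * L" using that by (simp add: L_def)
    define v where "v = integral {0..L} g"
    have v: "norm v \<le> M * L"
      using norm_integral_halfline[OF g M(2), of 0 L] L by (simp add: v_def)
    have block: "norm (integral {a..a + L} g - v) \<le> 2 * e * L" if "a \<ge> 0" for a
    proof -
      obtain \<tau> where \<tau>: "\<tau> \<in> {a..a + l}" "almost_period g e \<tau>"
        using l \<open>a \<ge> 0\<close> by blast
      have 1: "norm (integral {a..a + L} g - integral {\<tau>..\<tau> + L} g) \<le> e * L"
        using integral_window_shift[OF g M(2) that _ \<tau>(1), of L] L by (simp add: Le)
      have int: "(\<lambda>s. g (s + \<tau>)) integrable_on {0..L}"
        using \<tau> that by (intro integrable_continuous_real continuous_on_compose2[OF g] continuous_intros) auto
      have "integral {\<tau>..\<tau> + L} g = integral {0..L} (\<lambda>s. g (s + \<tau>))"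
        using integral_shift_Icc_real[of 0 L g \<tau>] by (simp add: o_def add.commute)
      then have "integral {\<tau>..\<tau> + L} g - v = integral {0..L} (\<lambda>s. g (s + \<tau>) - g s)"
        unfolding v_def using int
        by (simp add: Henstock_Kurzweil_Integration.integral_diff integrable_on_halfline[OF g])
      also have "norm \<dots> \<le> e * (L - 0)"
        using L \<tau> that g
        by (intro integral_bound continuous_intros continuous_on_compose2[OF g])
          (auto simp: almost_period_def)
      finally have 2: "norm (integral {\<tau>..\<tau> + L} g - v) \<le> e * L" by simp
      show ?thesis
        using norm_diff_triangle_le[OF 1 2] by (simp add: algebra_simps)
    qed
    have "norm (A X - (1 / L) *\<^sub>R v) \<le> 4 * e" if X: "X \<ge> L" "X \<ge> M * L / e" for X
    proof -
      have X0: "X > 0" using X L by simp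
      obtain n where n: "real n * L \<le> X" "X \<le> real n * L + L"
        "norm (integral {0..X} g - integral {0..real n * L} g) \<le> M * L"
        using integral_remainder[OF g M(2) L, of X] X0 by auto
      have "norm (integral {0..real n * L} g - real n *\<^sub>R v) = norm (\<Sum>i<n. integral {real i * L..real i * L + L} g - v)"
        using L by (simp add: integral_blocks[OF g] sum_subtractf sum_constant_scaleR)
      also have "\<dots> \<le> (\<Sum>i<n. 2 * e * L)"
        using L by (intro sum_norm_le block) auto
      also have "\<dots> \<le> 2 * e * X"
        using mult_left_mono[OF n(1), of "2 * e"] \<open>e > 0\<close> by (simp add: algebra_simps)
      finally have 2: "norm (integral {0..real n * L} g - real n *\<^sub>R v) \<le> 2 * e * X" .
      have "norm (real n *\<^sub>R v - (X / L) *\<^sub>R v) = \<bar>real n - X / L\<bar> * norm v"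
        by (simp add: scaleR_left_diff_distrib[symmetric])
      also have "\<dots> \<le> 1 * (M * L)"
        using n L v by (intro mult_mono) (auto simp: abs_le_iff field_simps)
      finally have 3: "norm (real n *\<^sub>R v - (X / L) *\<^sub>R v) \<le> M * L" by simp
      \<comment> \<open>One M * L is the incomplete last block, the other comes from replacing n by
        X / L. Each is at most e * X, whence 4 * e.\<close>
      have "norm (integral {0..X} g - (X / L) *\<^sub>R v) \<le> M * L + 2 * e * X + M * L"
        using norm_diff_triangle_le[OF norm_diff_triangle_le[OF n(3) 2] 3] by simp
      also have "\<dots> \<le> 4 * e * X"
        using X \<open>e > 0\<close> by (simp add: field_simps)
      finally have 4: "norm (integral {0..X} g - (X / L) *\<^sub>R v) \<le> 4 * e * X" .
      have "A X - (1 / L) *\<^sub>R v = (1 / X) *\<^sub>R (integral {0..X} g - (X / L) *\<^sub>R v)"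
        using X0 by (simp add: A_def scaleR_right_diff_distrib)
      also have "norm \<dots> = norm (integral {0..X} g - (X / L) *\<^sub>R v) / X"
        using X0 by simp
      also have "\<dots> \<le> 4 * e"
        using 4 X0 by (subst pos_divide_le_eq)
      finally show ?thesis .
    qed
    then show ?thesis
      unfolding eventually_at_top_linorder
      by (intro exI[of _ "(1 / L) *\<^sub>R v"] exI[of _ "max L (M * L / e)"]) auto
  qed
  have key': "\<exists>c X0. \<forall>X\<ge>X0. norm (A X - c) < e" if e: "e > 0" for e
  proof -
    obtain c X0 where "\<forall>X\<ge>X0. norm (A X - c) \<le> 4 * (e/8)"
      using key[of "e/8"] e unfolding eventually_at_top_linorder by auto
    moreover have "4 * (e/8) < e" using e by simp
    ultimately have "\<forall>X\<ge>X0. norm (A X - c) < e"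
      by (meson le_less_trans)
    then show ?thesis by blast
  qed
  \<comment> \<open>Completeness is used along the integers; \<open>key'\<close> then extends the
    limit to real arguments.\<close>
  have "Cauchy (\<lambda>n. A (real n))"
  proof (rule metric_CauchyI)
    fix e :: real assume "e > 0"
    then obtain c X0 where c: "\<And>X. X \<ge> X0 \<Longrightarrow> norm (A X - c) < e/2"
      using key'[of "e/2"] by auto
    obtain N where N: "real N \<ge> X0" using real_arch_simple by blast
    show "\<exists>M. \<forall>m\<ge>M. \<forall>n\<ge>M. dist (A (real m)) (A (real n)) < e"
    proof (intro exI[of _ N] allI impI)
      fix m n assume "m \<ge> N" "n \<ge> N"
      then have "real m \<ge> X0" "real n \<ge> X0" using N by linarith+
      then show "dist (A (real m)) (A (real n)) < e"
        using dist_triangle_half_l[of "A (real m)" c e "A (real n)"] c[of "real m"] c[of "real n"]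
        by (simp add: dist_norm)
    qed
  qed
  then obtain P where P: "(\<lambda>n. A (real n)) \<longlonglongrightarrow> P"
    using Cauchy_convergent_iff convergent_def by blast
  have "(A \<longlongrightarrow> P) at_top"
  proof (rule tendstoI)
    fix e :: real assume "e > 0"
    then obtain c X0 where c: "\<And>X. X \<ge> X0 \<Longrightarrow> norm (A X - c) < e/4"
      using key'[of "e/4"] by auto
    have "dist c P \<le> e/4"
    proof (rule Lim_dist_ubound[OF _ P])
      show "\<forall>\<^sub>F n in sequentially. dist c (A (real n)) \<le> e/4"
        using c eventually_ge_at_top[of "nat \<lceil>X0\<rceil>"]
        by (auto elim!: eventually_mono simp: dist_norm norm_minus_commute less_imp_le nat_le_iff ceiling_le_iff)
    qed simp
    then have "dist (A X) P < e" if "X \<ge> X0" for X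
      using c[OF that] dist_triangle[of "A X" P c] \<open>e > 0\<close> by (simp add: dist_norm)
    then show "\<forall>\<^sub>F X in at_top. dist (A X) P < e"
      unfolding eventually_at_top_linorder by blast
  qed
  then show ?thesis unfolding A_def by blast
qed

section \<open>Bohr means\<close>

definition osc :: "real \<Rightarrow> real \<Rightarrow> complex"
  where "osc r s = exp (- (\<i> * of_real r * of_real s))"

lemma osc_0 [simp]: "osc r 0 = 1" "osc 0 s = 1"
  by (simp_all add: osc_def)

lemma osc_add: "osc r (s + t) = osc r s * osc r t"
  by (simp add: osc_def exp_add[symmetric] algebra_simps)

lemma osc_add_freq: "osc (r + q) s = osc r s * osc q s"
  by (simp add: osc_def exp_add[symmetric] algebra_simps)

lemma osc_eq: "osc r s = exp (\<i> * of_real (- (r * s)))"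
  by (simp add: osc_def algebra_simps)

lemma norm_osc [simp]: "cmod (osc r s) = 1"
  unfolding osc_eq by (rule norm_exp_i_times)

lemma norm_osc_diff_1: "cmod (osc r s - 1) = 2 * \<bar>sin (r * s / 2)\<bar>"
  unfolding osc_eq dist_exp_i_1 by simp

lemma norm_osc_diff_1_le: "cmod (osc r s - 1) \<le> \<bar>r * s\<bar>"
  using abs_sin_x_le_abs_x[of "r * s / 2"] by (simp add: norm_osc_diff_1 abs_mult)

lemma continuous_on_osc [continuous_intros]:
  "continuous_on S g \<Longrightarrow> continuous_on S (\<lambda>s. osc r (g s))"
  unfolding osc_def by (intro continuous_intros)

lemma continuous_on_twist:
  "continuous_on {0..} f \<Longrightarrow> continuous_on {0..} (\<lambda>s. osc r s *\<^sub>C (f s :: 'a::complex_normed_vector))"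
  by (intro continuous_intros)

text \<open>The kernel need not be almost invariant under the shift by \<tau>; by multiplicativity
  the shift just produces the unimodular factor \<open>osc r \<tau>\<close>. Only f is compared with
  its translate.\<close>

lemma twisted_window:
  fixes f :: "real \<Rightarrow> 'a::complex_banach"
  assumes f: "continuous_on {0..} f" and \<tau>: "almost_period f e \<tau>" and L: "0 \<le> L"
  shows "norm (integral {\<tau>..\<tau> + L} (\<lambda>s. osc r s *\<^sub>C f s)
      - osc r \<tau> *\<^sub>C integral {0..L} (\<lambda>s. osc r s *\<^sub>C f s)) \<le> e * L"
proof -
  have \<tau>0: "0 \<le> \<tau>" using \<tau> by (simp add: almost_period_def)
  have c1: "continuous_on {0..L} (\<lambda>s. osc r (\<tau> + s) *\<^sub>C f (\<tau> + s))"
    using \<tau>0 by (intro continuous_intros continuous_on_compose2[OF f]) auto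
  have c2: "continuous_on {0..L} (\<lambda>s. osc r s *\<^sub>C f s)"
    by (rule continuous_on_halfline[OF continuous_on_twist[OF f]]) simp
  have c3: "continuous_on {0..L} (\<lambda>s. osc r \<tau> *\<^sub>C osc r s *\<^sub>C f s)"
    by (intro continuous_intros continuous_on_halfline[OF f]) simp
  have "integral {\<tau>..\<tau> + L} (\<lambda>s. osc r s *\<^sub>C f s)
      = integral {0..L} (\<lambda>s. osc r (\<tau> + s) *\<^sub>C f (\<tau> + s))"
    using integral_shift_Icc_real[of 0 L "\<lambda>s. osc r s *\<^sub>C f s" \<tau>] by (simp add: o_def add.commute)
  moreover have "osc r \<tau> *\<^sub>C integral {0..L} (\<lambda>s. osc r s *\<^sub>C f s)
      = integral {0..L} (\<lambda>s. osc r \<tau> *\<^sub>C osc r s *\<^sub>C f s)"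
    using c2 by (intro integral_scaleC[symmetric] integrable_continuous_real)
  ultimately have "integral {\<tau>..\<tau> + L} (\<lambda>s. osc r s *\<^sub>C f s)
      - osc r \<tau> *\<^sub>C integral {0..L} (\<lambda>s. osc r s *\<^sub>C f s)
      = integral {0..L} (\<lambda>s. osc r (\<tau> + s) *\<^sub>C f (\<tau> + s) - osc r \<tau> *\<^sub>C osc r s *\<^sub>C f s)"
    using c1 c3 by (simp add: Henstock_Kurzweil_Integration.integral_diff integrable_continuous_real)
  also have "norm \<dots> \<le> e * (L - 0)"
  proof (rule integral_bound[OF L continuous_on_diff[OF c1 c3]])
    fix s assume s: "s \<in> {0..L}"
    have "osc r (\<tau> + s) *\<^sub>C f (\<tau> + s) - osc r \<tau> *\<^sub>C osc r s *\<^sub>C f s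
        = osc r (\<tau> + s) *\<^sub>C (f (s + \<tau>) - f s)"
      by (simp add: osc_add scaleC_diff_right add.commute)
    then show "norm (osc r (\<tau> + s) *\<^sub>C f (\<tau> + s) - osc r \<tau> *\<^sub>C osc r s *\<^sub>C f s) \<le> e"
      using \<tau> s by (simp add: norm_scaleC almost_period_def)
  qed
  finally show ?thesis by simp
qed

text \<open>If \<open>f\<close> has a nonzero component at frequency \<open>r\<close>, its almost periods are automatically almost
  periods of \<open>s \<mapsto> e\<^sup>-\<^sup>i\<^sup>r\<^sup>s\<close> as well, so no common almost periods have to be constructed.\<close>

lemma almost_period_frequency:
  fixes f :: "real \<Rightarrow> 'a::complex_banach"
  assumes f: "continuous_on {0..} f" "\<And>t. t \<ge> 0 \<Longrightarrow> norm (f t) \<le> M" and \<tau>: "almost_period f e \<tau>"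
    and large: "\<exists>\<^sub>F T in at_top. \<alpha> \<le> norm ((1 / T) *\<^sub>R integral {0..T} (\<lambda>s. osc r s *\<^sub>C f s))"
  shows "cmod (osc r \<tau> - 1) * \<alpha> \<le> e"
proof (rule field_le_epsilon)
  fix \<eta> :: real assume \<eta>: "\<eta> > 0"
  have \<tau>0: "0 \<le> \<tau>" using \<tau> by (simp add: almost_period_def)
  define I where "I = (\<lambda>T. integral {0..T} (\<lambda>s. osc r s *\<^sub>C f s))"
  have "\<exists>\<^sub>F T in at_top. \<alpha> \<le> norm ((1 / T) *\<^sub>R I T) \<and> T > 0 \<and> T \<ge> 2 * M * \<tau> / \<eta>"
    using large unfolding I_def
    by (rule frequently_rev_mp) (auto intro: eventually_elim2[OF eventually_gt_at_top[of 0] eventually_ge_at_top[of "2 * M * \<tau> / \<eta>"]])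
  then obtain T where T: "\<alpha> \<le> norm ((1 / T) *\<^sub>R I T)" "T > 0" "T \<ge> 2 * M * \<tau> / \<eta>"
    by (auto dest: frequently_ex)
  \<comment> \<open>Sliding the window by \<tau> costs an amount that does not grow with T; the
    chosen T absorbs it into \<eta> * T.\<close>
  have "norm (I T - integral {\<tau>..\<tau> + T} (\<lambda>s. osc r s *\<^sub>C f s)) \<le> 2 * M * \<tau>"
    using integral_window_shift[OF continuous_on_twist[OF f(1)], of r M 0 T \<tau> \<tau>] f(2) T(2) \<tau>0
    by (simp add: I_def norm_scaleC)
  from norm_diff_triangle_le[OF this twisted_window[OF f(1) \<tau>, of T r]]
  have "norm (I T - osc r \<tau> *\<^sub>C I T) \<le> 2 * M * \<tau> + e * T"
    using T(2) by (simp add: I_def)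
  also have "I T - osc r \<tau> *\<^sub>C I T = - ((osc r \<tau> - 1) *\<^sub>C I T)"
    by (simp add: scaleC_diff_left)
  also have "norm \<dots> = cmod (osc r \<tau> - 1) * norm (I T)"
    by (simp add: norm_scaleC)
  also have "2 * M * \<tau> + e * T \<le> (e + \<eta>) * T"
    using T(2,3) \<eta> by (simp add: field_simps)
  finally have 1: "cmod (osc r \<tau> - 1) * norm (I T) \<le> (e + \<eta>) * T" .
  have "\<alpha> * T \<le> norm (I T)"
    using T(1,2) by (simp add: field_simps)
  then have "cmod (osc r \<tau> - 1) * (\<alpha> * T) \<le> (e + \<eta>) * T"
    by (intro order_trans[OF mult_left_mono 1]) auto
  then show "cmod (osc r \<tau> - 1) * \<alpha> \<le> e + \<eta>"
    using T(2) by (simp add: mult.assoc[symmetric])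
qed

text \<open>\<open>bohr_mean\<close> is a \<open>Lim\<close> and says nothing until the limit is
  known to exist. Either the averages tend to 0, or they frequently have norm at least some \<alpha>
  > 0; then \<open>almost_period_frequency\<close> makes the twisted function almost periodic and
  \<open>almost_periodic_mean\<close> applies.\<close>

lemma bohr_mean_tendsto:
  fixes f :: "real \<Rightarrow> 'a::complex_banach"
  assumes ap: "almost_periodic f"
  shows "((\<lambda>T. (1 / T) *\<^sub>R integral {0..T} (\<lambda>s. osc r s *\<^sub>C f s)) \<longlongrightarrow> bohr_mean r f) at_top"
proof -
  let ?g = "\<lambda>s. osc r s *\<^sub>C f s"
  let ?A = "\<lambda>T. (1 / T) *\<^sub>R integral {0..T} ?g"
  have f: "continuous_on {0..} f"
    using ap by (simp add: almost_periodic_def)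
  obtain M where M: "M > 0" "\<And>t. t \<ge> 0 \<Longrightarrow> norm (f t) \<le> M"
    using almost_periodic_bounded[OF ap] by blast
  have "\<exists>P. (?A \<longlongrightarrow> P) at_top"
  proof (cases "(?A \<longlongrightarrow> 0) at_top")
    case False
    then obtain \<alpha> where \<alpha>: "\<alpha> > 0" "\<exists>\<^sub>F T in at_top. \<alpha> \<le> norm (?A T)"
      unfolding tendsto_iff frequently_def by (auto simp: not_le)
    have "almost_periodic ?g"
    proof (rule almost_periodicI[OF continuous_on_twist[OF f]])
      fix e :: real assume e: "e > 0"
      \<comment> \<open>d is the error from shifting f, (d / \<alpha>) * M the error from shifting
        the kernel; this d makes them add up to e.\<close>
      define d where "d = e / (1 + M / \<alpha>)"
      have pos: "1 + M / \<alpha> > 0" using M \<alpha> by (simp add: add_pos_pos)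
      have "d + d / \<alpha> * M = d * (1 + M / \<alpha>)"
        by (simp add: algebra_simps)
      with e pos have d: "d > 0" "d + d / \<alpha> * M = e"
        using e pos by (simp_all add: d_def)
      have "almost_period ?g e \<tau>" if \<tau>: "almost_period f d \<tau>" for \<tau>
        unfolding almost_period_def
      proof (intro conjI allI impI)
        fix t :: real assume t: "t \<ge> 0"
        have "cmod (osc r \<tau> - 1) * \<alpha> \<le> d"
          using almost_period_frequency[OF f M(2) \<tau> \<alpha>(2)] by simp
        then have "cmod (osc r \<tau> - 1) \<le> d / \<alpha>"
          using \<alpha> by (simp add: field_simps)
        then have 1: "norm ((osc r \<tau> - 1) *\<^sub>C f t) \<le> d / \<alpha> * M"
          unfolding norm_scaleC using M t d \<alpha> by (intro mult_mono) auto
        have 2: "norm (osc r \<tau> *\<^sub>C (f (t + \<tau>) - f t)) \<le> d"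
          using \<tau> t by (simp add: norm_scaleC almost_period_def)
        have "?g (t + \<tau>) - ?g t = osc r t *\<^sub>C (osc r \<tau> *\<^sub>C (f (t + \<tau>) - f t) + (osc r \<tau> - 1) *\<^sub>C f t)"
          by (simp add: osc_add scaleC_diff_right scaleC_diff_left scaleC_add_right)
        also have "norm \<dots> \<le> d + d / \<alpha> * M"
          unfolding norm_scaleC norm_osc using norm_triangle_mono[OF 2 1] by simp
        finally show "norm (?g (t + \<tau>) - ?g t) \<le> e" using d by simp
      qed (use \<tau> in \<open>simp add: almost_period_def\<close>)
      then show "\<exists>l>0. \<forall>a\<ge>0. \<exists>\<tau>\<in>{a..a + l}. almost_period ?g e \<tau>"
        using almost_periodicD[OF ap d(1)] by metis
    qed
    then show ?thesis by (rule almost_periodic_mean)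
  qed blast
  then obtain P where P: "(?A \<longlongrightarrow> P) at_top" by blast
  then have "bohr_mean r f = P"
    unfolding bohr_mean_def osc_def[symmetric] by (intro tendsto_Lim) auto
  with P show ?thesis by simp
qed

text \<open>The window at 0 has an average close to the Bohr mean, which lies in Y. A window at a is
  slid to an almost period \<tau>, where its integral is nearly \<open>osc r \<tau>\<close> times
  the one at 0. The factor varies with a, but Y absorbs it, so one L serves all a.\<close>

lemma twisted_windows_near:
  fixes f :: "real \<Rightarrow> 'a::complex_banach"
  assumes ap: "almost_periodic f" and Y: "complex_vector.subspace Y" "bohr_mean r f \<in> Y" and e: "e > 0"
  shows "\<exists>L>0. \<forall>a\<ge>0. near Y (e * L) (integral {a..a + L} (\<lambda>s. osc r s *\<^sub>C f s))"
proof -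
  let ?g = "\<lambda>s. osc r s *\<^sub>C f s"
  have f: "continuous_on {0..} f"
    using ap by (simp add: almost_periodic_def)
  obtain M where M: "M > 0" "\<And>t. t \<ge> 0 \<Longrightarrow> norm (f t) \<le> M"
    using almost_periodic_bounded[OF ap] by blast
  obtain l where l: "l > 0" "\<And>a. a \<ge> 0 \<Longrightarrow> \<exists>\<tau>\<in>{a..a + l}. almost_period f (e/3) \<tau>"
    using almost_periodicD[OF ap, of "e/3"] e by auto
  have "\<forall>\<^sub>F L in at_top. norm ((1 / L) *\<^sub>R integral {0..L} ?g - bohr_mean r f) < e/3"
    using tendstoD[OF bohr_mean_tendsto[OF ap, of r], of "e/3"] e by (simp add: dist_norm)
  then have "\<forall>\<^sub>F L in at_top. norm ((1 / L) *\<^sub>R integral {0..L} ?g - bohr_mean r f) < e/3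
      \<and> L > 0 \<and> L \<ge> 6 * M * l / e"
    by (intro eventually_conj eventually_gt_at_top eventually_ge_at_top)
  then obtain L where L: "norm ((1 / L) *\<^sub>R integral {0..L} ?g - bohr_mean r f) < e/3"
    "L > 0" "L \<ge> 6 * M * l / e"
    unfolding eventually_at_top_linorder by blast
  have "integral {0..L} ?g - of_real L *\<^sub>C bohr_mean r f
      = L *\<^sub>R ((1 / L) *\<^sub>R integral {0..L} ?g - bohr_mean r f)"
    using L(2) by (simp add: scaleC_of_real scaleR_right_diff_distrib)
  also have "norm \<dots> \<le> L * (e/3)"
    unfolding norm_scaleR using L(1,2) by (intro mult_mono) auto
  finally have near0: "near Y (L * (e/3)) (integral {0..L} ?g)"
    using complex_vector.subspace_scale[OF Y] unfolding near_def by blast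
  have Ml: "2 * M * l \<le> e/3 * L"
    using L(3) e by (simp add: field_simps)
  have "near Y (e * L) (integral {a..a + L} ?g)" if a: "a \<ge> 0" for a
  proof -
    obtain \<tau> where \<tau>: "\<tau> \<in> {a..a + l}" "almost_period f (e/3) \<tau>"
      using l(2) a by blast
    have 1: "norm (integral {a..a + L} ?g - integral {\<tau>..\<tau> + L} ?g) \<le> e/3 * L"
      using integral_window_shift[OF continuous_on_twist[OF f], of r M a L \<tau> l] M(2) a L(2) \<tau>(1) Ml
      by (simp add: norm_scaleC)
    have 2: "norm (integral {\<tau>..\<tau> + L} ?g - osc r \<tau> *\<^sub>C integral {0..L} ?g) \<le> e/3 * L"
      using L(2) by (intro twisted_window[OF f \<tau>(2)]) simp
    have "near Y (cmod (osc r \<tau>) * (L * (e/3))) (osc r \<tau> *\<^sub>C integral {0..L} ?g)"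
      by (rule near_scale[OF Y(1) near0])
    from near_perturb[OF this norm_diff_triangle_le[OF 1 2]]
    show ?thesis by (simp add: algebra_simps)
  qed
  with L(2) show ?thesis by blast
qed

text \<open>On a block at a, \<open>osc q\<close> is \<open>osc r\<close> times the phase
  \<open>osc (q - r) a\<close> and a factor that drifts only with s - a \<le> L. The phase is
  absorbed by Y, so closeness of q to r is measured against L and not against T.\<close>

lemma twisted_integrals_near_locally:
  fixes f :: "real \<Rightarrow> 'a::complex_banach"
  assumes ap: "almost_periodic f" and Y: "complex_vector.subspace Y" "bohr_mean r f \<in> Y" and e: "e > 0"
  shows "\<exists>\<rho>>0. \<exists>T0. \<forall>T\<ge>T0. \<forall>q\<in>ball r \<rho>. near Y (e * T) (integral {0..T} (\<lambda>s. osc q s *\<^sub>C f s))"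
proof -
  have f: "continuous_on {0..} f"
    using ap by (simp add: almost_periodic_def)
  obtain M where M: "M > 0" "\<And>t. t \<ge> 0 \<Longrightarrow> norm (f t) \<le> M"
    using almost_periodic_bounded[OF ap] by blast
  obtain L where L: "L > 0"
    "\<And>a. a \<ge> 0 \<Longrightarrow> near Y (e/4 * L) (integral {a..a + L} (\<lambda>s. osc r s *\<^sub>C f s))"
    using twisted_windows_near[OF ap Y, of "e/4"] e by auto
  \<comment> \<open>\<rho> * L bounds the drift of the kernel on one block and M bounds f; together
    they use up e/4. The window estimate takes another e/4, and e/2 is left for the incomplete
    block.\<close>
  define \<rho> where "\<rho> = e / (4 * L * M)"
  have \<rho>: "\<rho> > 0" "\<rho> * L * M = e/4"
    using e L M by (simp_all add: \<rho>_def)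
  have block: "near Y (e/2 * L) (integral {a..a + L} (\<lambda>s. osc q s *\<^sub>C f s))"
    if q: "q \<in> ball r \<rho>" and a: "a \<ge> 0" for q a
  proof -
    let ?d = "q - r"
    have c1: "continuous_on {a..a+L} (\<lambda>s. osc q s *\<^sub>C f s)"
      and c2: "continuous_on {a..a+L} (\<lambda>s. osc r s *\<^sub>C f s)"
      using a by (intro continuous_on_halfline continuous_on_twist f; simp)+
    have c3: "continuous_on {a..a+L} (\<lambda>s. osc ?d a *\<^sub>C osc r s *\<^sub>C f s)"
      by (intro continuous_intros continuous_on_halfline[OF f] a)
    have "integral {a..a + L} (\<lambda>s. osc q s *\<^sub>C f s) - osc ?d a *\<^sub>C integral {a..a + L} (\<lambda>s. osc r s *\<^sub>C f s)
       = integral {a..a + L} (\<lambda>s. osc q s *\<^sub>C f s - osc ?d a *\<^sub>C osc r s *\<^sub>C f s)"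
      using c1 c3 by (subst integral_scaleC[symmetric])
        (auto intro!: Henstock_Kurzweil_Integration.integral_diff[symmetric] integrable_continuous_real c2)
    also have "norm \<dots> \<le> e/4 * (a + L - a)"
    proof (rule integral_bound)
      fix s assume s: "s \<in> {a..a+L}"
      have "osc q s = osc ?d a * (osc ?d (s - a) * osc r s)"
        using osc_add_freq[of r ?d s] osc_add[of ?d a "s - a"] by simp
      then have "osc q s *\<^sub>C f s - osc ?d a *\<^sub>C osc r s *\<^sub>C f s
          = (osc ?d a * (osc ?d (s - a) - 1) * osc r s) *\<^sub>C f s"
        by (simp add: algebra_simps scaleC_diff_left)
      also have "norm \<dots> = cmod (osc ?d (s - a) - 1) * norm (f s)"
        by (simp add: norm_scaleC norm_mult)
      also have "\<dots> \<le> (\<rho> * L) * M"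
      proof (rule mult_mono)
        have "\<bar>?d * (s - a)\<bar> \<le> \<rho> * L"
          unfolding abs_mult using q s \<rho> by (intro mult_mono) (auto simp: dist_real_def)
        then show "cmod (osc ?d (s - a) - 1) \<le> \<rho> * L"
          using norm_osc_diff_1_le order_trans by blast
      qed (use M s a \<rho> L in auto)
      finally show "norm (osc q s *\<^sub>C f s - osc ?d a *\<^sub>C osc r s *\<^sub>C f s) \<le> e/4"
        using \<rho> by simp
    qed (use L c1 c3 in \<open>auto intro!: continuous_on_diff\<close>)
    finally have "norm (integral {a..a + L} (\<lambda>s. osc q s *\<^sub>C f s)
        - osc ?d a *\<^sub>C integral {a..a + L} (\<lambda>s. osc r s *\<^sub>C f s)) \<le> e/4 * L"
      by simp
    from near_perturb[OF near_scale[OF Y(1) L(2)[OF a], of "osc ?d a"] this]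
    show ?thesis by (simp add: algebra_simps)
  qed
  have "near Y (e * T) (integral {0..T} (\<lambda>s. osc q s *\<^sub>C f s))"
    if "T \<ge> 2 * M * L / e" and q: "q \<in> ball r \<rho>" for T q
  proof -
    have T: "M * L \<le> e/2 * T"
      using that e by (simp add: field_simps)
    have T0: "T \<ge> 0"
      using that(1) M L e by (meson divide_nonneg_pos less_imp_le mult_nonneg_nonneg order_trans zero_le_numeral)
    have "near Y (e/2 * T + M * L) (integral {0..T} (\<lambda>s. osc q s *\<^sub>C f s))"
      using M(2) e by (intro near_integral_of_blocks[OF Y(1) continuous_on_twist[OF f] _ L(1) _ block[OF q] T0])
        (auto simp: norm_scaleC)
    then show ?thesis
      by (rule near_mono) (use T in simp)
  qed
  then show ?thesis using \<rho>(1) by blast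
qed

lemma twisted_integrals_near:
  fixes f :: "real \<Rightarrow> 'a::complex_banach"
  assumes ap: "almost_periodic f" and Y: "complex_vector.subspace Y" "\<And>r. bohr_mean r f \<in> Y" and e: "e > 0"
  shows "\<exists>T0. \<forall>T\<ge>T0. \<forall>r\<in>{-R..R}. near Y (e * T) (integral {0..T} (\<lambda>s. osc r s *\<^sub>C f s))"
proof -
  obtain \<rho> T0 where \<rho>: "\<And>r. \<rho> r > 0"
    and T0: "\<And>r T q. T \<ge> T0 r \<Longrightarrow> q \<in> ball r (\<rho> r) \<Longrightarrow> near Y (e * T) (integral {0..T} (\<lambda>s. osc q s *\<^sub>C f s))"
    using twisted_integrals_near_locally[OF ap Y(1) Y(2) e] by metis
  have "{-R..R} \<subseteq> (\<Union>r\<in>{-R..R}. ball r (\<rho> r))"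
    using \<rho> by force
  then obtain F where F: "F \<subseteq> {-R..R}" "finite F" "{-R..R} \<subseteq> (\<Union>r\<in>F. ball r (\<rho> r))"
    using compactE_image[OF compact_Icc, of "{-R..R}" "\<lambda>r. ball r (\<rho> r)" "-R" R] by auto
  \<comment> \<open>\<open>insert 0\<close> keeps the set under \<open>Max\<close> nonempty: F is
    empty if R < 0.\<close>
  have "near Y (e * T) (integral {0..T} (\<lambda>s. osc q s *\<^sub>C f s))"
    if T: "T \<ge> Max (insert 0 (T0 ` F))" and q: "q \<in> {-R..R}" for T q
  proof -
    obtain r where r: "r \<in> F" "q \<in> ball r (\<rho> r)"
      using F(3) q by blast
    have "T \<ge> T0 r"
      using T r F(2) by simp
    then show ?thesis using T0 r by blast
  qed
  then show ?thesis by blast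
qed

section \<open>Discrete Fourier transform\<close>

text \<open>The offset \<open>b\<close> shifts the frequency index; with \<open>b = N div 2\<close> the frequencies are centred at 0.\<close>

definition dft_char :: "nat \<Rightarrow> nat \<Rightarrow> nat \<Rightarrow> int \<Rightarrow> complex"
  where "dft_char N b j z = cis (2 * pi * (real j - real b) * real_of_int z / real N)"

lemma dft_char_add: "dft_char N b j (y + z) = dft_char N b j y * dft_char N b j z"
  by (simp add: dft_char_def cis_mult add_divide_distrib[symmetric] algebra_simps)

lemma cnj_dft_char: "cnj (dft_char N b j z) = dft_char N b j (- z)"
  by (simp add: dft_char_def cis_cnj)

text \<open>For z not divisible by N this is, up to the constant phase due to b, a geometric sum of
  an N-th root of unity different from 1.\<close>

lemma sum_dft_char:
  assumes "N > 0"
  shows "(\<Sum>j<N. dft_char N b j z) = (if int N dvd z then of_nat N else 0)"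
proof (cases "int N dvd z")
  case True
  then obtain k where k: "z = int N * k" by blast
  have "dft_char N b j z = 1" for j
  proof -
    have "2 * pi * (real j - real b) * real_of_int z / real N = 2 * pi * real_of_int ((int j - int b) * k)"
      using assms by (simp add: k)
    then have "dft_char N b j z = cis (2 * pi * real_of_int ((int j - int b) * k))"
      by (simp only: dft_char_def)
    also have "\<dots> = 1"
      by (rule cis_multiple_2pi) (rule Ints_of_int)
    finally show ?thesis .
  qed
  then show ?thesis using True by simp
next
  case False
  let ?w = "cis (2 * pi * real_of_int z / real N)"
  have w: "?w \<noteq> 1"
  proof
    assume "?w = 1"
    then have "cos (2 * pi * real_of_int z / real N) = 1"
      by (simp add: complex_eq_iff)
    then obtain n :: int where "2 * pi * real_of_int z / real N = of_int n * 2 * pi"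
      using cos_one_2pi_int by auto
    then have "real_of_int z = real_of_int (n * int N)"
      using assms by (simp add: field_simps)
    then have "z = n * int N"
      by linarith
    with False show False by simp
  qed
  have "?w ^ N = cis (real N * (2 * pi * real_of_int z / real N))"
    by (rule Complex.DeMoivre)
  also have "real N * (2 * pi * real_of_int z / real N) = 2 * pi * real_of_int z"
    using assms by simp
  also have "cis \<dots> = 1"
    by (rule cis_multiple_2pi) (rule Ints_of_int)
  finally have wN: "?w ^ N = 1" .
  have "dft_char N b j z = cis (- (2 * pi * real b * real_of_int z / real N)) * ?w ^ j" for j
    unfolding Complex.DeMoivre cis_mult dft_char_def using assms
    by (intro arg_cong[where f = cis]) (simp add: field_simps)
  then have "(\<Sum>j<N. dft_char N b j z) = cis (- (2 * pi * real b * real_of_int z / real N)) * (\<Sum>j<N. ?w ^ j)"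
    by (simp add: sum_distrib_left)
  also have "\<dots> = 0"
    unfolding geometric_sum[OF w] wN by simp
  finally show ?thesis using False by simp
qed

lemma sum_dft_norm_sq:
  "of_real ((cmod (\<Sum>n\<in>S. dft_char N b j (int n)))\<^sup>2)
    = (\<Sum>n\<in>S. \<Sum>k\<in>S. dft_char N b j (int n - int k))"
proof -
  have "of_real ((cmod (\<Sum>n\<in>S. dft_char N b j (int n)))\<^sup>2)
      = (\<Sum>n\<in>S. dft_char N b j (int n)) * (\<Sum>k\<in>S. dft_char N b j (- int k))"
    by (simp only: complex_norm_square cnj_sum cnj_dft_char)
  also have "\<dots> = (\<Sum>n\<in>S. \<Sum>k\<in>S. dft_char N b j (int n + - int k))"
    unfolding sum_product dft_char_add ..
  finally show ?thesis by simp
qed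

text \<open>Parseval for the indicator function of S. It gives the total mass of the weights that
  \<open>near_of_sampling\<close> places on the frequencies.\<close>

lemma dft_parseval:
  assumes N: "N > 0" and S: "S \<subseteq> {..<N}"
  shows "(\<Sum>j<N. (cmod (\<Sum>n\<in>S. dft_char N b j (int n)))\<^sup>2) = real N * real (card S)"
proof -
  have fin: "finite S" using S finite_subset by blast
  have "complex_of_real (\<Sum>j<N. (cmod (\<Sum>n\<in>S. dft_char N b j (int n)))\<^sup>2)
      = (\<Sum>j<N. \<Sum>n\<in>S. \<Sum>k\<in>S. dft_char N b j (int n - int k))"
    by (simp only: of_real_sum sum_dft_norm_sq)
  also have "\<dots> = (\<Sum>n\<in>S. \<Sum>k\<in>S. \<Sum>j<N. dft_char N b j (int n - int k))"
    by (subst sum.swap, rule sum.cong[OF refl], rule sum.swap)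
  also have "\<dots> = (\<Sum>n\<in>S. \<Sum>k\<in>S. if n = k then of_nat N else 0)"
  proof (intro sum.cong refl)
    fix n k assume "n \<in> S" "k \<in> S"
    then have "n < N" "k < N" using S by auto
    then have "int N dvd int n - int k \<longleftrightarrow> n = k"
      by (metis mod_eq_dvd_iff mod_less nat_int_comparison(1) of_nat_mod)
    then show "(\<Sum>j<N. dft_char N b j (int n - int k)) = (if n = k then of_nat N else 0)"
      by (simp add: sum_dft_char[OF N])
  qed
  also have "\<dots> = complex_of_real (real N * real (card S))"
    using fin by simp
  finally show ?thesis by (simp only: of_real_eq_iff)
qed

text \<open>The squared modulus of the transform of S is the transform of its autocorrelation. After
  expanding it, orthogonality leaves only t congruent to n - k modulo N. The weights on the left are
  nonnegative, so uniform errors in the coefficients are multiplied by exactly their sum.\<close>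

lemma cyclic_differences_dft:
  fixes F :: "nat \<Rightarrow> 'a::complex_normed_vector"
  assumes N: "N > 0" and S: "S \<subseteq> {..<N}"
  shows "(\<Sum>j<N. of_real ((cmod (\<Sum>n\<in>S. dft_char N b j (int n)))\<^sup>2) *\<^sub>C
            (\<Sum>t<N. dft_char N b j (- int t) *\<^sub>C F t))
       = of_nat N *\<^sub>C (\<Sum>n\<in>S. \<Sum>k\<in>S. F ((n + N - k) mod N))"
proof -
  have "(\<Sum>j<N. of_real ((cmod (\<Sum>n\<in>S. dft_char N b j (int n)))\<^sup>2) *\<^sub>C
            (\<Sum>t<N. dft_char N b j (- int t) *\<^sub>C F t))
      = (\<Sum>j<N. \<Sum>n\<in>S. \<Sum>k\<in>S. \<Sum>t<N. dft_char N b j (int n - int k - int t) *\<^sub>C F t)"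
  proof (rule sum.cong[OF refl])
    fix j
    show "of_real ((cmod (\<Sum>n\<in>S. dft_char N b j (int n)))\<^sup>2) *\<^sub>C
            (\<Sum>t<N. dft_char N b j (- int t) *\<^sub>C F t)
        = (\<Sum>n\<in>S. \<Sum>k\<in>S. \<Sum>t<N. dft_char N b j (int n - int k - int t) *\<^sub>C F t)"
      unfolding sum_dft_norm_sq scaleC_sum_left
      by (simp add: scaleC_sum_right dft_char_add[symmetric])
  qed
  also have "\<dots> = (\<Sum>n\<in>S. \<Sum>j<N. \<Sum>k\<in>S. \<Sum>t<N. dft_char N b j (int n - int k - int t) *\<^sub>C F t)"
    by (rule sum.swap)
  also have "\<dots> = (\<Sum>n\<in>S. \<Sum>k\<in>S. \<Sum>j<N. \<Sum>t<N. dft_char N b j (int n - int k - int t) *\<^sub>C F t)"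
    by (rule sum.cong[OF refl], rule sum.swap)
  also have "\<dots> = (\<Sum>n\<in>S. \<Sum>k\<in>S. of_nat N *\<^sub>C F ((n + N - k) mod N))"
  proof (intro sum.cong refl)
    fix n k assume "n \<in> S" "k \<in> S"
    then have nk: "n < N" "k < N" using S by auto
    have iff: "int N dvd int n - int k - int t \<longleftrightarrow> t = (n + N - k) mod N" if "t < N" for t
    proof -
      \<comment> \<open>N is added before k is subtracted, since subtraction of natural numbers
        truncates at 0.\<close>
      have "int ((n + N - k) mod N) = (int n - int k + int N) mod int N"
        using nk by (simp add: of_nat_mod of_nat_diff algebra_simps)
      also have "\<dots> = (int n - int k) mod int N"
        by simp
      finally have "t = (n + N - k) mod N \<longleftrightarrow> int t mod int N = (int n - int k) mod int N"
        using that by (metis mod_less of_nat_eq_iff of_nat_mod)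
      then show ?thesis
        by (metis mod_eq_dvd_iff)
    qed
    have "(\<Sum>j<N. \<Sum>t<N. dft_char N b j (int n - int k - int t) *\<^sub>C F t)
        = (\<Sum>t<N. (\<Sum>j<N. dft_char N b j (int n - int k - int t)) *\<^sub>C F t)"
      by (subst sum.swap) (simp add: scaleC_sum_left)
    also have "\<dots> = (\<Sum>t<N. if t = (n + N - k) mod N then of_nat N *\<^sub>C F t else 0)"
      by (intro sum.cong refl) (simp add: sum_dft_char[OF N] iff)
    also have "\<dots> = of_nat N *\<^sub>C F ((n + N - k) mod N)"
      using N by simp
    finally show "(\<Sum>j<N. \<Sum>t<N. dft_char N b j (int n - int k - int t) *\<^sub>C F t)
        = of_nat N *\<^sub>C F ((n + N - k) mod N)" .
  qed
  finally show ?thesis by (simp add: scaleC_sum_right)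
qed

section \<open>Sampling\<close>

text \<open>A weak form of Jordan's inequality. With y = x/2 one has sin x = 2 sin y cos y and sin y
  = y cos z for some z < y; both cosines are at least sqrt 2 / 2 on [0, \<pi>/4].\<close>

lemma half_le_sin:
  assumes "0 \<le> x" "x \<le> pi / 2"
  shows "x / 2 \<le> sin x"
proof (cases "x = 0")
  case False
  define y where "y = x / 2"
  have y: "0 < y" "y \<le> pi / 4" using assms False by (auto simp: y_def)
  then obtain z where z: "0 < z" "z < y" "sin y - sin 0 = (y - 0) * cos z"
    using MVT2[of 0 y sin cos] by (auto intro: DERIV_sin)
  have cy: "sqrt 2 / 2 \<le> cos y"
    using cos_monotone_0_pi_le[of y "pi/4"] y by (simp add: cos_45)
  moreover have "cos y \<le> cos z"
    using cos_monotone_0_pi_le[of z y] y z pi_gt_zero by linarith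
  ultimately have cz: "sqrt 2 / 2 \<le> cos z" by simp
  have c0: "0 \<le> cos y" "0 \<le> cos z"
    by (rule order_trans[OF _ cy], simp) (rule order_trans[OF _ cz], simp)
  have "y * (sqrt 2 / 2) * (sqrt 2 / 2) \<le> y * cos z * cos y"
    using y cy cz c0 by (intro mult_mono) auto
  then have "y / 2 \<le> sin y * cos y"
    using z by (simp add: field_simps)
  then show ?thesis
    using sin_double[of y] by (simp add: y_def)
qed simp

text \<open>For r \<noteq> 0 the modulus is 2 |sin (rh/2)| / |r|, which vanishes at |r| h = 2\<pi>.
  The bound \<pi> on |r| h keeps the half angle in [0, \<pi>/2], where \<open>half_le_sin\<close>
  applies.\<close>

lemma norm_integral_osc_ge:
  assumes h: "h > 0" "\<bar>r\<bar> * h \<le> pi"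
  shows "h / 2 \<le> cmod (integral {0..h} (osc r))"
proof (cases "r = 0")
  case True
  then have "osc r = (\<lambda>s. 1)" by (simp add: fun_eq_iff)
  then show ?thesis using h by simp
next
  case False
  have "(osc r has_integral (\<i> / of_real r * osc r h - \<i> / of_real r * osc r 0)) {0..h}"
  proof (rule fundamental_theorem_of_calculus)
    fix s assume "s \<in> {0..h}"
    have "((\<lambda>s. \<i> / of_real r * exp (- (\<i> * of_real r * s))) has_field_derivative
        \<i> / of_real r * (exp (- (\<i> * of_real r * of_real s)) * (- (\<i> * of_real r)))) (at (complex_of_real s))"
      using False by (auto intro!: derivative_eq_intros simp: mult_ac)
    from has_vector_derivative_real_field[OF this]
    have "((\<lambda>s. \<i> / of_real r * osc r s) has_vector_derivative
        \<i> / of_real r * (osc r s * (- (\<i> * of_real r)))) (at s within {0..h})"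
      by (simp only: osc_def o_def)
    also have "\<i> / of_real r * (osc r s * (- (\<i> * of_real r))) = osc r s"
      using False by (simp add: mult_ac)
    finally show "((\<lambda>s. \<i> / of_real r * osc r s) has_vector_derivative osc r s) (at s within {0..h})" .
  qed (use h in simp)
  then have "integral {0..h} (osc r) = \<i> / of_real r * (osc r h - 1)"
    by (simp add: integral_unique algebra_simps)
  then have eq: "cmod (integral {0..h} (osc r)) = 2 * \<bar>sin (r * h / 2)\<bar> / \<bar>r\<bar>"
    by (simp add: norm_mult norm_divide norm_osc_diff_1)
  have "\<bar>r\<bar> * h / 2 / 2 \<le> sin (\<bar>r\<bar> * h / 2)"
    using h by (intro half_le_sin) auto
  also have "\<dots> \<le> \<bar>sin (r * h / 2)\<bar>"
    by (cases "r \<ge> 0") (auto simp: abs_if)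
  finally show ?thesis
    using False unfolding eq by (simp add: field_simps)
qed

text \<open>On each cell \<open>[nh, nh + h]\<close> only \<open>f\<close> is frozen, not the exponential, which need not be
  nearly constant there; for \<open>\<bar>r\<bar> \<le> \<pi>/h\<close> its integral over a cell still has modulus at least \<open>h/2\<close>.\<close>

lemma sampled_sum_near:
  fixes f :: "real \<Rightarrow> 'a::complex_banach"
  assumes Y: "complex_vector.subspace Y" and f: "continuous_on {0..} f"
    and h: "h > 0" "\<bar>r\<bar> * h \<le> pi" and d: "\<And>s. 0 \<le> s \<Longrightarrow> s \<le> h \<Longrightarrow> almost_period f d s"
    and near: "near Y (e * (real N * h)) (integral {0..real N * h} (\<lambda>s. osc r s *\<^sub>C f s))"
    and pos: "e + d \<ge> 0"
  shows "near Y (2 * real N * (e + d)) (\<Sum>n<N. osc r (real n * h) *\<^sub>C f (real n * h))"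
proof -
  define \<kappa> where "\<kappa> = integral {0..h} (osc r)"
  define Z where "Z = (\<Sum>n<N. osc r (real n * h) *\<^sub>C f (real n * h))"
  have \<kappa>: "h / 2 \<le> cmod \<kappa>"
    unfolding \<kappa>_def by (rule norm_integral_osc_ge[OF h])
  have block: "norm (\<kappa> *\<^sub>C osc r a *\<^sub>C f a - integral {a..a + h} (\<lambda>s. osc r s *\<^sub>C f s)) \<le> d * h"
    if a: "a \<ge> 0" for a
  proof -
    have osc_int: "osc r integrable_on S" if "S = {u..v}" for S u v
      unfolding that by (intro integrable_continuous_real continuous_intros)
    have "\<kappa> * osc r a = integral {0..h} (\<lambda>s. osc r (a + s))"
      unfolding \<kappa>_def osc_add using integral_mult_right[of "{0..h}" "osc r a" "osc r"]
      by (simp add: mult.commute)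
    also have "\<dots> = integral {a..a + h} (osc r)"
      using integral_shift_Icc_real[of 0 h "osc r" a] by (simp add: o_def add.commute)
    finally have "\<kappa> *\<^sub>C osc r a *\<^sub>C f a = integral {a..a + h} (\<lambda>s. osc r s *\<^sub>C f a)"
      using integral_linear[OF osc_int[OF refl] bounded_bilinear.bounded_linear_left[OF bounded_bilinear_scaleC], of a "a + h" "f a"]
      by (simp add: o_def)
    moreover have c1: "continuous_on {a..a + h} (\<lambda>s. osc r s *\<^sub>C f a)"
      by (intro continuous_intros)
    moreover have c2: "continuous_on {a..a + h} (\<lambda>s. osc r s *\<^sub>C f s)"
      by (rule continuous_on_halfline[OF continuous_on_twist[OF f] a])
    ultimately have "\<kappa> *\<^sub>C osc r a *\<^sub>C f a - integral {a..a + h} (\<lambda>s. osc r s *\<^sub>C f s)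
        = integral {a..a + h} (\<lambda>s. osc r s *\<^sub>C f a - osc r s *\<^sub>C f s)"
      by (simp add: Henstock_Kurzweil_Integration.integral_diff integrable_continuous_real)
    also have "norm \<dots> \<le> d * (a + h - a)"
    proof (rule integral_bound[OF _ continuous_on_diff[OF c1 c2]])
      fix s assume s: "s \<in> {a..a + h}"
      then have "norm (f (a + (s - a)) - f a) \<le> d"
        using d[of "s - a"] a unfolding almost_period_def by auto
      then show "norm (osc r s *\<^sub>C f a - osc r s *\<^sub>C f s) \<le> d"
        by (simp add: scaleC_diff_right[symmetric] norm_scaleC norm_minus_commute)
    qed (use h in simp)
    finally show ?thesis by simp
  qed
  have "\<kappa> *\<^sub>C Z - integral {0..real N * h} (\<lambda>s. osc r s *\<^sub>C f s)
      = (\<Sum>n<N. \<kappa> *\<^sub>C osc r (real n * h) *\<^sub>C f (real n * h)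
          - integral {real n * h..real n * h + h} (\<lambda>s. osc r s *\<^sub>C f s))"
    unfolding Z_def integral_blocks[OF continuous_on_twist[OF f] less_imp_le[OF h(1)]] scaleC_sum_right
      sum_subtractf ..
  also have "norm \<dots> \<le> (\<Sum>n<N. d * h)"
    using h by (intro sum_norm_le block) auto
  finally have "near Y (e * (real N * h) + (\<Sum>n<N. d * h)) (\<kappa> *\<^sub>C Z)"
    by (rule near_perturb[OF near])
  then have 1: "near Y ((e + d) * (real N * h)) (\<kappa> *\<^sub>C Z)"
    by (simp add: algebra_simps)
  have \<kappa>0: "\<kappa> \<noteq> 0" using \<kappa> h by auto
  \<comment> \<open>Division by \<kappa> costs at most 2 / h, which turns the length real N * h into
    the factor 2 * real N.\<close>
  have "near Y (cmod (1 / \<kappa>) * ((e + d) * (real N * h))) ((1 / \<kappa>) *\<^sub>C \<kappa> *\<^sub>C Z)"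
    by (rule near_scale[OF Y 1])
  also have "(1 / \<kappa>) *\<^sub>C \<kappa> *\<^sub>C Z = Z"
    using \<kappa>0 by (simp del: complex_vector.scale_left_diff_distrib)
  finally have "near Y (cmod (1 / \<kappa>) * ((e + d) * (real N * h))) Z" .
  moreover have "cmod (1 / \<kappa>) * ((e + d) * (real N * h)) \<le> (2 / h) * ((e + d) * (real N * h))"
  proof (rule mult_right_mono)
    show "cmod (1 / \<kappa>) \<le> 2 / h"
      using \<kappa> h \<kappa>0 by (simp add: norm_divide field_simps)
    show "0 \<le> (e + d) * (real N * h)"
      using pos h by simp
  qed
  moreover have "(2 / h) * ((e + d) * (real N * h)) = 2 * real N * (e + d)"
    using h by simp
  ultimately show ?thesis unfolding Z_def by (auto intro: near_mono)
qed

lemma card_ge_of_blocks: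
  assumes "\<And>j. \<exists>n. j * q \<le> n \<and> n + m \<le> Suc j * q \<and> (\<forall>i<m. P (n + i))"
  shows "J * m \<le> card {n. n < J * q \<and> P n}"
proof (induction J)
  case (Suc J)
  obtain n where n: "J * q \<le> n" "n + m \<le> Suc J * q" "\<And>i. i < m \<Longrightarrow> P (n + i)"
    using assms by blast
  have "{n. n < J * q \<and> P n} \<union> {n..<n + m} \<subseteq> {n. n < Suc J * q \<and> P n}"
  proof
    fix k assume "k \<in> {n. n < J * q \<and> P n} \<union> {n..<n + m}"
    then show "k \<in> {n. n < Suc J * q \<and> P n}"
      using n(2) n(3)[of "k - n"] by auto
  qed
  then have "card ({n. n < J * q \<and> P n} \<union> {n..<n + m}) \<le> card {n. n < Suc J * q \<and> P n}"
    by (intro card_mono) auto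
  moreover have "card ({n. n < J * q \<and> P n} \<union> {n..<n + m}) = card {n. n < J * q \<and> P n} + m"
    using n(1) by (subst card_Un_disjoint) auto
  ultimately show ?case
    using Suc by simp
qed simp

text \<open>A window of m * p grid steps has length p * \<delta>. It contains an almost period
  \<tau> together with the m grid points that follow it within \<delta>, all of them almost periods
  for 2 * e. The resulting density 1 / (2 * p) does not involve m, the fineness of the grid.\<close>

lemma many_sampled_almost_periods:
  fixes f :: "real \<Rightarrow> 'a::complex_banach"
  assumes l: "l > 0" "\<And>a. a \<ge> 0 \<Longrightarrow> \<exists>\<tau>\<in>{a..a + l}. almost_period f e \<tau>"
    and \<delta>: "\<delta> > 0" "\<And>s. 0 \<le> s \<Longrightarrow> s \<le> \<delta> \<Longrightarrow> almost_period f e s"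
    and p: "l / \<delta> + 2 \<le> real p" and m: "m > 0" and N: "m * p \<le> N"
  shows "real N / (2 * real p) \<le> real (card {n. n < N \<and> almost_period f (2 * e) (real n * (\<delta> / real m))})"
proof -
  define h where "h = \<delta> / real m"
  have h: "h > 0" "real m * h = \<delta>" using \<delta> m by (simp_all add: h_def)
  define P where "P = (\<lambda>n. almost_period f (2 * e) (real n * h))"
  have p0: "p > 0"
    using p l \<delta> by (metis add_nonneg_pos divide_nonneg_nonneg gr0I le_less_trans less_imp_le less_irrefl of_nat_0 zero_less_numeral)
  have "\<exists>n. j * (m * p) \<le> n \<and> n + m \<le> Suc j * (m * p) \<and> (\<forall>i<m. P (n + i))" for j
  proof -
    have "real (j * (m * p)) * h \<ge> 0" using h by simp
    then obtain \<tau> where \<tau>: "\<tau> \<ge> real (j * (m * p)) * h" "\<tau> \<le> real (j * (m * p)) * h + l" "almost_period f e \<tau>"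
      using l(2)[of "real (j * (m * p)) * h"] by auto
    have \<tau>0: "\<tau> \<ge> 0" using \<tau>(3) by (simp add: almost_period_def)
    \<comment> \<open>The first grid index at or after \<tau>. Rounding up adds at most \<delta>,
      the run of m points another \<delta>; the window has room because l + 2 * \<delta> \<le> real
      p * \<delta>.\<close>
    define n where "n = nat \<lceil>\<tau> / h\<rceil>"
    have "real n = of_int \<lceil>\<tau> / h\<rceil>"
      using \<tau>0 h by (simp add: n_def)
    then have "\<tau> / h \<le> real n" "real n < \<tau> / h + 1" by linarith+
    then have n: "\<tau> \<le> real n * h" "real n * h < \<tau> + h"
      using h by (simp_all add: field_simps)
    have "real (j * (m * p)) * h \<le> real n * h" using \<tau> n by linarith
    then have 1: "j * (m * p) \<le> n" using h by (simp del: of_nat_mult)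
    have "real (n + m) * h = real n * h + \<delta>"
      using h by (simp add: algebra_simps)
    also have "\<dots> \<le> real (j * (m * p)) * h + (l + 2 * \<delta>)"
    proof -
      have "h \<le> \<delta>"
        using m \<delta> by (simp add: h_def field_simps)
      then show ?thesis using n(2) \<tau>(2) by linarith
    qed
    also have "\<dots> \<le> real (j * (m * p)) * h + real p * \<delta>"
      using p \<delta> by (simp add: field_simps)
    also have "\<dots> = real (Suc j * (m * p)) * h"
      by (simp add: h(2)[symmetric] algebra_simps)
    finally have 2: "n + m \<le> Suc j * (m * p)"
      using h(1) by (simp del: of_nat_mult of_nat_add mult_Suc)
    have "P (n + i)" if "i < m" for i
    proof -
      have "real i * h \<le> (real m - 1) * h"
        using that h by (intro mult_right_mono) auto
      then have "real i * h \<le> \<delta> - h" using h by (simp add: algebra_simps)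
      moreover have "0 \<le> real i * h" using h by simp
      ultimately have "almost_period f e (real n * h + real i * h - \<tau>)"
        using n by (intro \<delta>(2)) linarith+
      then have "almost_period f e (real (n + i) * h - \<tau>)"
        by (simp add: algebra_simps)
      from almost_period_add[OF \<tau>(3) this] show ?thesis by (simp add: P_def)
    qed
    with 1 2 show ?thesis by blast
  qed
  from card_ge_of_blocks[of "m * p", OF this]
  have "(N div (m * p)) * m \<le> card {n. n < N div (m * p) * (m * p) \<and> P n}" .
  also have "\<dots> \<le> card {n. n < N \<and> P n}"
    by (intro card_mono) (auto intro: less_le_trans[OF _ div_times_less_eq_dividend])
  finally have 3: "real (N div (m * p)) * real m \<le> real (card {n. n < N \<and> P n})"
    unfolding of_nat_mult[symmetric] of_nat_le_iff .
  have mp: "m * p > 0" using m p0 by simp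
  have "1 \<le> N div (m * p)"
    using N mp by (simp add: Suc_le_eq div_greater_zero_iff)
  \<comment> \<open>At least one full window fits, so the incomplete one at most doubles the length;
    this is the 2 in 2 * real p.\<close>
  then have "(N div (m * p) + 1) * (m * p) \<le> (2 * (N div (m * p))) * (m * p)"
    by (intro mult_le_mono1) simp
  moreover have "N < (N div (m * p) + 1) * (m * p)"
    using dividend_less_div_times[OF mp, of N] by (simp only: add_mult_distrib mult_1)
  ultimately have "real N \<le> real ((2 * (N div (m * p))) * (m * p))"
    unfolding of_nat_le_iff by linarith
  then have "real N \<le> 2 * (real (N div (m * p)) * real m) * real p"
    by (simp only: of_nat_mult of_nat_numeral mult.assoc)
  then have "real N / (2 * real p) \<le> real (N div (m * p)) * real m"
    using p0 by (simp add: field_simps)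
  with 3 show ?thesis by (simp add: P_def h_def)
qed

section \<open>Approximation by Bohr means\<close>

lemma near_of_sampling:
  fixes f :: "real \<Rightarrow> 'a::complex_banach"
  assumes Y: "complex_vector.subspace Y" and h: "h > 0" and N: "N > 0"
    and NT: "almost_period f (2 * e) (real N * h)"
    and S: "S = {n. n < N \<and> almost_period f (2 * e) (real n * h)}" "S \<noteq> {}"
    and e: "e > 0"
    and sums: "\<And>r. \<bar>r\<bar> * h \<le> pi \<Longrightarrow> near Y (real N * c) (\<Sum>n<N. osc r (real n * h) *\<^sub>C f (real n * h))"
  shows "near Y (c * real N / real (card S) + 6 * e) (f 0)"
proof -
  \<comment> \<open>Centring: |j - b| \<le> N/2 gives |r| * h \<le> \<pi>, the range in which
    \<open>sums\<close> is available.\<close>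
  define b where "b = N div 2"
  define F where "F = (\<lambda>t. f (real t * h))"
  define a where "a = (\<lambda>j. (cmod (\<Sum>n\<in>S. dft_char N b j (int n)))\<^sup>2)"
  have SN: "S \<subseteq> {..<N}" using S by auto
  have fin: "finite S" using SN finite_subset by blast
  have card: "card S > 0" using fin S(2) by (simp add: card_gt_0_iff)
  have G: "near Y (real N * c) (\<Sum>t<N. dft_char N b j (- int t) *\<^sub>C F t)" if j: "j < N" for j
  proof -
    define r where "r = 2 * pi * (real j - real b) / (real N * h)"
    have "2 * pi * (real j - real b) * real_of_int (- int t) / real N = - (r * (real t * h))" for t
      using h N by (simp add: r_def field_simps)
    then have "dft_char N b j (- int t) = osc r (real t * h)" for t
      by (simp only: dft_char_def osc_eq cis_conv_exp)
    moreover have "\<bar>r\<bar> * h \<le> pi"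
    proof -
      have "2 * j \<le> 2 * b + N" "2 * b \<le> 2 * j + N"
        using j by (auto simp: b_def)
      then have "real (2 * j) \<le> real (2 * b + N)" "real (2 * b) \<le> real (2 * j + N)"
        by (simp_all only: of_nat_le_iff)
      then have "2 * \<bar>real j - real b\<bar> \<le> real N"
        by (auto simp: abs_if)
      then have le: "2 * \<bar>real j - real b\<bar> * pi \<le> real N * pi"
        by (intro mult_right_mono) auto
      have eq: "\<bar>r\<bar> * h = 2 * \<bar>real j - real b\<bar> * pi / real N"
        using h N by (simp add: r_def abs_mult)
      show ?thesis
        unfolding eq using le N by (subst pos_divide_le_eq) (simp_all add: mult.commute)
    qed
    ultimately show ?thesis using sums[of r] by (simp add: F_def)
  qed
  have "near Y (\<Sum>j<N. cmod (of_real (a j)) * (real N * c))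
      (\<Sum>j<N. of_real (a j) *\<^sub>C (\<Sum>t<N. dft_char N b j (- int t) *\<^sub>C F t))"
    by (intro near_sum[OF Y] near_scale[OF Y] G) auto
  also have "(\<Sum>j<N. of_real (a j) *\<^sub>C (\<Sum>t<N. dft_char N b j (- int t) *\<^sub>C F t))
      = of_nat N *\<^sub>C (\<Sum>n\<in>S. \<Sum>k\<in>S. F ((n + N - k) mod N))"
    unfolding a_def by (rule cyclic_differences_dft[OF N SN])
  also have "(\<Sum>j<N. cmod (of_real (a j)) * (real N * c)) = (\<Sum>j<N. a j) * (real N * c)"
    by (simp add: sum_distrib_right a_def norm_power)
  also have "(\<Sum>j<N. a j) = real N * real (card S)"
    unfolding a_def by (rule dft_parseval[OF N SN])
  finally have 1: "near Y (real N * real (card S) * (real N * c))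
      (of_nat N *\<^sub>C (\<Sum>n\<in>S. \<Sum>k\<in>S. F ((n + N - k) mod N)))" .
  \<comment> \<open>Normalisation: N comes from Fourier inversion, the square of card S is the
    number of pairs (n, k).\<close>
  define w where "w = 1 / (real N * (real (card S))\<^sup>2)"
  have w: "w > 0" using N card by (simp add: w_def)
  define V where "V = (1 / (real (card S))\<^sup>2) *\<^sub>R (\<Sum>n\<in>S. \<Sum>k\<in>S. F ((n + N - k) mod N))"
  have "near Y (cmod (of_real w) * (real N * real (card S) * (real N * c)))
      (of_real w *\<^sub>C of_nat N *\<^sub>C (\<Sum>n\<in>S. \<Sum>k\<in>S. F ((n + N - k) mod N)))"
    by (rule near_scale[OF Y 1])
  also have "cmod (of_real w) * (real N * real (card S) * (real N * c)) = c * real N / real (card S)"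
  proof -
    have "cmod (of_real w) = w" using w by simp
    then show ?thesis
      using N card by (simp add: w_def power2_eq_square field_simps)
  qed
  also have "of_real w *\<^sub>C of_nat N *\<^sub>C (\<Sum>n\<in>S. \<Sum>k\<in>S. F ((n + N - k) mod N)) = V"
  proof -
    have "of_real w * of_nat N = complex_of_real (1 / (real (card S))\<^sup>2)"
      using N by (simp add: w_def)
    then show ?thesis
      unfolding V_def scaleC_scaleC by (simp only: scaleC_of_real)
  qed
  finally have 2: "near Y (c * real N / real (card S)) V" .
  \<comment> \<open>A difference of two indices in S costs 2 * e + 2 * e; if it is negative, N is
    added, and the almost period real N * h costs 2 * e more.\<close>
  have dev: "norm (f 0 - F ((n + N - k) mod N)) \<le> 6 * e" if nk: "n \<in> S" "k \<in> S" for n k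
  proof -
    have n: "n < N" "almost_period f (2 * e) (real n * h)"
      and k: "k < N" "almost_period f (2 * e) (real k * h)" using nk S by auto
    have "almost_period f (6 * e) (real ((n + N - k) mod N) * h)"
    proof (cases "k \<le> n")
      case True
      then have eq: "(n + N - k) mod N = n - k"
        using n by (metis diff_add_assoc2 less_imp_diff_less mod_add_self2 mod_less)
      have "almost_period f (2 * e + 2 * e) (real n * h - real k * h)"
        using True h by (intro almost_period_diff n k mult_right_mono) auto
      moreover have "real n * h - real k * h = real (n - k) * h"
        using True by (simp add: algebra_simps of_nat_diff)
      ultimately show ?thesis
        unfolding eq using e by (auto elim: almost_period_mono)
    next
      case False
      then have eq: "(n + N - k) mod N = n + N - k"
        using k by (intro mod_less) auto
      have le: "k \<le> n + N" using k by simp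
      have "real k * h \<le> real (n + N) * h"
        using h le by (intro mult_right_mono) (auto simp del: of_nat_add)
      then have "real k * h \<le> real n * h + real N * h"
        by (simp add: algebra_simps)
      then have "almost_period f ((2 * e + 2 * e) + 2 * e) (real n * h + real N * h - real k * h)"
        by (intro almost_period_diff[OF almost_period_add] n k NT)
      moreover have "real n * h + real N * h - real k * h = real (n + N - k) * h"
        using le by (simp add: algebra_simps of_nat_diff)
      ultimately show ?thesis
        unfolding eq by (auto elim: almost_period_mono)
    qed
    then have "norm (f (0 + real ((n + N - k) mod N) * h) - f 0) \<le> 6 * e"
      unfolding almost_period_def by blast
    then show ?thesis by (simp add: F_def norm_minus_commute)
  qed
  have "f 0 - V = (1 / (real (card S))\<^sup>2) *\<^sub>R (\<Sum>n\<in>S. \<Sum>k\<in>S. f 0 - F ((n + N - k) mod N))"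
    using card by (simp add: V_def sum_subtractf scaleR_right_diff_distrib sum_constant_scaleR power2_eq_square)
  also have "norm \<dots> \<le> (1 / (real (card S))\<^sup>2) * (\<Sum>n\<in>S. \<Sum>k\<in>S. 6 * e)"
    unfolding norm_scaleR by (intro mult_mono sum_norm_le dev) (auto simp: sum_nonneg)
  also have "\<dots> = 6 * e"
    using card by (simp add: power2_eq_square)
  finally show ?thesis
    by (rule near_perturb[OF 2])
qed

text \<open>p, hence the bound 2 * p for N / |S|, is fixed before d, \<eta> and the step h; T0
  depends on h through the frequency range, so N is chosen last.\<close>

theorem almost_periodic_value_in_closure:
  fixes f :: "real \<Rightarrow> 'a::complex_banach"
  assumes ap: "almost_periodic f" and Y: "complex_vector.subspace Y" "\<And>r. bohr_mean r f \<in> Y"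
  shows "f 0 \<in> closure Y"
proof -
  have f: "continuous_on {0..} f" using ap by (simp add: almost_periodic_def)
  have "near Y (8 * e) (f 0)" if e: "e > 0" for e
  proof -
    obtain l where l: "l > 0" "\<And>a. a \<ge> 0 \<Longrightarrow> \<exists>\<tau>\<in>{a..a + l}. almost_period f e \<tau>"
      using almost_periodicD[OF ap e] by blast
    obtain \<delta> where \<delta>: "\<delta> > 0" "\<And>h. 0 \<le> h \<Longrightarrow> h \<le> \<delta> \<Longrightarrow> almost_period f e h"
      using almost_periodic_small_shifts[OF ap e] by blast
    obtain p where p: "l / \<delta> + 2 \<le> real p" using real_arch_simple by blast
    have p0: "p > 0"
      using p l \<delta> by (metis add_nonneg_pos divide_nonneg_nonneg gr0I le_less_trans less_imp_le less_irrefl of_nat_0 zero_less_numeral)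
    \<comment> \<open>With d for both the integral and the sampling error,
      \<open>sampled_sum_near\<close> gives 4 * d per sample; multiplied by the mass bound 2 * p
      this is e.\<close>
    define d where "d = e / (8 * real p)"
    have d: "d > 0" "8 * real p * d = e" using e p0 by (simp_all add: d_def)
    obtain \<eta> where \<eta>: "\<eta> > 0" "\<And>h. 0 \<le> h \<Longrightarrow> h \<le> \<eta> \<Longrightarrow> almost_period f d h"
      using almost_periodic_small_shifts[OF ap d(1)] by blast
    \<comment> \<open>h = \<delta> / m refines the grid below \<eta> while \<delta> remains a whole
      multiple of h.\<close>
    obtain m where m: "\<delta> / \<eta> \<le> real m" using real_arch_simple by blast
    have m0: "m > 0"
      using m \<delta> \<eta> by (metis divide_pos_pos gr0I le_less_trans less_irrefl of_nat_0)
    define h where "h = \<delta> / real m"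
    have h: "h > 0" "h \<le> \<eta>" "h \<le> \<delta>"
      using m \<delta> \<eta> m0 by (simp_all add: h_def field_simps)
    obtain T0 where T0: "\<And>T r. T \<ge> T0 \<Longrightarrow> r \<in> {-(pi / h)..pi / h} \<Longrightarrow>
        near Y (d * T) (integral {0..T} (\<lambda>s. osc r s *\<^sub>C f s))"
      using twisted_integrals_near[OF ap Y d(1), of "pi / h"] by blast
    \<comment> \<open>An almost period beyond both thresholds is rounded up to the grid; rounding
      shifts it by less than h \<le> \<delta> and doubles e.\<close>
    obtain \<tau> where \<tau>: "\<tau> \<ge> max T0 (real (m * p) * h)" "almost_period f e \<tau>"
      using l(2)[of "max T0 (real (m * p) * h)"] h by (fastforce simp: le_max_iff_disj)
    define N where "N = nat \<lceil>\<tau> / h\<rceil>"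
    have "\<tau> \<ge> 0" using \<tau> by (simp add: almost_period_def)
    then have "real N = of_int \<lceil>\<tau> / h\<rceil>" using h by (simp add: N_def)
    then have "\<tau> / h \<le> real N" "real N < \<tau> / h + 1" by linarith+
    then have N: "\<tau> \<le> real N * h" "real N * h < \<tau> + h"
      using h by (simp_all add: field_simps)
    have "real (m * p) * h \<le> real N * h"
      using order_trans[OF max.cobounded2 \<tau>(1)] N(1) by (rule order_trans)
    then have mp: "m * p \<le> N" using h by (simp del: of_nat_mult)
    then have N0: "N > 0" using m0 p0 by (metis gr0I le_zero_eq mult_is_0)
    have "almost_period f (e + e) (\<tau> + (real N * h - \<tau>))"
      using N h by (intro almost_period_add \<tau>(2) \<delta>(2)) auto
    then have NT: "almost_period f (2 * e) (real N * h)" by simp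
    define S where "S = {n. n < N \<and> almost_period f (2 * e) (real n * h)}"
    have cardS: "real N / (2 * real p) \<le> real (card S)"
      unfolding S_def h_def by (rule many_sampled_almost_periods[OF l \<delta> p m0 mp])
    moreover have "real N / (2 * real p) > 0" using N0 p0 by simp
    ultimately have card0: "real (card S) > 0" by linarith
    then have "S \<noteq> {}" by auto
    have "near Y (real N * (4 * d)) (\<Sum>n<N. osc r (real n * h) *\<^sub>C f (real n * h))"
      if r: "\<bar>r\<bar> * h \<le> pi" for r
    proof -
      have "\<bar>r\<bar> \<le> pi / h"
        using r h by (simp add: pos_le_divide_eq)
      then have "r \<in> {-(pi / h)..pi / h}"
        by (simp add: abs_le_iff)
      then have "near Y (d * (real N * h)) (integral {0..real N * h} (\<lambda>s. osc r s *\<^sub>C f s))"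
        using T0 \<tau>(1) N by simp
      from sampled_sum_near[OF Y(1) f h(1) r _ this, of d] \<eta>(2) h d
      show ?thesis by (simp add: mult_ac)
    qed
    from near_of_sampling[OF Y(1) h(1) N0 NT S_def \<open>S \<noteq> {}\<close> e this]
    have "near Y (4 * d * real N / real (card S) + 6 * e) (f 0)" by simp
    moreover have "4 * d * real N / real (card S) \<le> e"
    proof -
      have "real N \<le> 2 * real p * real (card S)"
        using cardS p0 by (simp add: field_simps)
      then have "4 * d * real N \<le> 4 * d * (2 * real p * real (card S))"
        using d by (intro mult_left_mono) auto
      also have "\<dots> = e * real (card S)"
        by (simp add: d(2)[symmetric])
      finally show ?thesis using card0 by (simp add: field_simps)
    qed
    ultimately show ?thesis using e by (auto elim!: near_mono)
  qed
  note near = this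
  show ?thesis
    unfolding closure_approachable
  proof (intro allI impI)
    fix e :: real assume "e > 0"
    then obtain y where "y \<in> Y" "norm (f 0 - y) \<le> 8 * (e / 16)"
      using near[of "e / 16"] unfolding near_def by auto
    with \<open>e > 0\<close> show "\<exists>y\<in>Y. dist y (f 0) < e"
      by (intro bexI[of _ y]) (auto simp: dist_norm norm_minus_commute)
  qed
qed

section \<open>Distributions along translations, and the primitive of a distribution\<close>

section \<open>Test functions\<close>

lemma vector_derivative_lipschitz:
  fixes f :: "real \<Rightarrow> 'a::real_normed_vector"
  assumes "convex S" "\<And>s. s \<in> S \<Longrightarrow> (f has_vector_derivative f' s) (at s within S)"
    "\<And>s. s \<in> S \<Longrightarrow> norm (f' s) \<le> B" "x \<in> S" "y \<in> S"
  shows "norm (f x - f y) \<le> B * \<bar>x - y\<bar>"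
proof -
  have "norm (f x - f y) \<le> B * norm (x - y)"
  proof (rule differentiable_bound[OF assms(1)])
    fix s assume s: "s \<in> S"
    then show "(f has_derivative (\<lambda>h. h *\<^sub>R f' s)) (at s within S)"
      using assms(2) by (simp add: has_vector_derivative_def)
    show "onorm (\<lambda>h. h *\<^sub>R f' s) \<le> B"
      using assms(3)[OF s] by (intro onorm_le) (simp add: mult.commute[of B] mult_left_mono)
  qed (use assms in auto)
  then show ?thesis by simp
qed

lemma vderiv_eqI: "(\<phi> has_vector_derivative d) (at t) \<Longrightarrow> vderiv \<phi> t = d"
  by (simp add: vderiv_def vector_derivative_at)

lemma smooth_has_vector_derivative:
  "smooth \<phi> \<Longrightarrow> ((vderiv ^^ n) \<phi> has_vector_derivative (vderiv ^^ Suc n) \<phi> t) (at t within S)"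
  by (rule has_vector_derivative_at_within)
    (simp add: smooth_def vderiv_apply vector_derivative_works[symmetric])

lemma smooth_vderiv: "smooth \<phi> \<Longrightarrow> smooth (vderiv \<phi>)"
  unfolding smooth_def by (metis comp_apply funpow_Suc_right)

lemma smooth_continuous: "smooth \<phi> \<Longrightarrow> continuous_on S ((vderiv ^^ n) \<phi>)"
  using smooth_has_vector_derivative continuous_on_vector_derivative by blast

lemma vderiv_shift: 
  assumes "smooth \<phi>"
  shows "(vderiv ^^ n) (\<lambda>t. \<phi> (t - s)) = (\<lambda>t. (vderiv ^^ n) \<phi> (t - s))"
proof (induction n)
  case (Suc n)
  show ?case
  proof
    fix t
    have "(((vderiv ^^ n) \<phi> \<circ> (\<lambda>t. t - s)) has_vector_derivative 1 *\<^sub>R (vderiv ^^ Suc n) \<phi> (t - s)) (at t)"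
      by (intro vector_diff_chain_at smooth_has_vector_derivative assms)
        (auto intro!: derivative_eq_intros)
    then show "(vderiv ^^ Suc n) (\<lambda>t. \<phi> (t - s)) t = (vderiv ^^ Suc n) \<phi> (t - s)"
      using Suc by (simp add: o_def vderiv_eqI)
  qed
qed simp

lemma smooth_shift:
  assumes "smooth \<phi>"
  shows "smooth (\<lambda>t. \<phi> (t - s))"
  unfolding smooth_def vderiv_shift[OF assms]
proof (intro allI)
  fix n t
  have "(((vderiv ^^ n) \<phi> \<circ> (\<lambda>t. t - s)) has_vector_derivative 1 *\<^sub>R (vderiv ^^ Suc n) \<phi> (t - s)) (at t)"
    by (intro vector_diff_chain_at smooth_has_vector_derivative assms)
      (auto intro!: derivative_eq_intros)
  then show "(\<lambda>t. (vderiv ^^ n) \<phi> (t - s)) differentiable at t"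
    unfolding o_def by (rule differentiableI_vector)
qed

lemma vderiv_eq_0:
  assumes "smooth \<phi>" "closed K" "\<And>t. t \<notin> K \<Longrightarrow> \<phi> t = 0" "t \<notin> K"
  shows "(vderiv ^^ n) \<phi> t = 0"
  using assms(4)
proof (induction n arbitrary: t)
  case (Suc n)
  have "((\<lambda>_. 0) has_vector_derivative (vderiv ^^ Suc n) \<phi> t) (at t)"
    by (rule has_vector_derivative_transform_within_open[where S = "- K", OF smooth_has_vector_derivative[OF assms(1)]])
      (use Suc assms(2) in auto)
  then show ?case
    using vector_derivative_unique_at has_vector_derivative_const by blast
qed (use assms(3) in auto)

lemma test_funs_on_closed_iff:
  "closed K \<Longrightarrow> \<phi> \<in> test_funs_on K \<longleftrightarrow> \<phi> \<in> test_funs \<and> (\<forall>t. t \<notin> K \<longrightarrow> \<phi> t = 0)"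
  unfolding test_funs_on_def fun_supp_def
  using closure_subset[of "{t. \<phi> t \<noteq> 0}"] closure_minimal[of "{t. \<phi> t \<noteq> 0}" K] by blast

lemma test_funs_iff: "\<phi> \<in> test_funs \<longleftrightarrow> smooth \<phi> \<and> (\<exists>a b. \<forall>t. t \<notin> {a..b} \<longrightarrow> \<phi> t = 0)"
proof
  assume "\<phi> \<in> test_funs"
  then have sm: "smooth \<phi>" and "bounded (fun_supp \<phi>)"
    by (auto simp: test_funs_def compact_imp_bounded)
  then obtain a where "\<And>t. t \<in> fun_supp \<phi> \<Longrightarrow> \<bar>t\<bar> \<le> a"
    unfolding bounded_iff by auto
  then have "\<forall>t. t \<notin> {-a..a} \<longrightarrow> \<phi> t = 0"
    using closure_subset[of "{t. \<phi> t \<noteq> 0}"] unfolding fun_supp_def by (force simp: abs_le_iff)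
  with sm show "smooth \<phi> \<and> (\<exists>a b. \<forall>t. t \<notin> {a..b} \<longrightarrow> \<phi> t = 0)" by blast
next
  assume "smooth \<phi> \<and> (\<exists>a b. \<forall>t. t \<notin> {a..b} \<longrightarrow> \<phi> t = 0)"
  then obtain a b where ab: "smooth \<phi>" "\<And>t. t \<notin> {a..b} \<Longrightarrow> \<phi> t = 0" by blast
  have "fun_supp \<phi> \<subseteq> {a..b}"
    unfolding fun_supp_def using ab(2) by (intro closure_minimal) (blast, simp)
  then have "compact (fun_supp \<phi>)"
    using bounded_subset[OF bounded_closed_interval] by (auto simp: compact_eq_bounded_closed fun_supp_def)
  with ab show "\<phi> \<in> test_funs" by (simp add: test_funs_def)
qed

lemma test_funs_on_Icc_iff:
  "\<phi> \<in> test_funs_on {a..b} \<longleftrightarrow> smooth \<phi> \<and> (\<forall>t. t \<notin> {a..b} \<longrightarrow> \<phi> t = 0)"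
  by (subst test_funs_on_closed_iff) (auto simp: test_funs_iff)

lemma test_funs_obtain_Icc:
  assumes "\<phi> \<in> test_funs"
  obtains a b where "\<phi> \<in> test_funs_on {a..b}"
  using assms by (auto simp: test_funs_on_Icc_iff test_funs_iff)

lemma test_funs_on_subset_test_funs: "\<phi> \<in> test_funs_on K \<Longrightarrow> \<phi> \<in> test_funs"
  by (simp add: test_funs_on_def)

lemma test_funs_on_mono: "\<phi> \<in> test_funs_on K \<Longrightarrow> K \<subseteq> K' \<Longrightarrow> \<phi> \<in> test_funs_on K'"
  by (auto simp: test_funs_on_def)

lemma test_funs_smooth: "\<phi> \<in> test_funs \<Longrightarrow> smooth \<phi>"
  by (simp add: test_funs_def)

lemma test_funs_vderiv: "\<phi> \<in> test_funs \<Longrightarrow> vderiv \<phi> \<in> test_funs"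
  unfolding test_funs_iff using vderiv_eq_0[of \<phi> "{a..b}" _ 1 for a b] smooth_vderiv
  by (metis closed_atLeastAtMost funpow_0 funpow_simps_right(2) o_apply One_nat_def)

lemma test_funs0_vderiv: "\<phi> \<in> test_funs0 \<Longrightarrow> vderiv \<phi> \<in> test_funs0"
  using vderiv_eq_0[of \<phi> "{0..}" _ 1] test_funs_vderiv
  by (auto simp: test_funs_on_closed_iff test_funs_smooth)

lemma test_funs_shift: "\<phi> \<in> test_funs \<Longrightarrow> (\<lambda>t. \<phi> (t - s)) \<in> test_funs"
proof -
  assume "\<phi> \<in> test_funs"
  then obtain a b where ab: "smooth \<phi>" "\<And>t. t \<notin> {a..b} \<Longrightarrow> \<phi> t = 0"
    by (auto simp: test_funs_iff)
  have "\<forall>t. t \<notin> {a + s..b + s} \<longrightarrow> \<phi> (t - s) = 0"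
    using ab(2) by auto
  with smooth_shift[OF ab(1)] show ?thesis unfolding test_funs_iff by blast
qed

lemma test_funs0_shift: "\<phi> \<in> test_funs0 \<Longrightarrow> 0 \<le> s \<Longrightarrow> (\<lambda>t. \<phi> (t - s)) \<in> test_funs0"
  by (auto simp: test_funs_on_closed_iff test_funs_shift)

lemma vderiv_shift1: "smooth \<phi> \<Longrightarrow> vderiv (\<lambda>t. \<phi> (t - s)) = (\<lambda>t. vderiv \<phi> (t - s))"
  using vderiv_shift[of \<phi> 1 s] by simp

text \<open>Continuity and vanishing for negative arguments. This removes the term with
  \<open>C\<close> from \<open>DCF_matrix\<close> on \<open>test_funs0\<close>.\<close>

lemma test_funs0_at_0:
  assumes "\<phi> \<in> test_funs0"
  shows "\<phi> 0 = 0"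
proof -
  have sm: "smooth \<phi>" and 0: "\<And>t. t < 0 \<Longrightarrow> \<phi> t = 0"
    using assms by (auto simp: test_funs_on_closed_iff test_funs_smooth)
  have "isCont \<phi> 0"
    using smooth_continuous[OF sm, where S = UNIV and n = 0] by (simp add: continuous_on_eq_continuous_at)
  then have "(\<phi> \<longlongrightarrow> \<phi> 0) (at_left 0)"
    by (simp add: isCont_def filterlim_at_split)
  moreover have "(\<phi> \<longlongrightarrow> 0) (at_left 0)"
    by (rule tendsto_eventually) (use 0 in \<open>auto simp: eventually_at_filter\<close>)
  ultimately show ?thesis
    using tendsto_unique trivial_limit_at_left_real by blast
qed

lemma test_funs_derivatives_bounded:
  assumes "\<phi> \<in> test_funs"
  obtains B where "B > 0" "\<And>j t. j \<le> n \<Longrightarrow> cmod ((vderiv ^^ j) \<phi> t) \<le> B"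
proof -
  obtain a b where ab: "smooth \<phi>" "\<And>t. t \<notin> {a..b} \<Longrightarrow> \<phi> t = 0"
    using assms by (auto simp: test_funs_iff)
  have "\<exists>B. \<forall>t. cmod ((vderiv ^^ j) \<phi> t) \<le> B" for j
  proof -
    have "bounded ((vderiv ^^ j) \<phi> ` {a..b})"
      by (intro compact_imp_bounded compact_continuous_image smooth_continuous ab) simp
    then obtain B where B: "B > 0" "\<And>t. t \<in> {a..b} \<Longrightarrow> cmod ((vderiv ^^ j) \<phi> t) \<le> B"
      by (auto simp: bounded_pos)
    then have "cmod ((vderiv ^^ j) \<phi> t) \<le> B" for t
      using vderiv_eq_0[OF ab(1) closed_atLeastAtMost ab(2), where t = t and n = j] by (cases "t \<in> {a..b}") auto
    then show ?thesis by blast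
  qed
  then obtain B where B: "\<And>j t. cmod ((vderiv ^^ j) \<phi> t) \<le> B j" by metis
  show ?thesis
  proof (rule that[of "1 + Max (B ` {..n})"])
    have "0 \<le> B 0" using B[of 0 0] norm_ge_zero order_trans by blast
    also have "B 0 \<le> Max (B ` {..n})" by (intro Max_ge) auto
    finally show "1 + Max (B ` {..n}) > 0" by simp
    fix j t assume "j \<le> n"
    then have "B j \<le> Max (B ` {..n})" by (intro Max_ge) auto
    with B[of j t] show "cmod ((vderiv ^^ j) \<phi> t) \<le> 1 + Max (B ` {..n})" by simp
  qed
qed

section \<open>Distributions and translations\<close>

definition test_linear :: "((real \<Rightarrow> complex) \<Rightarrow> 'x::complex_normed_vector) \<Rightarrow> bool"
  where "test_linear T \<longleftrightarrow> (\<forall>\<phi>\<in>test_funs. \<forall>\<psi>\<in>test_funs. \<forall>a b.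
              T (\<lambda>t. a * \<phi> t + b * \<psi> t) = a *\<^sub>C T \<phi> + b *\<^sub>C T \<psi>)"

text \<open>The continuity of a distribution as an estimate on each [a, b] by finitely many
  sup-norms of derivatives; B stands for their common bound. Unlike the inductive limit topology,
  this form passes easily to primitives and to row operators.\<close>

definition order_bounded :: "((real \<Rightarrow> complex) \<Rightarrow> 'x::real_normed_vector) \<Rightarrow> bool"
  where "order_bounded T \<longleftrightarrow> (\<forall>a b. \<exists>n. \<exists>M>0. \<forall>\<phi>\<in>test_funs_on {a..b}. \<forall>B>0.
     (\<forall>j\<le>n. \<forall>t. cmod ((vderiv ^^ j) \<phi> t) \<le> B) \<longrightarrow> norm (T \<phi>) \<le> M * B)"

lemma test_linearD:
  "test_linear T \<Longrightarrow> \<phi> \<in> test_funs \<Longrightarrow> \<psi> \<in> test_funs \<Longrightarrow>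
    T (\<lambda>t. a * \<phi> t + b * \<psi> t) = a *\<^sub>C T \<phi> + b *\<^sub>C T \<psi>"
  by (simp add: test_linear_def)

lemma scaleC_minus_one: "(- 1) *\<^sub>C x = - (x :: 'a::complex_normed_vector)"
  using complex_vector.scale_minus_left[of 1 x] by simp

lemma test_linear_uminus:
  assumes "test_linear T" "\<phi> \<in> test_funs"
  shows "T (\<lambda>t. - \<phi> t) = - T \<phi>"
  using test_linearD[OF assms assms(2), of "-1" 0] by (simp add: scaleC_minus_one)

lemma distribution_test_linear: "distribution T \<Longrightarrow> test_linear T"
  by (simp add: distribution_def test_linear_def)

text \<open>The preimage of the unit ball contains a basic neighbourhood V of 0, whose trace on
  [a, b] is described by n and e. Scaling a test function into it yields the estimate.\<close>

lemma distribution_order_bounded: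
  fixes T :: "(real \<Rightarrow> complex) \<Rightarrow> 'x::complex_normed_vector"
  assumes "distribution T"
  shows "order_bounded T"
  unfolding order_bounded_def
proof (intro allI)
  fix a b :: real
  have lin: "test_linear T" by (rule distribution_test_linear[OF assms])
  have "(vderiv ^^ n) (\<lambda>t. 0) = (\<lambda>t. 0)" for n
  proof (induction n)
    case (Suc n)
    then show ?case by (simp add: vderiv_def)
  qed simp
  then have zero: "(\<lambda>t. 0) \<in> test_funs"
    by (simp add: test_funs_iff smooth_def)
  define U where "U = {\<phi> \<in> test_funs. T \<phi> \<in> ball 0 1}"
  have "openin test_topology {\<phi> \<in> topspace test_topology. T \<phi> \<in> ball 0 1}"
    using assms by (intro openin_continuous_map_preimage[of _ euclidean]) (auto simp: distribution_def)
  then have "test_open U"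
    unfolding openin_test_topology topspace_test_topology U_def .
  moreover have "(\<lambda>t. 0) \<in> U"
    using test_linearD[OF lin zero zero, of 0 0] zero by (simp add: U_def)
  ultimately obtain V where V: "basic_zero_nhd V" "\<And>\<psi>. \<psi> \<in> V \<Longrightarrow> \<psi> \<in> U"
    unfolding test_open_def by fastforce
  then obtain n e where e: "e > 0"
    "\<And>\<phi>. \<phi> \<in> test_funs_on {a..b} \<Longrightarrow> (\<And>j t. j \<le> n \<Longrightarrow> cmod ((vderiv ^^ j) \<phi> t) < e) \<Longrightarrow> \<phi> \<in> V"
    unfolding basic_zero_nhd_def zero_nhd_on_def by (metis compact_Icc)
  show "\<exists>n. \<exists>M>0. \<forall>\<phi>\<in>test_funs_on {a..b}. \<forall>B>0.
     (\<forall>j\<le>n. \<forall>t. cmod ((vderiv ^^ j) \<phi> t) \<le> B) \<longrightarrow> norm (T \<phi>) \<le> M * B"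
  proof (intro exI[of _ n] exI[of _ "2 / e"] conjI ballI allI impI)
    fix \<phi> and B :: real
    assume \<phi>: "\<phi> \<in> test_funs_on {a..b}" and B: "B > 0" "\<forall>j\<le>n. \<forall>t. cmod ((vderiv ^^ j) \<phi> t) \<le> B"
    \<comment> \<open>The 2 makes c * B strictly less than e, as \<open>zero_nhd_on\<close>
      requires.\<close>
    define c where "c = e / (2 * B)"
    have c: "c > 0" "c * B < e" using e B by (simp_all add: c_def)
    have \<phi>t: "\<phi> \<in> test_funs" and sm: "smooth \<phi>" and z: "\<And>t. t \<notin> {a..b} \<Longrightarrow> \<phi> t = 0"
      using \<phi> by (auto simp: test_funs_on_Icc_iff test_funs_iff)
    let ?\<psi> = "\<lambda>t. of_real c * \<phi> t + 0 * \<phi> t"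
    have "?\<psi> \<in> V"
    proof (rule e(2))
      show "?\<psi> \<in> test_funs_on {a..b}"
        using test_funs_lincomb[OF \<phi>t \<phi>t, of "of_real c" 0] z by (simp add: test_funs_on_closed_iff)
      fix j t assume "j \<le> n"
      then have "c * cmod ((vderiv ^^ j) \<phi> t) \<le> c * B"
        using B c by (intro mult_left_mono) auto
      also have "\<dots> < e" by (rule c)
      finally show "cmod ((vderiv ^^ j) ?\<psi> t) < e"
        using c unfolding vderiv_lincomb[OF sm sm] by (simp add: norm_mult)
    qed
    then have "norm (T ?\<psi>) < 1" using V(2) by (force simp: U_def)
    also have "T ?\<psi> = of_real c *\<^sub>C T \<phi> + 0 *\<^sub>C T \<phi>"
      by (rule test_linearD[OF lin \<phi>t \<phi>t])
    finally have "c * norm (T \<phi>) < 1"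
      using c by (simp add: norm_scaleC)
    then show "norm (T \<phi>) \<le> 2 / e * B"
      using e B by (simp add: c_def field_simps)
  qed (use e in simp)
qed

text \<open>Taylor's formula with remainder, with B in place of B/2. It is applied to every
  derivative of a test function up to the order of a distribution.\<close>

lemma second_difference_bound:
  fixes g :: "real \<Rightarrow> complex"
  assumes "\<And>t. (g has_vector_derivative g' t) (at t)" "\<And>t. (g' has_vector_derivative g'' t) (at t)"
    and "\<And>t. norm (g'' t) \<le> B"
  shows "norm (g (u - h) - g u + of_real h * g' u) \<le> B * h\<^sup>2"
proof -
  have B: "B \<ge> 0" using order_trans[OF norm_ge_zero assms(3)] .
  define k where "k = (\<lambda>s. g (u - s) + of_real s * g' u)"
  \<comment> \<open>Symmetric, since h may be negative.\<close>
  define S where "S = {-\<bar>h\<bar>..\<bar>h\<bar>}"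
  have "norm (k h - k 0) \<le> (B * \<bar>h\<bar>) * \<bar>h - 0\<bar>"
  proof (rule vector_derivative_lipschitz)
    show "convex S" by (simp add: S_def)
    fix s assume s: "s \<in> S"
    have "((g \<circ> (\<lambda>s. u - s)) has_vector_derivative (- 1) *\<^sub>R g' (u - s)) (at s)"
      by (intro vector_diff_chain_at assms(1)) (auto intro!: derivative_eq_intros)
    then have "((\<lambda>s. g (u - s)) has_vector_derivative - g' (u - s)) (at s)"
      by (simp add: o_def)
    moreover have "((\<lambda>s. of_real s * g' u) has_vector_derivative g' u) (at s)"
      unfolding scaleR_conv_of_real[symmetric]
      by (rule has_vector_derivative_eq_rhs[OF has_vector_derivative_scaleR[OF DERIV_ident has_vector_derivative_const]]) simp
    ultimately have "(k has_vector_derivative - g' (u - s) + g' u) (at s)"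
      unfolding k_def by (rule has_vector_derivative_add)
    then show "(k has_vector_derivative - g' (u - s) + g' u) (at s within S)"
      by (rule has_vector_derivative_at_within)
    have "norm (g' u - g' (u - s)) \<le> B * \<bar>u - (u - s)\<bar>"
      using assms(2,3) by (intro vector_derivative_lipschitz[of UNIV]) auto
    also have "\<dots> \<le> B * \<bar>h\<bar>"
      using s B by (intro mult_left_mono) (auto simp: S_def)
    finally show "norm (- g' (u - s) + g' u) \<le> B * \<bar>h\<bar>" by simp
  qed (auto simp: S_def)
  then show ?thesis
    by (simp add: k_def power2_eq_square abs_mult_self_eq mult.assoc algebra_simps)
qed

text \<open>The first order remainder of the shift is itself a test function, supported in one fixed
  interval for |h| \<le> 1, whose derivatives up to order n are at most B * h^2. The order estimate
  turns this into M * B * h^2.\<close>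

lemma shift_has_vector_derivative:
  fixes T :: "(real \<Rightarrow> complex) \<Rightarrow> 'x::complex_normed_vector"
  assumes lin: "test_linear T" and bd: "order_bounded T" and \<phi>: "\<phi> \<in> test_funs"
  shows "((\<lambda>s. T (\<lambda>t. \<phi> (t - s))) has_vector_derivative - T (\<lambda>t. vderiv \<phi> (t - s))) (at s within S)"
proof -
  obtain a b where "\<phi> \<in> test_funs_on {a..b}" using test_funs_obtain_Icc[OF \<phi>] .
  then have sm: "smooth \<phi>" and z: "\<And>t. t \<notin> {a..b} \<Longrightarrow> \<phi> t = 0"
    by (auto simp: test_funs_on_Icc_iff)
  have z': "vderiv \<phi> t = 0" if "t \<notin> {a..b}" for t
    using vderiv_eq_0[OF sm closed_atLeastAtMost z that, where n = 1] by simp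
  \<comment> \<open>Enlarged by 1 on both sides to contain the supports of all shifts by s + h with
    |h| \<le> 1.\<close>
  obtain n M where M: "M > 0"
    "\<And>\<psi> B. \<psi> \<in> test_funs_on {a + s - 1..b + s + 1} \<Longrightarrow> B > 0 \<Longrightarrow>
      (\<And>j t. j \<le> n \<Longrightarrow> cmod ((vderiv ^^ j) \<psi> t) \<le> B) \<Longrightarrow> norm (T \<psi>) \<le> M * B"
    using bd unfolding order_bounded_def by metis
  \<comment> \<open>T sees n derivatives, and Taylor's formula needs two more.\<close>
  obtain B where B: "B > 0" "\<And>j t. j \<le> n + 2 \<Longrightarrow> cmod ((vderiv ^^ j) \<phi> t) \<le> B"
    using test_funs_derivatives_bounded[OF \<phi>] by blast
  let ?P = "\<lambda>s t. \<phi> (t - s)" and ?D = "\<lambda>t. vderiv \<phi> (t - s)"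
  have P: "?P x \<in> test_funs" for x by (rule test_funs_shift[OF \<phi>])
  have D: "?D \<in> test_funs" by (rule test_funs_shift[OF test_funs_vderiv[OF \<phi>]])
  have est: "norm (T (?P (s + h)) - T (?P s) - h *\<^sub>R (- T ?D)) \<le> M * B * h\<^sup>2" if h: "\<bar>h\<bar> \<le> 1" "h \<noteq> 0" for h
  proof -
    let ?Q = "\<lambda>t. 1 * ?P (s + h) t + (- 1) * ?P s t"
    let ?R = "\<lambda>t. 1 * ?Q t + of_real h * ?D t"
    have Q: "?Q \<in> test_funs" by (rule test_funs_lincomb[OF P P])
    have R: "?R \<in> test_funs" by (rule test_funs_lincomb[OF Q D])
    have "norm (T ?R) \<le> M * (B * h\<^sup>2)"
    proof (rule M(2))
      show "?R \<in> test_funs_on {a + s - 1..b + s + 1}"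
        unfolding test_funs_on_closed_iff[OF closed_atLeastAtMost]
      proof (intro conjI R allI impI)
        fix t assume "t \<notin> {a + s - 1..b + s + 1}"
        then have "t - (s + h) \<notin> {a..b}" "t - s \<notin> {a..b}" using h by auto
        then show "?R t = 0" by (simp add: z z')
      qed
      fix j t assume j: "j \<le> n"
      have "(vderiv ^^ j) ?D t = (vderiv ^^ Suc j) \<phi> (t - s)"
        unfolding vderiv_shift[OF smooth_vderiv[OF sm]] by (simp add: funpow_swap1)
      then have "(vderiv ^^ j) ?R t = (vderiv ^^ j) \<phi> ((t - s) - h) - (vderiv ^^ j) \<phi> (t - s)
          + of_real h * (vderiv ^^ Suc j) \<phi> (t - s)"
        unfolding vderiv_lincomb[OF test_funs_smooth[OF Q] test_funs_smooth[OF D]]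
          vderiv_lincomb[OF test_funs_smooth[OF P] test_funs_smooth[OF P]] vderiv_shift[OF sm]
        by (simp add: algebra_simps)
      also have "norm \<dots> \<le> B * h\<^sup>2"
        using B(2)[of "Suc (Suc j)"] j
        by (intro second_difference_bound[of _ _ "(vderiv ^^ Suc (Suc j)) \<phi>"] smooth_has_vector_derivative sm) auto
      finally show "cmod ((vderiv ^^ j) ?R t) \<le> B * h\<^sup>2" .
    qed (use B h in simp)
    moreover have "T ?R = T (?P (s + h)) - T (?P s) - h *\<^sub>R (- T ?D)"
      unfolding test_linearD[OF lin Q D] test_linearD[OF lin P P]
      by (simp add: scaleC_minus_one scaleC_of_real)
    ultimately show ?thesis by (simp add: mult.assoc)
  qed
  have "((\<lambda>s. T (\<lambda>t. \<phi> (t - s))) has_derivative (\<lambda>h. h *\<^sub>R (- T ?D))) (at s)"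
    unfolding has_derivative_iff_norm
  proof (intro conjI bounded_linear_scaleR_left)
    have "\<forall>\<^sub>F y in at s. norm (norm (T (?P y) - T (?P s) - (y - s) *\<^sub>R (- T ?D)) / norm (y - s))
        \<le> M * B * \<bar>y - s\<bar>"
    proof -
      have "\<forall>\<^sub>F y in at s. \<bar>y - s\<bar> \<le> 1 \<and> y \<noteq> s"
        unfolding eventually_at by (intro exI[of _ 1]) (auto simp: dist_real_def)
      then show ?thesis
      proof (rule eventually_mono)
        fix y assume y: "\<bar>y - s\<bar> \<le> 1 \<and> y \<noteq> s"
        then have "norm (T (?P y) - T (?P s) - (y - s) *\<^sub>R (- T ?D)) \<le> M * B * \<bar>y - s\<bar> * \<bar>y - s\<bar>"
          using est[of "y - s"] by (simp add: power2_eq_square mult.assoc abs_mult_self_eq)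
        with y show "norm (norm (T (?P y) - T (?P s) - (y - s) *\<^sub>R (- T ?D)) / norm (y - s))
            \<le> M * B * \<bar>y - s\<bar>"
          by (simp add: pos_divide_le_eq)
      qed
    qed
    moreover have "((\<lambda>y. M * B * \<bar>y - s\<bar>) \<longlongrightarrow> 0) (at s)"
      by (auto intro!: tendsto_eq_intros)
    ultimately show "((\<lambda>y. norm (T (?P y) - T (?P s) - (y - s) *\<^sub>R (- T ?D)) / norm (y - s)) \<longlongrightarrow> 0) (at s)"
      by (rule Lim_null_comparison)
  qed
  then show ?thesis
    unfolding has_vector_derivative_def by (rule has_derivative_at_withinI)
qed

text \<open>w is merely continuous, so the product rule does not apply to \<open>P \<phi> s\<close>
  at w s. By \<open>rel\<close> this value equals an expression in the primitive W, which is
  differentiable; \<open>rel\<close> for the derivative of \<phi> then makes its derivative vanish.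
  A general L covers both the semigroup and the row operators of the cosine case.\<close>

lemma translation_orbit:
  fixes L :: "(real \<Rightarrow> complex) \<Rightarrow> ('x::banach \<Rightarrow>\<^sub>L 'y::complex_normed_vector)"
  assumes lin: "test_linear L" and bd: "order_bounded L" and w: "continuous_on {0..} w"
    and rel: "\<And>\<phi> t. \<phi> \<in> test_funs0 \<Longrightarrow> t \<ge> 0 \<Longrightarrow>
      blinfun_apply (L (vderiv \<phi>)) (integral {0..t} w) = - blinfun_apply (L \<phi>) (w t - w0)"
    and \<phi>: "\<phi> \<in> test_funs0" and t: "t \<ge> 0"
  shows "blinfun_apply (L (\<lambda>s. \<phi> (s - t))) w0 = blinfun_apply (L \<phi>) (w t)"
proof -
  define W where "W = (\<lambda>s. integral {0..s} w)"
  define P where "P = (\<lambda>\<psi> s. L (\<lambda>x. \<psi> (x - (t - s))))"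
  have \<phi>': "\<phi> \<in> test_funs" "vderiv \<phi> \<in> test_funs" "vderiv (vderiv \<phi>) \<in> test_funs"
    using \<phi> by (auto intro: test_funs_vderiv test_funs_on_subset_test_funs)
  have dP: "(P \<psi> has_vector_derivative P (vderiv \<psi>) s) (at s within {0..t})" if "\<psi> \<in> test_funs" for \<psi> s
  proof -
    have "(((\<lambda>x. L (\<lambda>y. \<psi> (y - x))) \<circ> (\<lambda>s. t - s)) has_vector_derivative
        (-1) *\<^sub>R (- L (\<lambda>y. vderiv \<psi> (y - (t - s))))) (at s)"
      by (intro vector_diff_chain_at shift_has_vector_derivative lin bd that)
        (auto intro!: derivative_eq_intros)
    then have "(P \<psi> has_vector_derivative P (vderiv \<psi>) s) (at s)"
      unfolding P_def by (simp add: o_def)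
    then show ?thesis by (rule has_vector_derivative_at_within)
  qed
  have relP: "blinfun_apply (P (vderiv \<psi>) s) (W s) = - blinfun_apply (P \<psi> s) (w s - w0)"
    if "\<psi> \<in> test_funs0" "s \<in> {0..t}" for \<psi> s
    using rel[OF test_funs0_shift[OF that(1), of "t - s"], of s] that
    by (simp add: P_def W_def vderiv_shift1 test_funs_smooth test_funs_on_subset_test_funs)
  \<comment> \<open>By \<open>relP\<close>, F s is minus \<open>P \<phi> s\<close> applied to w
    s.\<close>
  define F where "F = (\<lambda>s. blinfun_apply (P (vderiv \<phi>) s) (W s) - blinfun_apply (P \<phi> s) w0)"
  have dF: "(F has_vector_derivative 0) (at s within {0..t})" if s: "s \<in> {0..t}" for s
  proof -
    have dW: "(W has_vector_derivative w s) (at s within {0..t})"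
      unfolding W_def using s by (intro integral_has_vector_derivative continuous_on_halfline[OF w]) auto
    have "((\<lambda>s. blinfun_apply (P (vderiv \<phi>) s) (W s)) has_vector_derivative
        blinfun_apply (P (vderiv \<phi>) s) (w s) + blinfun_apply (P (vderiv (vderiv \<phi>)) s) (W s)) (at s within {0..t})"
      by (rule bounded_bilinear.has_vector_derivative[OF bounded_bilinear_blinfun_apply dP[OF \<phi>'(2)] dW])
    moreover have "((\<lambda>s. blinfun_apply (P \<phi> s) w0) has_vector_derivative blinfun_apply (P (vderiv \<phi>) s) w0) (at s within {0..t})"
      using bounded_linear.has_vector_derivative[OF blinfun.bounded_linear_left dP[OF \<phi>'(1)]] .
    ultimately have "(F has_vector_derivative
        blinfun_apply (P (vderiv \<phi>) s) (w s) + blinfun_apply (P (vderiv (vderiv \<phi>)) s) (W s)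
        - blinfun_apply (P (vderiv \<phi>) s) w0) (at s within {0..t})"
      unfolding F_def by (rule has_vector_derivative_diff)
    then show ?thesis
      unfolding relP[OF test_funs0_vderiv[OF \<phi>] s] by (simp add: blinfun.diff_right)
  qed
  have "norm (F t - F 0) \<le> 0 * \<bar>t - 0\<bar>"
    using t by (intro vector_derivative_lipschitz[of "{0..t}" F "\<lambda>_. 0"] dF) auto
  then have "F t = F 0" by simp
  moreover have "F t = - blinfun_apply (L \<phi>) (w t)"
    using relP[OF \<phi>, of t] t by (simp add: F_def P_def blinfun.diff_right)
  moreover have "F 0 = - blinfun_apply (L (\<lambda>s. \<phi> (s - t))) w0"
    by (simp add: F_def P_def W_def)
  ultimately show ?thesis by simp
qed

section \<open>Primitives\<close>

lemma integral_lower_cut: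
  fixes g :: "real \<Rightarrow> 'a::banach"
  assumes "\<And>t. t < a \<Longrightarrow> g t = 0"
  shows "integral {..s} g = integral {a..s} g"
proof -
  have "integral {..s} g = integral {..s} (\<lambda>t. if t \<in> {a..} then g t else 0)"
    using assms by (intro integral_cong) auto
  also have "\<dots> = integral ({..s} \<inter> {a..}) g"
    by (simp only: Henstock_Kurzweil_Integration.integral_restrict_Int Int_commute)
  also have "{..s} \<inter> {a..} = {a..s}" by auto
  finally show ?thesis .
qed

lemma integral_UNIV_cut:
  fixes g :: "real \<Rightarrow> 'a::banach"
  assumes "\<And>t. t \<notin> {a..b} \<Longrightarrow> g t = 0"
  shows "integral UNIV g = integral {a..b} g"
proof -
  have "integral UNIV g = integral UNIV (\<lambda>t. if t \<in> {a..b} then g t else 0)"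
    using assms by (intro integral_cong) auto
  then show ?thesis by (simp only: integral_restrict_UNIV)
qed

text \<open>Past b the primitive equals the full integral, so \<open>int0\<close> is what makes it
  compactly supported.\<close>

lemma
  assumes g: "g \<in> test_funs_on {a..b}" and int0: "integral UNIV g = 0"
  shows primitive_test_fun: "(\<lambda>s. integral {..s} g) \<in> test_funs_on {a..b}"
    and vderiv_primitive: "vderiv (\<lambda>s. integral {..s} g) = g"
proof -
  let ?I = "\<lambda>s. integral {..s} g"
  have sm: "smooth g" and z: "\<And>t. t \<notin> {a..b} \<Longrightarrow> g t = 0"
    using g by (auto simp: test_funs_on_Icc_iff)
  have cont: "continuous_on S g" for S
    using smooth_continuous[OF sm, where n = 0] by simp
  have der: "(?I has_vector_derivative g s) (at s)" for s
  proof -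
    \<comment> \<open>Strictly below a and s: g vanishes before c, and s is interior to
      [c, s + 1].\<close>
    define c where "c = min a s - 1"
    have eq: "?I = (\<lambda>s. integral {c..s} g)"
      by (intro ext integral_lower_cut z) (auto simp: c_def)
    have "((\<lambda>u. integral {c..u} g) has_vector_derivative g s) (at s within {c..s + 1})"
      by (intro integral_has_vector_derivative cont) (auto simp: c_def)
    moreover have "at s within {c..s + 1} = at s"
      by (rule at_within_interior) (auto simp: c_def interior_atLeastAtMost_real)
    ultimately show ?thesis
      by (simp only: eq)
  qed
  show vd: "vderiv ?I = g"
    using der by (auto simp: vderiv_eqI)
  have "smooth ?I"
    unfolding smooth_def
  proof (intro allI)
    fix n t
    show "(vderiv ^^ n) ?I differentiable at t"
    proof (cases n)
      case 0
      then show ?thesis using der[of t] by (auto intro: differentiableI_vector)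
    next
      case (Suc k)
      then have "(vderiv ^^ n) ?I = (vderiv ^^ k) g"
        using vd by (simp add: funpow_swap1)
      then show ?thesis using sm by (simp add: smooth_def)
    qed
  qed
  moreover have "?I t = 0" if "t \<notin> {a..b}" for t
  proof (cases "t < a")
    case True
    then show ?thesis using integral_lower_cut[of a g t] z by simp
  next
    case False
    then have "integral {a..t} g = integral UNIV g"
      using that z by (intro integral_UNIV_cut[symmetric]) auto
    then show ?thesis using integral_lower_cut[of a g t] z int0 by simp
  qed
  ultimately show "?I \<in> test_funs_on {a..b}"
    by (simp add: test_funs_on_Icc_iff)
qed

lemma test_funs_on_Icc_integrable:
  assumes "g \<in> test_funs_on {a..b}"
  shows "g integrable_on {c..d}"
proof -
  have "continuous_on {c..d} g"
    using assms smooth_continuous[where n = 0] by (simp add: test_funs_on_Icc_iff)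
  then show ?thesis by (rule integrable_continuous_real)
qed

lemma integral_vderiv:
  assumes \<phi>: "\<phi> \<in> test_funs_on {a..b}"
  shows "integral {..s} (vderiv \<phi>) = \<phi> s" "integral UNIV (vderiv \<phi>) = 0"
proof -
  have sm: "smooth \<phi>" and z: "\<And>t. t \<notin> {a..b} \<Longrightarrow> \<phi> t = 0"
    using \<phi> by (auto simp: test_funs_on_Icc_iff)
  have z': "vderiv \<phi> t = 0" if "t \<notin> {a..b}" for t
    using vderiv_eq_0[OF sm closed_atLeastAtMost z that, where n = 1] by simp
  have ftc: "integral {a - 1..s} (vderiv \<phi>) = \<phi> s" for s
  proof (cases "a - 1 \<le> s")
    case True
    have "(vderiv \<phi> has_integral (\<phi> s - \<phi> (a - 1))) {a - 1..s}"
      using smooth_has_vector_derivative[OF sm, where n = 0]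
      by (intro fundamental_theorem_of_calculus True) auto
    then show ?thesis using z[of "a - 1"] by (simp add: integral_unique)
  next
    case False
    then show ?thesis using z[of s] by simp
  qed
  show "integral {..s} (vderiv \<phi>) = \<phi> s"
    using integral_lower_cut[of "a - 1" "vderiv \<phi>" s] z' ftc by simp
  have "integral UNIV (vderiv \<phi>) = integral {a - 1..b + 1} (vderiv \<phi>)"
    by (intro integral_UNIV_cut z') auto
  then show "integral UNIV (vderiv \<phi>) = 0"
    using ftc[of "b + 1"] z[of "b + 1"] by simp
qed

text \<open>The correction by \<zeta> is absent because the derivative of a test function has
  integral 0.\<close>

lemma antideriv_vderiv:
  assumes "\<phi> \<in> test_funs"
  shows "antideriv \<zeta> (vderiv \<phi>) = \<phi>"
proof -
  obtain a b where "\<phi> \<in> test_funs_on {a..b}" using test_funs_obtain_Icc[OF assms] .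
  from integral_vderiv[OF this] show ?thesis
    by (simp add: antideriv_def)
qed

text \<open>In distributional terms, T is the derivative of \<open>dist_prim \<zeta> T\<close>.
  Through this identity \<zeta> drops out whenever a derivative is tested.\<close>

lemma dist_prim_vderiv: "\<phi> \<in> test_funs \<Longrightarrow> dist_prim \<zeta> T (vderiv \<phi>) = - T \<phi>"
  by (simp add: dist_prim_def antideriv_vderiv)

text \<open>Subtracting the multiple of \<zeta> makes the integral 0, so that
  \<open>primitive_test_fun\<close> applies; a \<le> -2 and -1 \<le> b put the support of \<zeta>
  into the interval. The shape of g is that of \<open>vderiv_lincomb\<close>.\<close>

lemma antideriv_reduced:
  assumes \<zeta>: "zeta_fun \<zeta>" and \<phi>: "\<phi> \<in> test_funs_on {a..b}" and ab: "a \<le> -2" "-1 \<le> b"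
  defines "g \<equiv> \<lambda>t. 1 * \<phi> t + (- integral UNIV \<phi>) * \<zeta> t"
  shows "g \<in> test_funs_on {a..b}" "integral UNIV g = 0" "antideriv \<zeta> \<phi> = (\<lambda>s. integral {..s} g)"
proof -
  have \<zeta>': "\<zeta> \<in> test_funs_on {a..b}" and int1: "integral UNIV \<zeta> = 1"
    using \<zeta> ab by (auto simp: zeta_fun_def intro: test_funs_on_mono)
  have z: "\<phi> t = 0" "\<zeta> t = 0" if "t \<notin> {a..b}" for t
    using \<phi> \<zeta>' that by (auto simp: test_funs_on_Icc_iff)
  have "g \<in> test_funs"
    unfolding g_def using \<phi> \<zeta>' by (intro test_funs_lincomb) (auto simp: test_funs_on_def)
  then show "g \<in> test_funs_on {a..b}"
    unfolding test_funs_on_closed_iff[OF closed_atLeastAtMost] using z by (simp add: g_def)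
  have "integral UNIV g = integral {a..b} g"
    by (rule integral_UNIV_cut) (simp add: g_def z)
  also have "\<dots> = integral {a..b} \<phi> + (- integral UNIV \<phi>) * integral {a..b} \<zeta>"
    unfolding g_def
    by (subst Henstock_Kurzweil_Integration.integral_add)
      (simp_all only: mult_1 integral_mult_right integrable_on_mult_right
        test_funs_on_Icc_integrable[OF \<phi>] test_funs_on_Icc_integrable[OF \<zeta>'])
  also have "\<dots> = 0"
    using integral_UNIV_cut[of a b \<phi>] integral_UNIV_cut[of a b \<zeta>] z int1 by simp
  finally show "integral UNIV g = 0" .
  show "antideriv \<zeta> \<phi> = (\<lambda>s. integral {..s} g)"
    by (simp add: antideriv_def g_def mult.commute)
qed

lemma antideriv_test_fun:
  assumes \<zeta>: "zeta_fun \<zeta>" and \<phi>: "\<phi> \<in> test_funs_on {a..b}" and ab: "a \<le> -2" "-1 \<le> b"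
  shows "antideriv \<zeta> \<phi> \<in> test_funs_on {a..b}"
    "vderiv (antideriv \<zeta> \<phi>) = (\<lambda>t. 1 * \<phi> t + (- integral UNIV \<phi>) * \<zeta> t)"
  unfolding antideriv_reduced(3)[OF assms]
  by (rule primitive_test_fun[OF antideriv_reduced(1,2)[OF assms]],
      rule vderiv_primitive[OF antideriv_reduced(1,2)[OF assms]])

lemma test_funs_obtain_wide:
  assumes "\<phi> \<in> test_funs" "\<psi> \<in> test_funs"
  obtains a b where "a \<le> -2" "-1 \<le> b" "\<phi> \<in> test_funs_on {a..b}" "\<psi> \<in> test_funs_on {a..b}"
proof -
  obtain a b c d where "\<phi> \<in> test_funs_on {a..b}" "\<psi> \<in> test_funs_on {c..d}"
    using assms test_funs_obtain_Icc by metis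
  then show ?thesis
    by (intro that[of "min (min a c) (-2)" "max (max b d) (-1)"])
      (auto elim!: test_funs_on_mono)
qed

lemma antideriv_lincomb:
  assumes \<zeta>: "zeta_fun \<zeta>" and \<phi>: "\<phi> \<in> test_funs" and \<psi>: "\<psi> \<in> test_funs"
  shows "antideriv \<zeta> (\<lambda>t. p * \<phi> t + q * \<psi> t) = (\<lambda>t. p * antideriv \<zeta> \<phi> t + q * antideriv \<zeta> \<psi> t)"
proof
  fix s
  obtain a b where ab: "a \<le> -2" "-1 \<le> b" "\<phi> \<in> test_funs_on {a..b}" "\<psi> \<in> test_funs_on {a..b}"
    using test_funs_obtain_wide[OF \<phi> \<psi>] .
  have z: "\<phi> t = 0" "\<psi> t = 0" if "t \<notin> {a..b}" for t
    using ab(3,4) that by (auto simp: test_funs_on_Icc_iff)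
  have "\<zeta> \<in> test_funs_on {a..b}"
    using \<zeta> ab by (auto simp: zeta_fun_def intro: test_funs_on_mono)
  then have zz: "\<zeta> t = 0" if "t \<notin> {a..b}" for t
    using that by (auto simp: test_funs_on_Icc_iff)
  note ints = test_funs_on_Icc_integrable[OF ab(3)] test_funs_on_Icc_integrable[OF ab(4)]
    test_funs_on_Icc_integrable[OF \<open>\<zeta> \<in> test_funs_on {a..b}\<close>]
  have form: "antideriv \<zeta> h s = integral {a..s} h - integral {a..s} \<zeta> * integral {a..b} h"
    if c: "h integrable_on {a..s}" "\<And>t. t \<notin> {a..b} \<Longrightarrow> h t = 0" for h
  proof -
    have "antideriv \<zeta> h s = integral {a..s} (\<lambda>t. h t - \<zeta> t * integral UNIV h)"
      unfolding antideriv_def by (rule integral_lower_cut) (use c zz in auto)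
    also have "\<dots> = integral {a..s} h - integral {a..s} \<zeta> * integral UNIV h"
      using c ints(3) by (subst Henstock_Kurzweil_Integration.integral_diff)
        (auto intro: integrable_on_mult_left)
    finally show ?thesis using integral_UNIV_cut[of a b h] c(2) by simp
  qed
  have lin: "integral {a..d} (\<lambda>t. p * \<phi> t + q * \<psi> t) = p * integral {a..d} \<phi> + q * integral {a..d} \<psi>" for d
    using ints by (subst Henstock_Kurzweil_Integration.integral_add) (auto intro: integrable_on_mult_right)
  have f0: "antideriv \<zeta> (\<lambda>t. p * \<phi> t + q * \<psi> t) s
      = integral {a..s} (\<lambda>t. p * \<phi> t + q * \<psi> t) - integral {a..s} \<zeta> * integral {a..b} (\<lambda>t. p * \<phi> t + q * \<psi> t)"
    by (intro form integrable_add integrable_on_mult_right ints) (simp_all add: z)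
  have f1: "antideriv \<zeta> \<phi> s = integral {a..s} \<phi> - integral {a..s} \<zeta> * integral {a..b} \<phi>"
    by (rule form[OF ints(1) z(1)])
  have f2: "antideriv \<zeta> \<psi> s = integral {a..s} \<psi> - integral {a..s} \<zeta> * integral {a..b} \<psi>"
    by (rule form[OF ints(2) z(2)])
  show "antideriv \<zeta> (\<lambda>t. p * \<phi> t + q * \<psi> t) s = p * antideriv \<zeta> \<phi> s + q * antideriv \<zeta> \<psi> s"
    unfolding f0 f1 f2 lin by (simp add: algebra_simps)
qed

lemma dist_prim_test_linear:
  assumes "zeta_fun \<zeta>" "test_linear T"
  shows "test_linear (dist_prim \<zeta> T)"
  unfolding test_linear_def
proof (intro ballI allI)
  fix \<phi> \<psi> p q assume \<phi>: "\<phi> \<in> test_funs" and \<psi>: "\<psi> \<in> test_funs"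
  obtain a b where ab: "a \<le> -2" "-1 \<le> b" "\<phi> \<in> test_funs_on {a..b}" "\<psi> \<in> test_funs_on {a..b}"
    using test_funs_obtain_wide[OF \<phi> \<psi>] .
  have "antideriv \<zeta> \<phi> \<in> test_funs" "antideriv \<zeta> \<psi> \<in> test_funs"
    using antideriv_test_fun(1)[OF assms(1) _ ab(1,2)] ab(3,4) by (auto simp: test_funs_on_def)
  then show "dist_prim \<zeta> T (\<lambda>t. p * \<phi> t + q * \<psi> t) = p *\<^sub>C dist_prim \<zeta> T \<phi> + q *\<^sub>C dist_prim \<zeta> T \<psi>"
    unfolding dist_prim_def antideriv_lincomb[OF assms(1) \<phi> \<psi>]
    by (simp add: test_linearD[OF assms(2)])
qed

text \<open>The order n of T is kept: derivatives of the antiderivative of positive order are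
  derivatives of g of lower order, and the antiderivative itself is bounded by integrating g over
  [a, b].\<close>

lemma dist_prim_order_bounded:
  assumes \<zeta>: "zeta_fun \<zeta>" and bd: "order_bounded T"
  shows "order_bounded (dist_prim \<zeta> T)"
  unfolding order_bounded_def
proof (intro allI)
  fix a0 b0 :: real
  define a b where "a = min a0 (-2)" and "b = max b0 (-1)"
  have ab: "a \<le> -2" "-1 \<le> b" and sub: "{a0..b0} \<subseteq> {a..b}" and l: "b - a \<ge> 1"
    by (auto simp: a_def b_def)
  obtain n M where M: "M > 0" "\<And>\<psi> B. \<psi> \<in> test_funs_on {a..b} \<Longrightarrow> B > 0 \<Longrightarrow>
      (\<And>j t. j \<le> n \<Longrightarrow> cmod ((vderiv ^^ j) \<psi> t) \<le> B) \<Longrightarrow> norm (T \<psi>) \<le> M * B"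
    using bd unfolding order_bounded_def by metis
  have \<zeta>': "\<zeta> \<in> test_funs"
    using \<zeta> by (auto simp: zeta_fun_def test_funs_on_def)
  obtain Z where Z: "Z > 0" "\<And>j t. j \<le> n \<Longrightarrow> cmod ((vderiv ^^ j) \<zeta> t) \<le> Z"
    using test_funs_derivatives_bounded[OF \<zeta>'] by blast
  \<comment> \<open>B * c will bound the derivatives of g: the 1 is for \<phi>, and (b - a) * Z for
    the multiple of \<zeta>. K adds the factor b - a of the integration and dominates c because b -
    a \<ge> 1.\<close>
  define c where "c = 1 + (b - a) * Z"
  have c: "c > 0" using Z l by (simp add: c_def add_pos_nonneg)
  define K where "K = c * (b - a)"
  have K: "K > 0" "c \<le> K" using c l by (simp_all add: K_def)
  show "\<exists>n. \<exists>M>0. \<forall>\<phi>\<in>test_funs_on {a0..b0}. \<forall>B>0.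
     (\<forall>j\<le>n. \<forall>t. cmod ((vderiv ^^ j) \<phi> t) \<le> B) \<longrightarrow> norm (dist_prim \<zeta> T \<phi>) \<le> M * B"
  proof (intro exI[of _ n] exI[of _ "M * K"] conjI ballI allI impI)
    fix \<phi> and B :: real
    assume \<phi>0: "\<phi> \<in> test_funs_on {a0..b0}" and B: "B > 0" "\<forall>j\<le>n. \<forall>t. cmod ((vderiv ^^ j) \<phi> t) \<le> B"
    have \<phi>: "\<phi> \<in> test_funs_on {a..b}" using \<phi>0 sub by (rule test_funs_on_mono)
    have sm: "smooth \<phi>" "smooth \<zeta>" and z: "\<And>t. t \<notin> {a..b} \<Longrightarrow> \<phi> t = 0"
      using \<phi> \<zeta>' by (auto simp: test_funs_on_Icc_iff test_funs_iff)
    define m where "m = integral UNIV \<phi>"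
    define g where "g = (\<lambda>t. 1 * \<phi> t + (- m) * \<zeta> t)"
    have g: "g \<in> test_funs_on {a..b}" "antideriv \<zeta> \<phi> = (\<lambda>s. integral {..s} g)"
      "vderiv (antideriv \<zeta> \<phi>) = g"
      using antideriv_reduced[OF \<zeta> \<phi> ab] antideriv_test_fun[OF \<zeta> \<phi> ab] by (simp_all add: g_def m_def)
    have "cmod (\<phi> t) \<le> B" for t using B(2)[rule_format, of 0 t] by simp
    then have "cmod (integral {a..b} \<phi>) \<le> B * (b - a)"
      using l smooth_continuous[OF sm(1), where n = 0] by (intro integral_bound) auto
    then have "cmod m \<le> B * (b - a)"
      unfolding m_def using integral_UNIV_cut[of a b \<phi>] z by simp
    then have m: "cmod m * Z \<le> B * (b - a) * Z"
      using Z by (intro mult_right_mono) auto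
    have gb: "cmod ((vderiv ^^ j) g t) \<le> B * c" if "j \<le> n" for j t
    proof -
      have "cmod ((vderiv ^^ j) g t) \<le> cmod ((vderiv ^^ j) \<phi> t) + cmod m * cmod ((vderiv ^^ j) \<zeta> t)"
        unfolding g_def vderiv_lincomb[OF sm]
        using norm_triangle_ineq4[of "(vderiv ^^ j) \<phi> t" "m * (vderiv ^^ j) \<zeta> t"] by (simp add: norm_mult)
      also have "\<dots> \<le> B + cmod m * Z"
        using B(2) Z(2) that by (intro add_mono mult_left_mono) auto
      finally show ?thesis using m by (simp add: c_def algebra_simps)
    qed
    have Ib: "cmod (antideriv \<zeta> \<phi> t) \<le> B * K" for t
    proof (cases "t \<in> {a..b}")
      case True
      have zg: "\<And>t. t \<notin> {a..b} \<Longrightarrow> g t = 0" and sg: "smooth g"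
        using g(1) by (auto simp: test_funs_on_Icc_iff)
      have "antideriv \<zeta> \<phi> t = integral {a..t} g"
        unfolding g(2) by (rule integral_lower_cut) (use zg in auto)
      also have "cmod \<dots> \<le> B * c * (t - a)"
        using True gb[of 0] smooth_continuous[OF sg, where n = 0] by (intro integral_bound) auto
      also have "\<dots> \<le> B * c * (b - a)"
        using True B c by (intro mult_left_mono) auto
      finally show ?thesis by (simp add: K_def mult.assoc)
    next
      case False
      then have "antideriv \<zeta> \<phi> t = 0"
        using antideriv_test_fun(1)[OF \<zeta> \<phi> ab] by (auto simp: test_funs_on_Icc_iff)
      then show ?thesis using B K by simp
    qed
    have "norm (T (antideriv \<zeta> \<phi>)) \<le> M * (B * K)"
    proof (rule M(2)[OF antideriv_test_fun(1)[OF \<zeta> \<phi> ab]])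
      fix j t assume j: "j \<le> n"
      show "cmod ((vderiv ^^ j) (antideriv \<zeta> \<phi>) t) \<le> B * K"
      proof (cases j)
        case 0
        then show ?thesis using Ib by simp
      next
        case (Suc k)
        then have "cmod ((vderiv ^^ j) (antideriv \<zeta> \<phi>) t) = cmod ((vderiv ^^ k) g t)"
          using g(3) by (simp add: funpow_swap1)
        also have "\<dots> \<le> B * c" using gb j Suc by simp
        also have "\<dots> \<le> B * K" using B K by (intro mult_left_mono) auto
        finally show ?thesis .
      qed
    qed (use B K in simp)
    then show "norm (dist_prim \<zeta> T \<phi>) \<le> M * K * B"
      by (simp add: dist_prim_def mult_ac)
  qed (use M K in simp)
qed

section \<open>Eigenvalue equations for the Bohr means of orbits\<close>

section \<open>Means of derivatives\<close>

lemma bounded_clinear_opsD: "T \<in> bounded_clinear_ops \<Longrightarrow> blinfun_apply T (a *\<^sub>C x) = a *\<^sub>C blinfun_apply T x"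
  by (simp add: bounded_clinear_ops_def)

lemma mean_clinear_image:
  fixes f :: "real \<Rightarrow> 'a::complex_banach" and T :: "'a \<Rightarrow>\<^sub>L 'b::complex_banach"
  assumes T: "T \<in> bounded_clinear_ops" and ap: "almost_periodic f"
  shows "((\<lambda>t. (1 / t) *\<^sub>R integral {0..t} (\<lambda>s. osc r s *\<^sub>C blinfun_apply T (f s)))
    \<longlongrightarrow> blinfun_apply T (bohr_mean r f)) at_top"
proof -
  have f: "continuous_on {0..} f" using ap by (simp add: almost_periodic_def)
  have "integral {0..t} (\<lambda>s. osc r s *\<^sub>C blinfun_apply T (f s))
      = blinfun_apply T (integral {0..t} (\<lambda>s. osc r s *\<^sub>C f s))" for t
    using integral_linear[OF integrable_on_halfline[OF continuous_on_twist[OF f], of 0 r t] blinfun.bounded_linear_right[of T]]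
    by (simp add: o_def bounded_clinear_opsD[OF T])
  then have "(\<lambda>t. (1 / t) *\<^sub>R integral {0..t} (\<lambda>s. osc r s *\<^sub>C blinfun_apply T (f s)))
      = (\<lambda>t. blinfun_apply T ((1 / t) *\<^sub>R integral {0..t} (\<lambda>s. osc r s *\<^sub>C f s)))"
    by (simp add: blinfun.scaleR_right)
  then show ?thesis
    using bounded_linear.tendsto[OF blinfun.bounded_linear_right bohr_mean_tendsto[OF ap]] by simp
qed

lemma osc_has_vector_derivative:
  "(osc r has_vector_derivative (- (\<i> * of_real r)) * osc r s) (at s within S)"
proof -
  have "((\<lambda>s. exp (- (\<i> * of_real r * s))) has_field_derivative
      (- (\<i> * of_real r)) * exp (- (\<i> * of_real r * of_real s))) (at (complex_of_real s))"
    by (auto intro!: derivative_eq_intros)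
  from has_vector_derivative_real_field[OF this] show ?thesis
    unfolding osc_def o_def .
qed

text \<open>Existence of the mean of \<open>y'\<close> is part of the conclusion, so the lemma can
  be iterated. The boundary terms stay below 2 * B and vanish after division by t.\<close>

lemma mean_of_derivative:
  fixes y :: "real \<Rightarrow> 'a::complex_banach"
  assumes y: "\<And>s. s \<ge> 0 \<Longrightarrow> (y has_vector_derivative y' s) (at s within {0..})"
    and y': "continuous_on {0..} y'" and B: "\<And>s. s \<ge> 0 \<Longrightarrow> norm (y s) \<le> B"
    and Q: "((\<lambda>t. (1 / t) *\<^sub>R integral {0..t} (\<lambda>s. osc r s *\<^sub>C y s)) \<longlongrightarrow> Q) at_top"
  shows "((\<lambda>t. (1 / t) *\<^sub>R integral {0..t} (\<lambda>s. osc r s *\<^sub>C y' s)) \<longlongrightarrow> (\<i> * of_real r) *\<^sub>C Q) at_top"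
proof -
  define E where "E = (\<lambda>s. osc r s *\<^sub>C y s)"
  have yc: "continuous_on {0..} y"
    using y by (intro continuous_on_vector_derivative) auto
  have eq: "integral {0..t} (\<lambda>s. osc r s *\<^sub>C y' s)
      = (E t - E 0) + (\<i> * of_real r) *\<^sub>C integral {0..t} (\<lambda>s. osc r s *\<^sub>C y s)" if t: "t \<ge> 0" for t
  proof -
    have "((\<lambda>s. osc r s *\<^sub>C y' s + ((- (\<i> * of_real r)) * osc r s) *\<^sub>C y s) has_integral (E t - E 0)) {0..t}"
    proof (rule fundamental_theorem_of_calculus[OF t])
      fix s assume "s \<in> {0..t}"
      then have "(y has_vector_derivative y' s) (at s within {0..t})"
        by (intro has_vector_derivative_within_subset[OF y]) auto
      from bounded_bilinear.has_vector_derivative[OF bounded_bilinear_scaleC osc_has_vector_derivative this]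
      show "(E has_vector_derivative osc r s *\<^sub>C y' s + ((- (\<i> * of_real r)) * osc r s) *\<^sub>C y s) (at s within {0..t})"
        unfolding E_def .
    qed
    then have "E t - E 0 = integral {0..t} (\<lambda>s. osc r s *\<^sub>C y' s + (- (\<i> * of_real r)) *\<^sub>C osc r s *\<^sub>C y s)"
      by (simp add: integral_unique)
    also have "\<dots> = integral {0..t} (\<lambda>s. osc r s *\<^sub>C y' s)
        + integral {0..t} (\<lambda>s. (- (\<i> * of_real r)) *\<^sub>C osc r s *\<^sub>C y s)"
      by (intro Henstock_Kurzweil_Integration.integral_add integrable_on_halfline continuous_intros y' yc) auto
    also have "integral {0..t} (\<lambda>s. (- (\<i> * of_real r)) *\<^sub>C osc r s *\<^sub>C y s)
        = (- (\<i> * of_real r)) *\<^sub>C integral {0..t} (\<lambda>s. osc r s *\<^sub>C y s)"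
      by (intro integral_scaleC integrable_on_halfline continuous_intros yc) auto
    finally show ?thesis by simp
  qed
  have "((\<lambda>t. (1 / t) *\<^sub>R (E t - E 0)) \<longlongrightarrow> 0) at_top"
  proof (rule Lim_null_comparison)
    show "\<forall>\<^sub>F t in at_top. norm ((1 / t) *\<^sub>R (E t - E 0)) \<le> 2 * B / t"
      using eventually_gt_at_top[of 0]
    proof (rule eventually_mono)
      fix t :: real assume t: "0 < t"
      have "norm (E t - E 0) \<le> norm (E t) + norm (E 0)" by (rule norm_triangle_ineq4)
      also have "\<dots> \<le> 2 * B"
        using B[of t] B[of 0] t by (simp add: E_def norm_scaleC)
      finally show "norm ((1 / t) *\<^sub>R (E t - E 0)) \<le> 2 * B / t"
        using t by (simp add: divide_right_mono)
    qed
    show "((\<lambda>t. 2 * B / t) \<longlongrightarrow> 0) at_top"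
      by (intro tendsto_divide_0[OF tendsto_const] filterlim_at_top_imp_at_infinity filterlim_ident)
  qed
  moreover have "((\<lambda>t. (\<i> * of_real r) *\<^sub>C (1 / t) *\<^sub>R integral {0..t} (\<lambda>s. osc r s *\<^sub>C y s))
      \<longlongrightarrow> (\<i> * of_real r) *\<^sub>C Q) at_top"
    by (rule bounded_linear.tendsto[OF bounded_linear_scaleC Q])
  ultimately have "((\<lambda>t. (1 / t) *\<^sub>R (E t - E 0)
      + (\<i> * of_real r) *\<^sub>C (1 / t) *\<^sub>R integral {0..t} (\<lambda>s. osc r s *\<^sub>C y s)) \<longlongrightarrow> 0 + (\<i> * of_real r) *\<^sub>C Q) at_top"
    by (rule tendsto_add)
  moreover have "\<forall>\<^sub>F t in at_top. (1 / t) *\<^sub>R (E t - E 0)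
      + (\<i> * of_real r) *\<^sub>C (1 / t) *\<^sub>R integral {0..t} (\<lambda>s. osc r s *\<^sub>C y s)
      = (1 / t) *\<^sub>R integral {0..t} (\<lambda>s. osc r s *\<^sub>C y' s)"
    using eventually_ge_at_top[of 0]
    by (rule eventually_mono) (simp add: eq scaleR_right_distrib scaleC_scaleR_commute)
  ultimately show ?thesis
    by (auto elim: Lim_transform_eventually)
qed

text \<open>A Landau type estimate: over a step of length 1, y changes by \<open>y' t\<close> up to
  \<open>B''\<close>. In the cosine case it bounds the image of the integral of the orbit, an
  integral which may itself grow.\<close>

lemma derivative_bounded:
  fixes y :: "real \<Rightarrow> 'a::real_normed_vector"
  assumes y: "\<And>s. s \<ge> 0 \<Longrightarrow> (y has_vector_derivative y' s) (at s within {0..})"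
    and y': "\<And>s. s \<ge> 0 \<Longrightarrow> (y' has_vector_derivative y'' s) (at s within {0..})"
    and B: "\<And>s. s \<ge> 0 \<Longrightarrow> norm (y s) \<le> B" "\<And>s. s \<ge> 0 \<Longrightarrow> norm (y'' s) \<le> B''" and t: "t \<ge> 0"
  shows "norm (y' t) \<le> 2 * B + B''"
proof -
  have B'': "B'' \<ge> 0" using order_trans[OF norm_ge_zero B(2)[OF t]] .
  define k where "k = (\<lambda>s. y s - s *\<^sub>R y' t)"
  have "norm (k (t + 1) - k t) \<le> B'' * \<bar>t + 1 - t\<bar>"
  proof (rule vector_derivative_lipschitz[of "{t..t + 1}" k "\<lambda>s. y' s - y' t"])
    fix s assume s: "s \<in> {t..t + 1}"
    have "(y has_vector_derivative y' s) (at s within {t..t + 1})"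
      using y[of s] s t by (auto intro: has_vector_derivative_within_subset)
    moreover have "((\<lambda>s. s *\<^sub>R y' t) has_vector_derivative y' t) (at s within {t..t + 1})"
      by (rule has_vector_derivative_eq_rhs[OF has_vector_derivative_scaleR[OF DERIV_ident has_vector_derivative_const]]) simp
    ultimately show "(k has_vector_derivative y' s - y' t) (at s within {t..t + 1})"
      unfolding k_def by (rule has_vector_derivative_diff)
    have "norm (y' s - y' t) \<le> B'' * \<bar>s - t\<bar>"
    proof (rule vector_derivative_lipschitz[of "{t..t + 1}" y' y''])
      fix x assume x: "x \<in> {t..t + 1}"
      then show "(y' has_vector_derivative y'' x) (at x within {t..t + 1})"
        using y'[of x] t by (auto intro: has_vector_derivative_within_subset)
      show "norm (y'' x) \<le> B''" using B(2) x t by auto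
    qed (use s in auto)
    also have "\<dots> \<le> B'' * 1" using s B'' by (intro mult_left_mono) auto
    finally show "norm (y' s - y' t) \<le> B''" by simp
  qed auto
  then have "norm (y (t + 1) - y t - y' t) \<le> B''"
    by (simp add: k_def algebra_simps)
  moreover have "norm (y' t) \<le> norm (y (t + 1) - y t) + norm (y (t + 1) - y t - y' t)"
    using norm_triangle_ineq4[of "y (t + 1) - y t" "y (t + 1) - y t - y' t"] by simp
  moreover have "norm (y (t + 1) - y t) \<le> B + B"
    using B(1)[of t] B(1)[of "t + 1"] t norm_triangle_ineq4[of "y (t + 1)" "y t"] by linarith
  ultimately show ?thesis by linarith
qed

lemma has_vector_derivative_integral_halfline:
  fixes g :: "real \<Rightarrow> 'a::banach"
  assumes g: "continuous_on {0..} g" and s: "s \<ge> 0"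
  shows "((\<lambda>t. integral {0..t} g) has_vector_derivative g s) (at s within {0..})"
proof -
  have "((\<lambda>t. integral {0..t} g) has_vector_derivative g s) (at s within {0..s + 1})"
    using s by (intro integral_has_vector_derivative continuous_on_halfline[OF g]) auto
  moreover have "at s within {0..s + 1} = at s within {0..}"
    by (rule at_within_nhd[of _ "{s - 1<..<s + 1}"]) auto
  ultimately show ?thesis by simp
qed

lemma has_vector_derivative_blinfun_apply:
  "(w has_vector_derivative w') F \<Longrightarrow>
    ((\<lambda>s. blinfun_apply T (w s)) has_vector_derivative blinfun_apply T w') F"
  by (rule bounded_linear.has_vector_derivative[OF blinfun.bounded_linear_right])

section \<open>The semigroup case\<close>

lemma op_distribution0D:
  assumes "op_distribution0 G"
  shows "test_linear G" "order_bounded G" "\<phi> \<in> test_funs \<Longrightarrow> G \<phi> \<in> bounded_clinear_ops"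
  using assms by (auto simp: op_distribution0_def intro: distribution_test_linear distribution_order_bounded)

lemma C_DS_nondegenerate:
  assumes "C_DS C G" "\<And>\<phi>. \<phi> \<in> test_funs0 \<Longrightarrow> blinfun_apply (G \<phi>) z = 0"
  shows "z = 0"
proof -
  have "z \<in> (\<Inter>\<phi>\<in>test_funs0. {x. blinfun_apply (G \<phi>) x = 0})"
    using assms(2) by blast
  then show ?thesis using assms(1) unfolding C_DS_def by blast
qed

text \<open>\<open>DS_orbit\<close> is defined by \<open>THE\<close>; nondegeneracy of
  \<open>G\<close> makes the graph single-valued.\<close>

lemma DS_orbit_eqI:
  assumes G: "C_DS C G"
    and y: "\<And>\<phi>. \<phi> \<in> test_funs0 \<Longrightarrow> blinfun_apply (G (\<lambda>s. \<phi> (s - t))) x = blinfun_apply (G \<phi>) y"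
  shows "DS_orbit G x t = y"
  unfolding DS_orbit_def graph_app_def
proof (rule the_equality)
  show "(x, y) \<in> dist_op G (dirac t)"
    using y by (simp add: dist_op_def dist_conv_dirac)
  fix z assume "(x, z) \<in> dist_op G (dirac t)"
  then have "blinfun_apply (G \<phi>) (z - y) = 0" if "\<phi> \<in> test_funs0" for \<phi>
    using y[OF that] that by (simp add: dist_op_def dist_conv_dirac blinfun.diff_right)
  then show "z = y"
    using C_DS_nondegenerate[OF G, of "z - y"] by simp
qed

lemma DS_generator_iff_vderiv:
  assumes "test_linear G"
  shows "(x, y) \<in> DS_generator G \<longleftrightarrow>
    (\<forall>\<phi>\<in>test_funs0. blinfun_apply (G (vderiv \<phi>)) x = - blinfun_apply (G \<phi>) y)"
proof -
  have "blinfun_apply (G (\<lambda>t. - vderiv \<phi> t)) x = blinfun_apply (G \<phi>) y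
      \<longleftrightarrow> blinfun_apply (G (vderiv \<phi>)) x = - blinfun_apply (G \<phi>) y" if "\<phi> \<in> test_funs0" for \<phi>
  proof -
    have "G (\<lambda>t. - vderiv \<phi> t) = - G (vderiv \<phi>)"
      using that by (intro test_linear_uminus[OF assms] test_funs_vderiv) (simp add: test_funs_on_def)
    then show ?thesis
      by (auto simp: blinfun.minus_left minus_equation_iff[of "blinfun_apply (G (vderiv \<phi>)) x"])
  qed
  then show ?thesis
    unfolding DS_generator_iff by (intro ball_cong refl)
qed

text \<open>The function u from \<open>Z_space\<close> is identified with the orbit by
  \<open>translation_orbit\<close> and thus hands its integral equation over to it.\<close>

lemma DS_orbit_solution:
  fixes x :: "'a::complex_banach"
  assumes G: "C_DS C G" and x: "x \<in> Z_space (DS_generator G)"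
  shows "\<And>t. t \<ge> 0 \<Longrightarrow> (integral {0..t} (DS_orbit G x), DS_orbit G x t - x) \<in> DS_generator G"
    and "DS_orbit G x 0 = x"
proof -
  have op: "op_distribution0 G" using G by (simp add: C_DS_def)
  note lin = op_distribution0D(1)[OF op] and bd = op_distribution0D(2)[OF op]
  obtain u :: "real \<Rightarrow> 'a" where u: "continuous_on {0..} u" "\<And>t. t \<ge> 0 \<Longrightarrow> (integral {0..t} u, u t - x) \<in> DS_generator G"
    using x unfolding Z_space_def by blast
  have orbit: "DS_orbit G x t = u t" if t: "t \<ge> 0" for t
  proof (rule DS_orbit_eqI[OF G])
    fix \<phi> assume \<phi>: "\<phi> \<in> test_funs0"
    show "blinfun_apply (G (\<lambda>s. \<phi> (s - t))) x = blinfun_apply (G \<phi>) (u t)"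
      by (rule translation_orbit[OF lin bd u(1) _ \<phi> t])
        (use u(2) in \<open>auto simp: DS_generator_iff_vderiv[OF lin]\<close>)
  qed
  show "(integral {0..t} (DS_orbit G x), DS_orbit G x t - x) \<in> DS_generator G" if t: "t \<ge> 0" for t
  proof -
    have "integral {0..t} (DS_orbit G x) = integral {0..t} u"
      by (intro integral_cong) (simp add: orbit)
    then show ?thesis using u(2)[OF t] orbit[OF t] by simp
  qed
  \<comment> \<open>At t = 0 the integral vanishes, so the equation says that
    \<open>G \<phi>\<close> annihilates u 0 - x for every \<phi> in
    \<open>test_funs0\<close>.\<close>
  have "u 0 - x = 0"
    by (rule C_DS_nondegenerate[OF G]) (use u(2)[of 0] in \<open>auto simp: DS_generator_iff_vderiv[OF lin]\<close>)
  then show "DS_orbit G x 0 = x" by (simp add: orbit)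
qed

lemma DS_bohr_mean_eigen:
  assumes G: "C_DS C G" and x: "x \<in> Z_space (DS_generator G)" and ap: "almost_periodic (DS_orbit G x)"
  shows "(bohr_mean r (DS_orbit G x), (\<i> * of_real r) *\<^sub>C bohr_mean r (DS_orbit G x)) \<in> DS_generator G"
proof -
  have op: "op_distribution0 G" using G by (simp add: C_DS_def)
  note lin = op_distribution0D(1)[OF op] and clin = op_distribution0D(3)[OF op]
  define f where "f = DS_orbit G x"
  have ap: "almost_periodic f" using ap by (simp add: f_def)
  then have f: "continuous_on {0..} f" by (simp add: almost_periodic_def)
  obtain M where M: "M > 0" "\<And>t. t \<ge> 0 \<Longrightarrow> norm (f t) \<le> M"
    using almost_periodic_bounded[OF ap] by blast
  have "blinfun_apply (G (vderiv \<phi>)) (bohr_mean r f) = - blinfun_apply (G \<phi>) ((\<i> * of_real r) *\<^sub>C bohr_mean r f)"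
    if \<phi>: "\<phi> \<in> test_funs0" for \<phi>
  proof -
    have \<phi>t: "\<phi> \<in> test_funs" using \<phi> by (simp add: test_funs_on_def)
    \<comment> \<open>The right side is continuously differentiable in t although f is only
      continuous; testing with \<phi> is what yields a derivative.\<close>
    have rel: "blinfun_apply (G \<phi>) (f t) = blinfun_apply (G \<phi>) x - blinfun_apply (G (vderiv \<phi>)) (integral {0..t} f)"
      if "t \<ge> 0" for t
      using DS_orbit_solution(1)[OF G x that] \<phi>
      by (simp add: DS_generator_iff_vderiv[OF lin] f_def blinfun.diff_right)
    have "((\<lambda>t. blinfun_apply (G \<phi>) (f t)) has_vector_derivative blinfun_apply (- G (vderiv \<phi>)) (f s)) (at s within {0..})"
      if s: "s \<ge> 0" for s
    proof -
      have "((\<lambda>t. blinfun_apply (G \<phi>) x - blinfun_apply (G (vderiv \<phi>)) (integral {0..t} f))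
          has_vector_derivative 0 - blinfun_apply (G (vderiv \<phi>)) (f s)) (at s within {0..})"
        by (intro has_vector_derivative_diff has_vector_derivative_const
            has_vector_derivative_blinfun_apply has_vector_derivative_integral_halfline f s)
      then have "((\<lambda>t. blinfun_apply (G \<phi>) x - blinfun_apply (G (vderiv \<phi>)) (integral {0..t} f))
          has_vector_derivative blinfun_apply (- G (vderiv \<phi>)) (f s)) (at s within {0..})"
        by (simp add: blinfun.minus_left)
      then show ?thesis
        by (rule has_vector_derivative_transform[rotated 2]) (use s rel in auto)
    qed
    moreover have "continuous_on {0..} (\<lambda>s. blinfun_apply (- G (vderiv \<phi>)) (f s))"
      by (intro continuous_intros f)
    moreover have "norm (blinfun_apply (G \<phi>) (f s)) \<le> norm (G \<phi>) * M" if "s \<ge> 0" for s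
      using M(2)[OF that] by (intro order_trans[OF norm_blinfun] mult_left_mono) auto
    ultimately have "((\<lambda>t. (1 / t) *\<^sub>R integral {0..t} (\<lambda>s. osc r s *\<^sub>C blinfun_apply (- G (vderiv \<phi>)) (f s)))
        \<longlongrightarrow> (\<i> * of_real r) *\<^sub>C blinfun_apply (G \<phi>) (bohr_mean r f)) at_top"
      by (rule mean_of_derivative[OF _ _ _ mean_clinear_image[OF clin[OF \<phi>t] ap]])
    moreover have "- G (vderiv \<phi>) \<in> bounded_clinear_ops"
      using clin[OF test_funs_vderiv[OF \<phi>t]] by (simp add: bounded_clinear_ops_def blinfun.minus_left)
    \<comment> \<open>The same means have two limits: one by parts, the other directly, since
      \<open>- G (vderiv \<phi>)\<close> commutes with means.\<close>
    ultimately have "blinfun_apply (- G (vderiv \<phi>)) (bohr_mean r f) = (\<i> * of_real r) *\<^sub>C blinfun_apply (G \<phi>) (bohr_mean r f)"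
      using tendsto_unique[OF _ mean_clinear_image[OF _ ap]] trivial_limit_at_top_linorder by blast
    then show ?thesis
      by (simp add: bounded_clinear_opsD[OF clin[OF \<phi>t]] blinfun.minus_left
          minus_equation_iff[of "blinfun_apply (G (vderiv \<phi>)) (bohr_mean r f)"])
  qed
  then show ?thesis
    by (simp add: DS_generator_iff_vderiv[OF lin] f_def)
qed

section \<open>The cosine case\<close>

text \<open>Applied to \<open>G \<phi>\<close> and \<open>dist_prim \<zeta> G \<phi>\<close> this is
  the first row of \<open>DCF_matrix\<close>; linearity and order bounds follow from those of the
  two entries.\<close>

definition row_op :: "('a::real_normed_vector \<Rightarrow>\<^sub>L 'b) \<Rightarrow> ('a \<Rightarrow>\<^sub>L 'b::real_normed_vector) \<Rightarrow> ('a \<times> 'a) \<Rightarrow>\<^sub>L 'b"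
  where "row_op S T = (S o\<^sub>L fst_blinfun) + (T o\<^sub>L snd_blinfun)"

lemma row_op_apply: "blinfun_apply (row_op S T) p = blinfun_apply S (fst p) + blinfun_apply T (snd p)"
  by (simp add: row_op_def blinfun.add_left)

lemma norm_row_op_le: "norm (row_op S T) \<le> norm S + norm T"
proof (rule norm_blinfun_bound)
  fix p :: "'a \<times> 'a"
  have "norm (blinfun_apply S (fst p)) \<le> norm S * norm p"
    by (intro order_trans[OF norm_blinfun] mult_left_mono) (simp_all add: norm_fst_le[of "fst p" "snd p", simplified])
  moreover have "norm (blinfun_apply T (snd p)) \<le> norm T * norm p"
    by (intro order_trans[OF norm_blinfun] mult_left_mono) (simp_all add: norm_snd_le[of "snd p" "fst p", simplified])
  ultimately show "norm (blinfun_apply (row_op S T) p) \<le> (norm S + norm T) * norm p"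
    unfolding row_op_apply by (intro order_trans[OF norm_triangle_ineq]) (simp add: algebra_simps)
qed simp

lemma test_linear_row_op:
  assumes "test_linear S" "test_linear T"
  shows "test_linear (\<lambda>\<phi>. row_op (S \<phi>) (T \<phi>))"
  unfolding test_linear_def
  by (intro ballI allI blinfun_eqI)
    (simp add: row_op_apply test_linearD[OF assms(1)] test_linearD[OF assms(2)] blinfun.add_left
      scaleC_blinfun.rep_eq scaleC_add_right)

lemma order_bounded_row_op:
  assumes "order_bounded S" "order_bounded T"
  shows "order_bounded (\<lambda>\<phi>. row_op (S \<phi>) (T \<phi>))"
  unfolding order_bounded_def
proof (intro allI)
  fix a b :: real
  obtain n M where M: "M > 0" "\<And>\<phi> B. \<phi> \<in> test_funs_on {a..b} \<Longrightarrow> B > 0 \<Longrightarrow>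
      (\<And>j t. j \<le> n \<Longrightarrow> cmod ((vderiv ^^ j) \<phi> t) \<le> B) \<Longrightarrow> norm (S \<phi>) \<le> M * B"
    using assms(1) unfolding order_bounded_def by metis
  obtain m K where K: "K > 0" "\<And>\<phi> B. \<phi> \<in> test_funs_on {a..b} \<Longrightarrow> B > 0 \<Longrightarrow>
      (\<And>j t. j \<le> m \<Longrightarrow> cmod ((vderiv ^^ j) \<phi> t) \<le> B) \<Longrightarrow> norm (T \<phi>) \<le> K * B"
    using assms(2) unfolding order_bounded_def by metis
  show "\<exists>n. \<exists>M>0. \<forall>\<phi>\<in>test_funs_on {a..b}. \<forall>B>0.
     (\<forall>j\<le>n. \<forall>t. cmod ((vderiv ^^ j) \<phi> t) \<le> B) \<longrightarrow> norm (row_op (S \<phi>) (T \<phi>)) \<le> M * B"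
  proof (intro exI[of _ "max n m"] exI[of _ "M + K"] conjI ballI allI impI)
    fix \<phi> and B :: real
    assume \<phi>: "\<phi> \<in> test_funs_on {a..b}" and B: "B > 0" "\<forall>j\<le>max n m. \<forall>t. cmod ((vderiv ^^ j) \<phi> t) \<le> B"
    have "norm (S \<phi>) \<le> M * B" "norm (T \<phi>) \<le> K * B"
      using B by (intro M(2)[OF \<phi>] K(2)[OF \<phi>]; simp)+
    then show "norm (row_op (S \<phi>) (T \<phi>)) \<le> (M + K) * B"
      using norm_row_op_le[of "S \<phi>" "T \<phi>"] by (simp add: algebra_simps)
  qed (use M K in simp)
qed

lemma C_DCF_nondegenerate:
  assumes "C_DCF \<zeta> C G"
    "\<And>\<phi>. \<phi> \<in> test_funs0 \<Longrightarrow> blinfun_apply (G \<phi>) x + blinfun_apply (dist_prim \<zeta> G \<phi>) y = 0"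
  shows "x = 0" "y = 0"
  using assms unfolding C_DCF_def by blast+

text \<open>The hypothesis is the first row of the matrix identity. The second row follows by using
  it for the derivative of \<phi>, where \<open>dist_prim_vderiv\<close> leads back to
  \<open>G\<close>; the term with \<open>C\<close> vanishes as \<phi> is 0 at 0.\<close>

lemma DCF_orbit_eqI:
  assumes G: "C_DCF \<zeta> C G" and lin: "test_linear G"
    and yz: "\<And>\<phi>. \<phi> \<in> test_funs0 \<Longrightarrow> blinfun_apply (dist_prim \<zeta> G (\<lambda>s. \<phi> (s - t))) x
        = blinfun_apply (G \<phi>) y + blinfun_apply (dist_prim \<zeta> G \<phi>) z"
  shows "DCF_orbit \<zeta> C G x t = z"
proof -
  have "graph_app (dist_op (DCF_matrix \<zeta> C G) (dirac t)) (0, x) = (y, z)"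
    unfolding graph_app_def
  proof (rule the_equality)
    have "blinfun_apply (DCF_matrix \<zeta> C G (\<lambda>s. \<phi> (s - t))) (0, x) = blinfun_apply (DCF_matrix \<zeta> C G \<phi>) (y, z)"
      if \<phi>: "\<phi> \<in> test_funs0" for \<phi>
    proof -
      have \<phi>t: "\<phi> \<in> test_funs" using \<phi> by (simp add: test_funs_on_def)
      have "blinfun_apply (G (\<lambda>s. \<phi> (s - t))) x = - blinfun_apply (dist_prim \<zeta> G (\<lambda>s. vderiv \<phi> (s - t))) x"
        using dist_prim_vderiv[OF test_funs_shift[OF \<phi>t], of \<zeta> G t]
        by (simp add: vderiv_shift1[OF test_funs_smooth[OF \<phi>t]] blinfun.minus_left)
      also have "\<dots> = - blinfun_apply (G (vderiv \<phi>)) y + blinfun_apply (G \<phi>) z"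
        by (simp add: yz[OF test_funs0_vderiv[OF \<phi>]] dist_prim_vderiv[OF \<phi>t] blinfun.minus_left)
      finally show ?thesis
        using yz[OF \<phi>]
        by (simp add: DCF_matrix_def block_op_apply dist_deriv_def dirac_def test_funs0_at_0[OF \<phi>] blinfun.minus_left)
    qed
    then show "((0, x), (y, z)) \<in> dist_op (DCF_matrix \<zeta> C G) (dirac t)"
      by (simp add: dist_op_def dist_conv_dirac)
    \<comment> \<open>For uniqueness the first row suffices, by the nondegeneracy condition of
      \<open>C_DCF\<close>.\<close>
    fix p assume p: "((0, x), p) \<in> dist_op (DCF_matrix \<zeta> C G) (dirac t)"
    obtain y' z' where p_eq: "p = (y', z')" by (cases p)
    have "blinfun_apply (G \<phi>) (y' - y) + blinfun_apply (dist_prim \<zeta> G \<phi>) (z' - z) = 0"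
      if \<phi>: "\<phi> \<in> test_funs0" for \<phi>
    proof -
      have "blinfun_apply (dist_prim \<zeta> G (\<lambda>s. \<phi> (s - t))) x
          = blinfun_apply (G \<phi>) y' + blinfun_apply (dist_prim \<zeta> G \<phi>) z'"
        using p \<phi> by (simp add: p_eq dist_op_def dist_conv_dirac DCF_matrix_def block_op_apply)
      then show ?thesis
        using yz[OF \<phi>] by (simp add: blinfun.diff_right algebra_simps)
    qed
    from C_DCF_nondegenerate[OF G this] show "p = (y, z)"
      by (simp add: p_eq)
  qed
  then show ?thesis by (simp add: DCF_orbit_def)
qed

lemma DCF_generator_iff:
  "(x, y) \<in> DCF_generator \<zeta> G \<longleftrightarrow>
    (\<forall>\<phi>\<in>test_funs0. blinfun_apply (dist_prim \<zeta> G \<phi>) y = - blinfun_apply (G (vderiv \<phi>)) x)"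
proof -
  have "dist_prim \<zeta> G (vderiv (vderiv \<phi>)) = - G (vderiv \<phi>)" if "\<phi> \<in> test_funs0" for \<phi>
    using that by (intro dist_prim_vderiv test_funs_vderiv) (simp add: test_funs_on_def)
  then show ?thesis
    by (auto simp: DCF_generator_def blinfun.minus_left)
qed

text \<open>Splitting t - s separates the upper limit from the integrand; in the derivative the two
  boundary terms \<open>s *\<^sub>R u s\<close> cancel.\<close>

lemma second_integral_has_vector_derivative:
  fixes u :: "real \<Rightarrow> 'a::banach"
  assumes u: "continuous_on {0..} u" and s: "s \<ge> 0"
  shows "((\<lambda>t. integral {0..t} (\<lambda>s. (t - s) *\<^sub>R u s)) has_vector_derivative integral {0..s} u) (at s within {0..})"
proof -
  have c: "continuous_on {0..} (\<lambda>s. s *\<^sub>R u s)" by (intro continuous_intros u)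
  have "((\<lambda>t. t *\<^sub>R integral {0..t} u - integral {0..t} (\<lambda>s. s *\<^sub>R u s))
      has_vector_derivative (s *\<^sub>R u s + 1 *\<^sub>R integral {0..s} u) - s *\<^sub>R u s) (at s within {0..})"
    by (intro has_vector_derivative_diff has_vector_derivative_scaleR DERIV_ident
        has_vector_derivative_integral_halfline u c s)
  moreover have "integral {0..t} (\<lambda>s. (t - s) *\<^sub>R u s) = t *\<^sub>R integral {0..t} u - integral {0..t} (\<lambda>s. s *\<^sub>R u s)" for t
  proof -
    have "integral {0..t} (\<lambda>s. t *\<^sub>R u s - s *\<^sub>R u s) = integral {0..t} (\<lambda>s. t *\<^sub>R u s) - integral {0..t} (\<lambda>s. s *\<^sub>R u s)"
      by (intro Henstock_Kurzweil_Integration.integral_diff integrable_on_halfline c continuous_intros u) auto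
    then show ?thesis by (simp add: scaleR_left_diff_distrib)
  qed
  ultimately show ?thesis by simp
qed

text \<open>The second order equation for u becomes a first order one for w = (U, u) started at (0,
  x). The integral of w is (V u, U), and membership in \<open>DCF_generator\<close> is exactly the
  relation that \<open>translation_orbit\<close> asks of the row operator L.\<close>

lemma DCF_orbit_solution:
  fixes x :: "'a::complex_banach"
  assumes \<zeta>: "zeta_fun \<zeta>" and G: "C_DCF \<zeta> C G" and x: "x \<in> Z2_space (DCF_generator \<zeta> G)"
  shows "\<And>t. t \<ge> 0 \<Longrightarrow>
      (integral {0..t} (\<lambda>s. (t - s) *\<^sub>R DCF_orbit \<zeta> C G x s), DCF_orbit \<zeta> C G x t - x) \<in> DCF_generator \<zeta> G"
    and "DCF_orbit \<zeta> C G x 0 = x"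
proof -
  have op: "op_distribution0 G" using G by (simp add: C_DCF_def)
  note lin = op_distribution0D(1)[OF op] and bd = op_distribution0D(2)[OF op]
  define V where "V = (\<lambda>u :: real \<Rightarrow> 'a. \<lambda>t. integral {0..t} (\<lambda>s. (t - s) *\<^sub>R u s))"
  obtain u where u: "continuous_on {0..} u" "\<And>t. t \<ge> 0 \<Longrightarrow> (V u t, u t - x) \<in> DCF_generator \<zeta> G"
    using x unfolding Z2_space_def V_def by blast
  define U where "U = (\<lambda>t. integral {0..t} u)"
  define w where "w = (\<lambda>t. (U t, u t))"
  define L where "L = (\<lambda>\<phi>. row_op (G \<phi>) (dist_prim \<zeta> G \<phi>))"
  have Uc: "continuous_on {0..} U"
    using has_vector_derivative_integral_halfline[OF u(1)] unfolding U_def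
    by (intro continuous_on_vector_derivative) auto
  have w: "continuous_on {0..} w"
    unfolding w_def by (intro continuous_intros Uc u)
  have L: "test_linear L" "order_bounded L"
    unfolding L_def using \<zeta> lin bd
    by (intro test_linear_row_op order_bounded_row_op dist_prim_test_linear dist_prim_order_bounded; simp)+
  have w_int: "integral {0..t} w = (V u t, U t)" if t: "t \<ge> 0" for t
  proof -
    have "((\<lambda>t. (V u t, U t)) has_vector_derivative w s) (at s within {0..t})" if "s \<in> {0..t}" for s
    proof -
      have "(V u has_vector_derivative U s) (at s within {0..t})"
        using second_integral_has_vector_derivative[OF u(1), of s] that
        by (auto simp: V_def U_def intro: has_vector_derivative_within_subset)
      moreover have "(U has_vector_derivative u s) (at s within {0..t})"
        using has_vector_derivative_integral_halfline[OF u(1), of s] that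
        by (auto simp: U_def intro: has_vector_derivative_within_subset)
      ultimately show ?thesis
        unfolding w_def by (rule has_vector_derivative_Pair)
    qed
    then have "(w has_integral (V u t, U t) - (V u 0, U 0)) {0..t}"
      by (rule fundamental_theorem_of_calculus[OF t])
    then show ?thesis
      by (simp add: integral_unique V_def U_def)
  qed
  have orbit: "DCF_orbit \<zeta> C G x t = u t" if t: "t \<ge> 0" for t
  proof (rule DCF_orbit_eqI[OF G lin])
    fix \<phi> assume \<phi>: "\<phi> \<in> test_funs0"
    have "blinfun_apply (L (\<lambda>s. \<phi> (s - t))) (0, x) = blinfun_apply (L \<phi>) (w t)"
    proof (rule translation_orbit[OF L w _ \<phi> t])
      fix \<psi> s assume \<psi>: "\<psi> \<in> test_funs0" and s: "(s::real) \<ge> 0"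
      have "\<psi> \<in> test_funs" using \<psi> by (simp add: test_funs_on_def)
      then show "blinfun_apply (L (vderiv \<psi>)) (integral {0..s} w) = - blinfun_apply (L \<psi>) (w s - (0, x))"
        using u(2)[OF s] \<psi> unfolding w_int[OF s]
        by (simp add: L_def row_op_apply w_def dist_prim_vderiv DCF_generator_iff blinfun.minus_left)
    qed
    then show "blinfun_apply (dist_prim \<zeta> G (\<lambda>s. \<phi> (s - t))) x
        = blinfun_apply (G \<phi>) (U t) + blinfun_apply (dist_prim \<zeta> G \<phi>) (u t)"
      by (simp add: L_def row_op_apply w_def)
  qed
  show "(integral {0..t} (\<lambda>s. (t - s) *\<^sub>R DCF_orbit \<zeta> C G x s), DCF_orbit \<zeta> C G x t - x) \<in> DCF_generator \<zeta> G"
    if t: "t \<ge> 0" for t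
  proof -
    have "integral {0..t} (\<lambda>s. (t - s) *\<^sub>R DCF_orbit \<zeta> C G x s) = V u t"
      unfolding V_def by (intro integral_cong) (simp add: orbit)
    then show ?thesis using u(2)[OF t] orbit[OF t] by simp
  qed
  have "u 0 - x = 0"
    by (rule C_DCF_nondegenerate(2)[OF G, of 0]) (use u(2)[of 0] in \<open>auto simp: DCF_generator_iff V_def\<close>)
  then show "DCF_orbit \<zeta> C G x 0 = x" by (simp add: orbit)
qed

lemma dist_prim_clinear:
  assumes \<zeta>: "zeta_fun \<zeta>" and op: "op_distribution0 G" and \<phi>: "\<phi> \<in> test_funs"
  shows "dist_prim \<zeta> G \<phi> \<in> bounded_clinear_ops"
proof -
  obtain a b where ab: "a \<le> -2" "-1 \<le> b" "\<phi> \<in> test_funs_on {a..b}"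
    using test_funs_obtain_wide[OF \<phi> \<phi>] .
  have "antideriv \<zeta> \<phi> \<in> test_funs"
    using antideriv_test_fun(1)[OF \<zeta> ab(3,1,2)] by (simp add: test_funs_on_def)
  from op_distribution0D(3)[OF op this] show ?thesis
    by (simp add: dist_prim_def bounded_clinear_ops_def blinfun.minus_left)
qed

lemma DCF_bohr_mean_eigen:
  assumes \<zeta>: "zeta_fun \<zeta>" and G: "C_DCF \<zeta> C G" and x: "x \<in> Z2_space (DCF_generator \<zeta> G)"
    and ap: "almost_periodic (DCF_orbit \<zeta> C G x)"
  shows "(bohr_mean r (DCF_orbit \<zeta> C G x), - (of_real r)\<^sup>2 *\<^sub>C bohr_mean r (DCF_orbit \<zeta> C G x)) \<in> DCF_generator \<zeta> G"
proof -
  have op: "op_distribution0 G" using G by (simp add: C_DCF_def)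
  note clin = op_distribution0D(3)[OF op]
  define f where "f = DCF_orbit \<zeta> C G x"
  have ap: "almost_periodic f" using ap by (simp add: f_def)
  then have f: "continuous_on {0..} f" by (simp add: almost_periodic_def)
  obtain M where M: "M > 0" "\<And>t. t \<ge> 0 \<Longrightarrow> norm (f t) \<le> M"
    using almost_periodic_bounded[OF ap] by blast
  define U where "U = (\<lambda>t. integral {0..t} f)"
  define V where "V = (\<lambda>t. integral {0..t} (\<lambda>s. (t - s) *\<^sub>R f s))"
  have "blinfun_apply (dist_prim \<zeta> G \<phi>) (- (of_real r)\<^sup>2 *\<^sub>C bohr_mean r f) = - blinfun_apply (G (vderiv \<phi>)) (bohr_mean r f)"
    if \<phi>: "\<phi> \<in> test_funs0" for \<phi>
  proof -
    have \<phi>t: "\<phi> \<in> test_funs" using \<phi> by (simp add: test_funs_on_def)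
    let ?H = "dist_prim \<zeta> G \<phi>" and ?K = "- G (vderiv \<phi>)"
    have H: "?H \<in> bounded_clinear_ops" by (rule dist_prim_clinear[OF \<zeta> op \<phi>t])
    have K: "?K \<in> bounded_clinear_ops"
      using clin[OF test_funs_vderiv[OF \<phi>t]] by (simp add: bounded_clinear_ops_def blinfun.minus_left)
    define y where "y = (\<lambda>t. blinfun_apply ?H x + blinfun_apply ?K (V t))"
    have y: "blinfun_apply ?H (f t) = y t" if "t \<ge> 0" for t
      using DCF_orbit_solution(1)[OF \<zeta> G x that, unfolded DCF_generator_iff, rule_format, OF \<phi>]
      by (simp add: f_def V_def y_def blinfun.diff_right blinfun.minus_left algebra_simps)
    have d1: "(y has_vector_derivative blinfun_apply ?K (U s)) (at s within {0..})" if s: "s \<ge> 0" for s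
    proof -
      have "(y has_vector_derivative 0 + blinfun_apply ?K (U s)) (at s within {0..})"
        unfolding y_def U_def V_def
        by (intro has_vector_derivative_add has_vector_derivative_const
            has_vector_derivative_blinfun_apply second_integral_has_vector_derivative f s)
      then show ?thesis by simp
    qed
    have d2: "((\<lambda>s. blinfun_apply ?K (U s)) has_vector_derivative blinfun_apply ?K (f s)) (at s within {0..})"
      if s: "s \<ge> 0" for s
      unfolding U_def by (intro has_vector_derivative_blinfun_apply has_vector_derivative_integral_halfline f s)
    have c2: "continuous_on {0..} (\<lambda>s. blinfun_apply ?K (f s))"
      by (intro continuous_intros f)
    have c1: "continuous_on {0..} (\<lambda>s. blinfun_apply ?K (U s))"
      using d2 by (intro continuous_on_vector_derivative) auto
    have b0: "norm (y s) \<le> norm ?H * M" if "s \<ge> 0" for s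
      unfolding y[OF that, symmetric]
      using M(2)[OF that] by (intro order_trans[OF norm_blinfun] mult_left_mono) auto
    have b2: "norm (blinfun_apply ?K (f s)) \<le> norm ?K * M" if "s \<ge> 0" for s
      using M(2)[OF that] by (intro order_trans[OF norm_blinfun] mult_left_mono) auto
    \<comment> \<open>U may grow, but \<open>?K (U s)\<close> is the derivative of y, which is
      bounded and has a bounded second derivative.\<close>
    have b1: "norm (blinfun_apply ?K (U s)) \<le> 2 * (norm ?H * M) + norm ?K * M" if "s \<ge> 0" for s
      by (rule derivative_bounded[OF d1 d2 b0 b2 that])
    have "integral {0..t} (\<lambda>s. osc r s *\<^sub>C blinfun_apply ?H (f s)) = integral {0..t} (\<lambda>s. osc r s *\<^sub>C y s)" for t
      by (intro integral_cong) (simp add: y)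
    then have "((\<lambda>t. (1 / t) *\<^sub>R integral {0..t} (\<lambda>s. osc r s *\<^sub>C y s)) \<longlongrightarrow> blinfun_apply ?H (bohr_mean r f)) at_top"
      using mean_clinear_image[OF H ap, of r] by simp
    \<comment> \<open>The inner use yields the mean of \<open>?K (U s)\<close>, which the outer one
      takes as its input.\<close>
    from mean_of_derivative[OF d2 c2 b1 mean_of_derivative[OF d1 c1 b0 this]]
    have "((\<lambda>t. (1 / t) *\<^sub>R integral {0..t} (\<lambda>s. osc r s *\<^sub>C blinfun_apply ?K (f s)))
        \<longlongrightarrow> (\<i> * of_real r) *\<^sub>C (\<i> * of_real r) *\<^sub>C blinfun_apply ?H (bohr_mean r f)) at_top"
      by simp
    then have "blinfun_apply ?K (bohr_mean r f) = (\<i> * of_real r) *\<^sub>C (\<i> * of_real r) *\<^sub>C blinfun_apply ?H (bohr_mean r f)"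
      using tendsto_unique[OF _ mean_clinear_image[OF K ap]] trivial_limit_at_top_linorder by blast
    also have "\<dots> = (- (of_real r)\<^sup>2) *\<^sub>C blinfun_apply ?H (bohr_mean r f)"
      unfolding scaleC_scaleC by (intro arg_cong2[where f = scaleC] refl) (simp add: power2_eq_square mult_ac)
    finally show ?thesis
      by (simp only: bounded_clinear_opsD[OF H] blinfun.minus_left)
  qed
  then show ?thesis
    by (simp add: DCF_generator_iff f_def)
qed

section \<open>Totality of the eigenvectors\<close>

text \<open>\<open>almost_periodic_value_in_closure\<close> puts x = f x 0 into the closure of the
  span. Only nonzero means are required in D, as 0 is no eigenvector; the span contains 0
  anyway.\<close>

lemma total_set_of_bohr_means:
  fixes f :: "'a::complex_banach \<Rightarrow> real \<Rightarrow> 'a"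
  assumes ap: "\<And>x. x \<in> E \<Longrightarrow> almost_periodic (f x)" and f0: "\<And>x. x \<in> E \<Longrightarrow> f x 0 = x"
    and mean: "\<And>x r. x \<in> E \<Longrightarrow> bohr_mean r (f x) \<noteq> 0 \<Longrightarrow> bohr_mean r (f x) \<in> D"
    and dense: "closure E = UNIV"
  shows "total_set D"
proof -
  let ?Y = "complex_vector.span D"
  have "E \<subseteq> closure ?Y"
  proof
    fix x assume x: "x \<in> E"
    have "bohr_mean r (f x) \<in> ?Y" for r
      using mean[OF x, of r] complex_vector.span_base complex_vector.span_zero
      by (cases "bohr_mean r (f x) = 0") auto
    from almost_periodic_value_in_closure[OF ap[OF x] complex_vector.subspace_span this]
    show "x \<in> closure ?Y" by (simp add: f0[OF x])
  qed
  then have "closure E \<subseteq> closure ?Y"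
    by (rule closure_minimal) simp
  then show ?thesis using dense by (auto simp: total_set_def)
qed

theorem theorem2p7:
  fixes C :: "'a::complex_banach \<Rightarrow>\<^sub>L 'a"
  assumes "C \<in> bounded_clinear_ops" and "inj (blinfun_apply C)"
  shows
    "(\<forall>G E'. C_DS C G \<and> complex_vector.subspace E' \<and> E' \<subseteq> Z_space (DS_generator G) \<and>
         DS_almost_periodic G E' \<longrightarrow>
       (\<forall>r. \<forall>x\<in>E'. (bohr_mean r (DS_orbit G x), (\<i> * of_real r) *\<^sub>C bohr_mean r (DS_orbit G x))
                     \<in> DS_generator G) \<and>
       (closure E' = UNIV \<longrightarrow>
         total_set (\<Union>r::real. eigenvectors (DS_generator G) (\<i> * of_real r))))
     \<and>
     (\<forall>\<zeta> G E'. zeta_fun \<zeta> \<and> C_DCF \<zeta> C G \<and> complex_vector.subspace E' \<and>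
         E' \<subseteq> Z2_space (DCF_generator \<zeta> G) \<and> DCF_almost_periodic \<zeta> C G E' \<longrightarrow>
       (\<forall>r. \<forall>x\<in>E'. (bohr_mean r (DCF_orbit \<zeta> C G x), - (of_real r)\<^sup>2 *\<^sub>C bohr_mean r (DCF_orbit \<zeta> C G x))
                     \<in> DCF_generator \<zeta> G) \<and>
       (closure E' = UNIV \<longrightarrow>
         total_set (\<Union>l\<in>{..0::real}. eigenvectors (DCF_generator \<zeta> G) (of_real l))))"
proof (intro conjI allI impI; elim conjE)
  fix G and E' :: "'a set"
  assume G: "C_DS C G" and E': "E' \<subseteq> Z_space (DS_generator G)" and "DS_almost_periodic G E'"
  then have ap: "almost_periodic (DS_orbit G x)" if "x \<in> E'" for x
    using that by (simp add: DS_almost_periodic_def)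
  show eigen: "\<forall>x\<in>E'. (bohr_mean r (DS_orbit G x), (\<i> * of_real r) *\<^sub>C bohr_mean r (DS_orbit G x)) \<in> DS_generator G"
    for r
    using E' by (blast intro: DS_bohr_mean_eigen[OF G] ap)
  show "total_set (\<Union>r::real. eigenvectors (DS_generator G) (\<i> * of_real r))" if "closure E' = UNIV"
    by (rule total_set_of_bohr_means[of E' "DS_orbit G", OF ap _ _ that])
      (use E' eigen in \<open>auto simp: eigenvectors_def intro: DS_orbit_solution(2)[OF G]\<close>)
next
  fix \<zeta> G and E' :: "'a set"
  assume \<zeta>: "zeta_fun \<zeta>" and G: "C_DCF \<zeta> C G" and E': "E' \<subseteq> Z2_space (DCF_generator \<zeta> G)"
    and "DCF_almost_periodic \<zeta> C G E'"
  then have ap: "almost_periodic (DCF_orbit \<zeta> C G x)" if "x \<in> E'" for x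
    using that by (simp add: DCF_almost_periodic_def)
  show eigen: "\<forall>x\<in>E'. (bohr_mean r (DCF_orbit \<zeta> C G x), - (of_real r)\<^sup>2 *\<^sub>C bohr_mean r (DCF_orbit \<zeta> C G x))
      \<in> DCF_generator \<zeta> G" for r
    using E' by (blast intro: DCF_bohr_mean_eigen[OF \<zeta> G] ap)
  show "total_set (\<Union>l\<in>{..0::real}. eigenvectors (DCF_generator \<zeta> G) (of_real l))" if "closure E' = UNIV"
  proof (rule total_set_of_bohr_means[of E' "DCF_orbit \<zeta> C G", OF ap _ _ that])
    fix x r assume x: "x \<in> E'" and "bohr_mean r (DCF_orbit \<zeta> C G x) \<noteq> 0"
    then have "bohr_mean r (DCF_orbit \<zeta> C G x) \<in> eigenvectors (DCF_generator \<zeta> G) (of_real (- r\<^sup>2))"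
      using eigen by (simp add: eigenvectors_def)
    then show "bohr_mean r (DCF_orbit \<zeta> C G x) \<in> (\<Union>l\<in>{..0}. eigenvectors (DCF_generator \<zeta> G) (of_real l))"
      by (intro UN_I[of "- r\<^sup>2"]) auto
  qed (use E' in \<open>auto intro: DCF_orbit_solution(2)[OF \<zeta> G]\<close>)
qed

end
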